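(* Let $d>0$ and $\hat{B}\in L^\infty(\mathbb{R}^2)$, and consider the viscous half Klein-Gordon equation $$\partial_t u-\lambda(\partial_x)u=B(u,u),\qquad t\ge 0,\ x\in\mathbb{R},\ u(t,x)\in\mathbb{C},\qquad (\ast)$$ where $\lambda(\partial_x)$ is the Fourier multiplier with symbol $\hat{\lambda}(k)=-dk^2-\mathrm{i}\sqrt{1+k^2}$ and $B$ is the bilinear form with $$\mathcal{F}(B(u_1,u_2))(k)=\int_{\mathbb{R}}\hat{B}(k,l)\,\hat{u}_1(k-l)\,\hat{u}_2(l)\,\mathrm{d}l .$$ There exist $\delta>0$ and $C>0$ such that, if the Fourier transform of $u_0\in L^2(\mathbb{R})$ satisfies $\hat{u}_0\in L^1(\mathbb{R})\cap L^\infty(\mathbb{R})$ with $$E_0:=\|\hat{u}_0\|_{L^1\cap L^\infty}\le\delta,$$ then there exists a unique global mild solution $u\in C\big([0,\infty),L^2(\mathbb{R})\big)$ of $(\ast)$ with initial condition $u_0$. Furthermore, the solution $u(t)$ satisfies $\hat{u}(t)\in L^1(\mathbb{R})\cap L^\infty(\mathbb{R})$ and obeys the estimates $$\|u(t)\|_{L^\infty}\le\|\hat{u}(t)\|_{L^1}\le C E_0(1+t)^{-\frac12},\qquad \|u(t)\|_{L^2}\le C E_0(1+t)^{-\frac14},\qquad \|\hat{u}(t)\|_{L^\infty}\le C E_0,$$ for all $t\ge 0$.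
   Context: The Fourier transform (in $x$) is $\hat{u}(k)=(\mathcal{F}u)(k)=\int_{\mathbb{R}}\mathrm{e}^{-\mathrm{i}kx}u(x)\,\mathrm{d}x$. The norm on $L^1\cap L^\infty$ is $\|f\|_{L^1\cap L^\infty}=\|f\|_{L^1}+\|f\|_{L^\infty}$ (or any equivalent norm). All functions are complex-valued. A (global) mild solution of $(\ast)$ with initial condition $u_0$ is a function $u\in C([0,\infty),L^2(\mathbb{R}))$ satisfying the Duhamel formula, in Fourier space, $$\hat{u}(t,k)=\mathrm{e}^{t\hat{\lambda}(k)}\hat{u}_0(k)+\int_0^t\mathrm{e}^{(t-s)\hat{\lambda}(k)}\,\mathcal{F}\big(B(u(s),u(s))\big)(k)\,\mathrm{d}s$$ for all $t\ge0$ and almost every $k\in\mathbb{R}$. The constants $\delta, C$ may depend on $d$ and $\hat{B}$. *)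

theory Defs
  imports "HOL-Probability.Essential_Supremum"
begin

text \<open>
  Elements of \<open>L\<^sup>p\<close> are represented by Borel functions; every almost-everywhere class of Lebesgue
  measurable functions has such a representative. Identities between \<open>L\<^sup>p\<close> functions are therefore
  stated almost everywhere. The norms below are meaningful on the corresponding space only.
\<close>

definition L1_space :: "(real \<Rightarrow> complex) set" where
  "L1_space = {f. integrable lborel f}"

definition L2_space :: "(real \<Rightarrow> complex) set" where
  "L2_space = {f. f \<in> borel_measurable lborel \<and> integrable lborel (\<lambda>x. (norm (f x))\<^sup>2)}"

definition Linf_space :: "('a::euclidean_space \<Rightarrow> complex) set" where
  "Linf_space = {f. f \<in> borel_measurable lborel \<and> esssup lborel (\<lambda>x. ereal (norm (f x))) < \<infinity>}"

definition L1_norm :: "(real \<Rightarrow> complex) \<Rightarrow> real" where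
  "L1_norm f = (LINT x|lborel. norm (f x))"

definition L2_norm :: "(real \<Rightarrow> complex) \<Rightarrow> real" where
  "L2_norm f = sqrt (LINT x|lborel. (norm (f x))\<^sup>2)"

definition Linf_norm :: "('a::euclidean_space \<Rightarrow> complex) \<Rightarrow> real" where
  "Linf_norm f = real_of_ereal (esssup lborel (\<lambda>x. ereal (norm (f x))))"

definition L1_Linf_norm :: "(real \<Rightarrow> complex) \<Rightarrow> real" where
  "L1_Linf_norm f = L1_norm f + Linf_norm f"

definition fourier_integral :: "(real \<Rightarrow> complex) \<Rightarrow> real \<Rightarrow> complex" where
  "fourier_integral f k = (LINT x|lborel. exp (- (\<i> * of_real (k * x))) * f x)"

text \<open>
  On \<open>L\<^sup>2\<close> the Fourier transform is the limit in \<open>L\<^sup>2\<close> of the Fourier integrals over \<open>[-R, R]\<close>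
  as \<open>R \<rightarrow> \<infinity>\<close>. The limit is stated with the extended nonnegative integral, so that it
  presupposes no integrability. By Plancherel it exists for every \<open>u\<close> in \<open>L\<^sup>2\<close> and is unique up
  to a null set; \<open>fourier u\<close> is a choice of representative.
\<close>

definition is_fourier :: "(real \<Rightarrow> complex) \<Rightarrow> (real \<Rightarrow> complex) \<Rightarrow> bool" where
  "is_fourier u v \<longleftrightarrow> v \<in> L2_space \<and>
     ((\<lambda>R. \<integral>\<^sup>+ k. ennreal ((norm (fourier_integral (\<lambda>x. indicator {-R..R} x *\<^sub>R u x) k - v k))\<^sup>2) \<partial>lborel)
        \<longlongrightarrow> 0) at_top"

definition fourier :: "(real \<Rightarrow> complex) \<Rightarrow> real \<Rightarrow> complex" where
  "fourier u = (SOME v. is_fourier u v)"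

definition symbol :: "real \<Rightarrow> real \<Rightarrow> complex" where
  "symbol d k = - of_real (d * k\<^sup>2) - \<i> * of_real (sqrt (1 + k\<^sup>2))"

text \<open>
  The Fourier transform of \<open>B(u\<^sub>1, u\<^sub>2)\<close>, through which the bilinear form is defined. For almost
  every \<open>k\<close> the section of the kernel is bounded, the integrand is integrable, and the value does
  not depend on the representatives of \<open>fourier u\<^sub>1\<close> and \<open>fourier u\<^sub>2\<close>.
\<close>

definition fourier_bilinear ::
  "(real \<times> real \<Rightarrow> complex) \<Rightarrow> (real \<Rightarrow> complex) \<Rightarrow> (real \<Rightarrow> complex) \<Rightarrow> real \<Rightarrow> complex" where
  "fourier_bilinear Bhat u\<^sub>1 u\<^sub>2 k = (LINT l|lborel. Bhat (k, l) * fourier u\<^sub>1 (k - l) * fourier u\<^sub>2 l)"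

definition continuous_L2 :: "(real \<Rightarrow> real \<Rightarrow> complex) \<Rightarrow> bool" where
  "continuous_L2 u \<longleftrightarrow> (\<forall>t\<ge>0. u t \<in> L2_space) \<and>
     (\<forall>t\<ge>0. ((\<lambda>s. L2_norm (\<lambda>x. u s x - u t x)) \<longlongrightarrow> 0) (at t within {0..}))"

text \<open>
  For \<open>u\<close> continuous into \<open>L\<^sup>2\<close>, the integrand of the Duhamel formula is continuous in \<open>s\<close> for
  almost every \<open>k\<close>. Taking \<open>t = 0\<close> gives \<open>u 0 = u\<^sub>0\<close> almost everywhere.
\<close>

definition mild_solution ::
  "real \<Rightarrow> (real \<times> real \<Rightarrow> complex) \<Rightarrow> (real \<Rightarrow> complex) \<Rightarrow> (real \<Rightarrow> real \<Rightarrow> complex) \<Rightarrow> bool" where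
  "mild_solution d Bhat u\<^sub>0 u \<longleftrightarrow> continuous_L2 u \<and>
     (\<forall>t\<ge>0. AE k in lborel.
        fourier (u t) k = exp (of_real t * symbol d k) * fourier u\<^sub>0 k
          + (LINT s:{0..t}|lborel. exp (of_real (t - s) * symbol d k) * fourier_bilinear Bhat (u s) (u s) k))"

end

theory Submission
  imports Defs "HOL-Probability.Probability"
begin

text \<open>
  The linear flow makes the \<open>L\<^sup>1\<close> norm of the Fourier transform decay like \<open>t\<close> to the power \<open>-1/2\<close>, and a quadratic, or even a
  cubic, nonlinearity is too strong for a direct perturbation argument: a product of \<open>n\<close> factors in
  Fourier space is only bounded by \<open>t\<close> to the power \<open>-(n - 1)/2\<close>, which is integrable in time for
  \<open>n \<ge> 4\<close> but not for \<open>n = 2\<close> or \<open>n = 3\<close>. What helps is oscillation. In the interaction picture the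
  quadratic terms carry the phase \<open>\<lambda>(k - l) + \<lambda>(l) - \<lambda>(k)\<close> and the cubic ones the analogous phase with
  three frequencies, and both phases are bounded away from zero: if a frequency is small, or if two
  frequencies have opposite signs, the dispersive part \<open>sqrt (1 + k\<^sup>2)\<close> is strictly subadditive by a
  definite amount, and otherwise the viscous part contributes (\<open>bilinear_phase_bound\<close>,
  \<open>trilinear_phase_bound\<close>). Integrating by parts in time twice therefore expresses the Duhamel integral
  of the quadratic term by boundary terms, which decay like products of solutions, and by a quartic
  integral, which converges. This is the a priori bound \<open>quadratic_duhamel_XB\<close>: the nonlinear term is of
  second order in the size \<open>M\<close> of the solution, with the same decay as the linear one.

  The bound is proved for a function whose forcing is quadratic in a second function, whose forcing is
  controlled in turn. Picard iterates have this structure, so that each of them satisfies the bound with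
  the same \<open>M\<close> (\<open>iterate_properties\<close>). They converge in an exponentially weighted norm
  (\<open>iterate_diff\<close>), and the limit is a global solution with the same decay.

  Since the kernel is only bounded, the analysis takes place on the Fourier side, with sup bounds and
  integrals of nonnegative functions. The transfer to physical space rests on Plancherel's theorem
  (\<open>Plancherel_L1_L2\<close>), the existence and isometry of the Fourier transform on \<open>L\<^sup>2\<close>
  (\<open>is_fourier_exists\<close>, \<open>fourier_isometry\<close>), and inversion (\<open>is_fourier_inverse_fourier_integral\<close>).
  Uniqueness holds among all mild solutions that are continuous with values in \<open>L\<^sup>2\<close>, by a weighted
  Gronwall argument that uses the smoothing of the heat factor (\<open>duhamel_unique\<close>).
\<close>

section \<open>Square integrable functions\<close>

lemma ennreal_finiteE:
  assumes "(x::ennreal) \<noteq> \<infinity>" obtains c where "x = ennreal c" "0 \<le> c"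
  using assms by (cases x) auto

lemma L2_spaceI:
  assumes "f \<in> borel_measurable borel" "(\<integral>\<^sup>+x. ennreal ((norm (f x))\<^sup>2) \<partial>lborel) < \<infinity>"
  shows "f \<in> L2_space"
  using assms unfolding L2_space_def by (auto simp: integrable_iff_bounded)

lemma L2_spaceD:
  assumes "f \<in> L2_space"
  shows "f \<in> borel_measurable borel" "integrable lborel (\<lambda>x. (norm (f x))\<^sup>2)"
  using assms unfolding L2_space_def by auto

lemma L2_norm_nonneg [simp]: "0 \<le> L2_norm f"
  unfolding L2_norm_def by simp

lemma L2_norm_sq: "(L2_norm f)\<^sup>2 = (LINT x|lborel. (norm (f x))\<^sup>2)"
  unfolding L2_norm_def by simp

lemma nn_integral_L2:
  assumes "f \<in> L2_space"
  shows "(\<integral>\<^sup>+x. ennreal ((norm (f x))\<^sup>2) \<partial>lborel) = ennreal ((L2_norm f)\<^sup>2)"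
  using L2_spaceD[OF assms] by (simp add: nn_integral_eq_integral L2_norm_sq)

lemma L2_norm_leI:
  assumes "(\<integral>\<^sup>+x. ennreal ((norm (f x))\<^sup>2) \<partial>lborel) \<le> ennreal (c\<^sup>2)" "0 \<le> c"
    "f \<in> borel_measurable borel"
  shows "f \<in> L2_space" "L2_norm f \<le> c"
proof -
  show *: "f \<in> L2_space"
    using assms by (intro L2_spaceI) (auto intro: le_less_trans)
  have "(L2_norm f)\<^sup>2 \<le> c\<^sup>2"
    using assms(1) unfolding nn_integral_L2[OF *] by simp
  then show "L2_norm f \<le> c" using assms(2) by (rule power2_le_imp_le)
qed

lemma L2_cmult:
  assumes "f \<in> L2_space" shows "(\<lambda>x. c * f x) \<in> L2_space"
  using assms unfolding L2_space_def by (auto simp: norm_mult power_mult_distrib)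

lemma L2_norm_cmult: "L2_norm (\<lambda>x. c * f x) = norm c * L2_norm f"
  unfolding L2_norm_def by (simp add: norm_mult power_mult_distrib real_sqrt_mult)

lemma L2_add:
  assumes "f \<in> L2_space" "g \<in> L2_space" shows "(\<lambda>x. f x + g x) \<in> L2_space"
proof -
  note [measurable] = L2_spaceD(1)[OF assms(1)] L2_spaceD(1)[OF assms(2)]
  have "integrable lborel (\<lambda>x. (norm (f x + g x))\<^sup>2)"
  proof (rule Bochner_Integration.integrable_bound)
    show "integrable lborel (\<lambda>x. 2 * (norm (f x))\<^sup>2 + 2 * (norm (g x))\<^sup>2)"
      using L2_spaceD(2)[OF assms(1)] L2_spaceD(2)[OF assms(2)] by simp
    have "(norm (f x + g x))\<^sup>2 \<le> 2 * (norm (f x))\<^sup>2 + 2 * (norm (g x))\<^sup>2" for x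
    proof -
      have "(norm (f x + g x))\<^sup>2 \<le> (norm (f x) + norm (g x))\<^sup>2"
        by (intro power_mono norm_triangle_ineq) simp
      also have "\<dots> \<le> 2 * (norm (f x))\<^sup>2 + 2 * (norm (g x))\<^sup>2"
        using sum_squares_bound[of "norm (f x)" "norm (g x)"] by (simp add: power2_sum)
      finally show ?thesis .
    qed
    then show "AE x in lborel. norm ((norm (f x + g x))\<^sup>2)
        \<le> norm (2 * (norm (f x))\<^sup>2 + 2 * (norm (g x))\<^sup>2)" by simp
  qed simp
  then show ?thesis unfolding L2_space_def by simp
qed

lemma L2_diff:
  assumes "f \<in> L2_space" "g \<in> L2_space" shows "(\<lambda>x. f x - g x) \<in> L2_space"
  using L2_add[OF assms(1) L2_cmult[OF assms(2), of "-1"]] by simp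

lemma L2_cnj: "f \<in> L2_space \<Longrightarrow> (\<lambda>x. cnj (f x)) \<in> L2_space"
  unfolding L2_space_def
  by (auto intro!: measurable_compose[OF _ borel_measurable_continuous_onI[of cnj]] continuous_intros)

lemma L2_norm_cnj: "L2_norm (\<lambda>x. cnj (f x)) = L2_norm f"
  unfolding L2_norm_def by simp

lemma L2_nn_Cauchy_Schwarz:
  assumes "f \<in> L2_space" "g \<in> L2_space"
  shows "(\<integral>\<^sup>+x. ennreal (norm (f x)) * ennreal (norm (g x)) \<partial>lborel) \<le> ennreal (L2_norm f * L2_norm g)"
proof -
  note [measurable] = L2_spaceD(1)[OF assms(1)] L2_spaceD(1)[OF assms(2)]
  let ?I = "\<integral>\<^sup>+x. ennreal (norm (f x)) * ennreal (norm (g x)) \<partial>lborel"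
  have "?I\<^sup>2 \<le> (\<integral>\<^sup>+x. (ennreal (norm (f x)))\<^sup>2 \<partial>lborel) * (\<integral>\<^sup>+x. (ennreal (norm (g x)))\<^sup>2 \<partial>lborel)"
    by (rule Cauchy_Schwarz_nn_integral) auto
  also have "\<dots> = ennreal ((L2_norm f * L2_norm g)\<^sup>2)"
    by (simp add: ennreal_power nn_integral_L2 assms power_mult_distrib ennreal_mult)
  finally have le: "?I\<^sup>2 \<le> ennreal ((L2_norm f * L2_norm g)\<^sup>2)" .
  then have "?I\<^sup>2 < \<infinity>" by (rule le_less_trans) simp
  then have "?I \<noteq> \<infinity>" by (auto simp: power2_eq_square)
  then obtain r where r: "?I = ennreal r" "0 \<le> r" by (rule ennreal_finiteE)
  have "r\<^sup>2 \<le> (L2_norm f * L2_norm g)\<^sup>2"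
    using le r by (simp add: ennreal_power)
  then have "r \<le> L2_norm f * L2_norm g" by (rule power2_le_imp_le) simp
  then show ?thesis using r by (simp add: ennreal_leI)
qed

lemma L2_mult_integrable:
  assumes "f \<in> L2_space" "g \<in> L2_space"
  shows "integrable lborel (\<lambda>x. f x * g x)"
proof -
  note [measurable] = L2_spaceD(1)[OF assms(1)] L2_spaceD(1)[OF assms(2)]
  show ?thesis
    using le_less_trans[OF L2_nn_Cauchy_Schwarz[OF assms] ennreal_less_top]
    by (simp add: integrable_iff_bounded norm_mult ennreal_mult)
qed

lemma L2_Cauchy_Schwarz:
  assumes "f \<in> L2_space" "g \<in> L2_space"
  shows "(LINT x|lborel. norm (f x * g x)) \<le> L2_norm f * L2_norm g"
    and "norm (LINT x|lborel. f x * g x) \<le> L2_norm f * L2_norm g"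
proof -
  have i: "integrable lborel (\<lambda>x. norm (f x * g x))"
    using L2_mult_integrable[OF assms] by simp
  have "ennreal (LINT x|lborel. norm (f x * g x)) = (\<integral>\<^sup>+x. ennreal (norm (f x * g x)) \<partial>lborel)"
    by (rule nn_integral_eq_integral[symmetric]) (use i in auto)
  also have "\<dots> \<le> ennreal (L2_norm f * L2_norm g)"
    using L2_nn_Cauchy_Schwarz[OF assms] by (simp add: norm_mult ennreal_mult)
  finally show *: "(LINT x|lborel. norm (f x * g x)) \<le> L2_norm f * L2_norm g"
    by (simp add: ennreal_le_iff)
  show "norm (LINT x|lborel. f x * g x) \<le> L2_norm f * L2_norm g"
    using integral_norm_bound[of lborel "\<lambda>x. f x * g x"] * by linarith
qed

lemma L2_norm_triangle:
  assumes "f \<in> L2_space" "g \<in> L2_space"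
  shows "L2_norm (\<lambda>x. f x + g x) \<le> L2_norm f + L2_norm g"
proof (rule power2_le_imp_le)
  note fg = L2_spaceD(2)[OF assms(1)] L2_spaceD(2)[OF assms(2)]
  have i: "integrable lborel (\<lambda>x. norm (f x * g x))"
    using L2_mult_integrable[OF assms] by simp
  have "(L2_norm (\<lambda>x. f x + g x))\<^sup>2 = (LINT x|lborel. (norm (f x + g x))\<^sup>2)"
    by (rule L2_norm_sq)
  also have "\<dots> \<le> (LINT x|lborel. (norm (f x))\<^sup>2 + (norm (g x))\<^sup>2 + 2 * norm (f x * g x))"
  proof (rule integral_mono)
    show "integrable lborel (\<lambda>x. (norm (f x + g x))\<^sup>2)"
      using L2_add[OF assms] by (rule L2_spaceD)
    show "integrable lborel (\<lambda>x. (norm (f x))\<^sup>2 + (norm (g x))\<^sup>2 + 2 * norm (f x * g x))"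
      using fg i by simp
    fix x
    have "(norm (f x + g x))\<^sup>2 \<le> (norm (f x) + norm (g x))\<^sup>2"
      by (intro power_mono norm_triangle_ineq) simp
    then show "(norm (f x + g x))\<^sup>2 \<le> (norm (f x))\<^sup>2 + (norm (g x))\<^sup>2 + 2 * norm (f x * g x)"
      by (simp add: power2_sum norm_mult)
  qed
  also have "\<dots> = (L2_norm f)\<^sup>2 + (L2_norm g)\<^sup>2 + 2 * (LINT x|lborel. norm (f x * g x))"
    using fg i by (simp add: L2_norm_sq)
  also have "\<dots> \<le> (L2_norm f)\<^sup>2 + (L2_norm g)\<^sup>2 + 2 * (L2_norm f * L2_norm g)"
    using L2_Cauchy_Schwarz(1)[OF assms] by simp
  finally show "(L2_norm (\<lambda>x. f x + g x))\<^sup>2 \<le> (L2_norm f + L2_norm g)\<^sup>2"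
    by (simp add: power2_sum)
qed simp

lemma L2_norm_minus_commute: "L2_norm (\<lambda>x. f x - g x) = L2_norm (\<lambda>x. g x - f x)"
  unfolding L2_norm_def by (simp add: norm_minus_commute)

lemma L2_norm_diff_triangle:
  assumes "f \<in> L2_space" "g \<in> L2_space"
  shows "\<bar>L2_norm f - L2_norm g\<bar> \<le> L2_norm (\<lambda>x. f x - g x)"
  using L2_norm_triangle[OF L2_diff[OF assms] assms(2)]
    L2_norm_triangle[OF L2_diff[OF assms(2,1)] assms(1)]
    L2_norm_minus_commute[of f g] by simp

lemma L2_norm_eq_0:
  assumes "f \<in> L2_space" "L2_norm f = 0"
  shows "AE x in lborel. f x = 0"
proof -
  have "(LINT x|lborel. (norm (f x))\<^sup>2) = 0" using assms(2) L2_norm_sq[of f] by simp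
  then have "AE x in lborel. (norm (f x))\<^sup>2 = 0"
    using integral_nonneg_eq_0_iff_AE[OF L2_spaceD(2)[OF assms(1)]] by simp
  then show ?thesis by eventually_elim simp
qed

lemma L2_norm_cong_AE:
  assumes "AE x in lborel. f x = g x" "f \<in> borel_measurable borel" "g \<in> borel_measurable borel"
  shows "L2_norm f = L2_norm g"
proof -
  have "(LINT x|lborel. (norm (f x))\<^sup>2) = (LINT x|lborel. (norm (g x))\<^sup>2)"
    using assms by (intro integral_cong_AE) auto
  then show ?thesis unfolding L2_norm_def by simp
qed

text \<open>
  Along a subsequence whose increments have norm at most \<open>2\<^sup>-\<^sup>k\<close>, the series of the squared increments
  weighted by \<open>2\<^sup>k\<close> has a finite integral. The increments therefore decay geometrically almost
  everywhere, and Fatou's lemma turns the pointwise limit into a limit in the norm.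
\<close>

lemma L2_complete:
  assumes f: "\<And>n. f n \<in> L2_space"
    and cau: "\<And>e. e > 0 \<Longrightarrow> \<exists>N. \<forall>m\<ge>N. \<forall>n\<ge>N. L2_norm (\<lambda>x. f m x - f n x) \<le> e"
  obtains g where "g \<in> L2_space" "(\<lambda>n. L2_norm (\<lambda>x. f n x - g x)) \<longlonglongrightarrow> 0"
proof -
  have [measurable]: "f n \<in> borel_measurable borel" for n using L2_spaceD f by blast
  have "\<exists>N. \<forall>m\<ge>N. \<forall>n\<ge>N. L2_norm (\<lambda>x. f m x - f n x) \<le> (1/2)^k" for k :: nat
    using cau[of "(1/2)^k"] by simp
  then obtain N where N: "\<And>k m n. m \<ge> N k \<Longrightarrow> n \<ge> N k \<Longrightarrow> L2_norm (\<lambda>x. f m x - f n x) \<le> (1/2)^k"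
    by metis
  define r where "r k = (\<Sum>j\<le>k. N j)" for k
  have rN: "r k \<ge> N k" for k unfolding r_def by (simp add: member_le_sum)
  have rS: "r (Suc k) \<ge> N k" for k using rN[of k] unfolding r_def by simp
  define D where "D k x = f (r (Suc k)) x - f (r k) x" for k x
  have [measurable]: "D k \<in> borel_measurable borel" for k unfolding D_def by measurable
  have DL: "D k \<in> L2_space" for k unfolding D_def by (intro L2_diff f)
  have Dn: "L2_norm (D k) \<le> (1/2)^k" for k unfolding D_def by (intro N rN rS)
  have "(\<integral>\<^sup>+x. (\<Sum>k. ennreal (2^k * (norm (D k x))\<^sup>2)) \<partial>lborel)
      = (\<Sum>k. \<integral>\<^sup>+x. ennreal (2^k * (norm (D k x))\<^sup>2) \<partial>lborel)"
    by (rule nn_integral_suminf) measurable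
  also have "\<dots> \<le> (\<Sum>k. ennreal ((1/2)^k))"
  proof (rule suminf_le)
    fix k
    have "(\<integral>\<^sup>+x. ennreal (2^k * (norm (D k x))\<^sup>2) \<partial>lborel)
        = ennreal (2^k) * (\<integral>\<^sup>+x. ennreal ((norm (D k x))\<^sup>2) \<partial>lborel)"
      by (subst nn_integral_cmult[symmetric]) (auto simp: ennreal_mult)
    also have "\<dots> = ennreal (2^k * (L2_norm (D k))\<^sup>2)"
      by (simp add: nn_integral_L2 DL ennreal_mult)
    also have "\<dots> \<le> ennreal (2^k * ((1/2)^k)\<^sup>2)"
      by (intro ennreal_leI mult_left_mono power_mono Dn) auto
    also have "(2::real)^k * ((1/2)^k)\<^sup>2 = (1/2)^k"
      by (simp add: power2_eq_square power_divide)
    finally show "(\<integral>\<^sup>+x. ennreal (2^k * (norm (D k x))\<^sup>2) \<partial>lborel) \<le> ennreal ((1/2)^k)" .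
  qed auto
  also have "\<dots> < \<infinity>"
    by (subst suminf_ennreal2) (auto simp: summable_geometric)
  finally have fin: "(\<integral>\<^sup>+x. (\<Sum>k. ennreal (2^k * (norm (D k x))\<^sup>2)) \<partial>lborel) < \<infinity>" .
  have ae: "AE x in lborel. convergent (\<lambda>k. f (r k) x)"
  proof -
    have "AE x in lborel. (\<Sum>k. ennreal (2^k * (norm (D k x))\<^sup>2)) \<noteq> \<infinity>"
      by (rule nn_integral_PInf_AE) (use fin in auto)
    then show ?thesis
    proof eventually_elim
      case (elim x)
      then obtain c where c: "(\<Sum>k. ennreal (2^k * (norm (D k x))\<^sup>2)) = ennreal c" "c \<ge> 0"
        by (rule ennreal_finiteE)
      have bd: "norm (D k x) \<le> sqrt c * (1 / sqrt 2)^k" for k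
      proof -
        have "ennreal (2^k * (norm (D k x))\<^sup>2) \<le> ennreal c"
          using sum_le_suminf[of "\<lambda>k. ennreal (2^k * (norm (D k x))\<^sup>2)" "{k}", OF summableI] unfolding c(1)
          by simp
        then have "2^k * (norm (D k x))\<^sup>2 \<le> c" using c(2) by (simp add: ennreal_le_iff)
        then have "(norm (D k x))\<^sup>2 \<le> c * (1/2)^k" by (simp add: field_simps)
        then have "norm (D k x) \<le> sqrt (c * (1/2)^k)" by (rule real_le_rsqrt)
        then show ?thesis by (simp add: real_sqrt_mult real_sqrt_power real_sqrt_divide)
      qed
      have "summable (\<lambda>k. sqrt c * (1 / sqrt 2)^k)"
        by (intro summable_mult summable_geometric) simp
      then have "summable (\<lambda>k. D k x)"
        by (rule summable_comparison_test'[where N=0]) (rule bd)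
      then have "convergent (\<lambda>n. \<Sum>k<n. D k x)"
        by (simp add: summable_iff_convergent)
      moreover have "(\<Sum>k<n. D k x) = f (r n) x - f (r 0) x" for n
        unfolding D_def by (rule sum_lessThan_telescope)
      ultimately have "convergent (\<lambda>n. f (r n) x - f (r 0) x)" by simp
      then have "convergent (\<lambda>n. (f (r n) x - f (r 0) x) + f (r 0) x)"
        by (intro convergent_add convergent_const)
      then show ?case by simp
    qed
  qed
  define g where "g x = lim (\<lambda>k. f (r k) x)" for x
  have [measurable]: "g \<in> borel_measurable borel"
    unfolding g_def by (rule borel_measurable_lim_metric) measurable
  have lim: "AE x in lborel. (\<lambda>k. f (r k) x) \<longlonglongrightarrow> g x"
    using ae by eventually_elim (simp add: g_def convergent_LIMSEQ_iff)
  have close: "(\<integral>\<^sup>+x. ennreal ((norm (f n x - g x))\<^sup>2) \<partial>lborel) \<le> ennreal (((1/2)^k)\<^sup>2)"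
    if n: "n \<ge> N k" for n k
  proof -
    have "(\<integral>\<^sup>+x. ennreal ((norm (f n x - g x))\<^sup>2) \<partial>lborel)
        = (\<integral>\<^sup>+x. liminf (\<lambda>j. ennreal ((norm (f n x - f (r j) x))\<^sup>2)) \<partial>lborel)"
    proof (rule nn_integral_cong_AE)
      show "AE x in lborel. ennreal ((norm (f n x - g x))\<^sup>2)
          = liminf (\<lambda>j. ennreal ((norm (f n x - f (r j) x))\<^sup>2))"
        using lim
      proof eventually_elim
        case (elim x)
        have "(\<lambda>j. ennreal ((norm (f n x - f (r j) x))\<^sup>2)) \<longlonglongrightarrow> ennreal ((norm (f n x - g x))\<^sup>2)"
          by (intro tendsto_ennrealI tendsto_intros elim)
        then show ?case by (metis lim_imp_Liminf trivial_limit_sequentially)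
      qed
    qed
    also have "\<dots> \<le> liminf (\<lambda>j. \<integral>\<^sup>+x. ennreal ((norm (f n x - f (r j) x))\<^sup>2) \<partial>lborel)"
      by (rule nn_integral_liminf) measurable
    also have "\<dots> \<le> liminf (\<lambda>j. ennreal (((1/2)^k)\<^sup>2))"
    proof (rule Liminf_mono, rule eventually_sequentiallyI)
      fix j assume "j \<ge> k"
      then have "r j \<ge> r k" unfolding r_def by (intro sum_mono2) auto
      then have "r j \<ge> N k" using rN[of k] by simp
      have "(\<integral>\<^sup>+x. ennreal ((norm (f n x - f (r j) x))\<^sup>2) \<partial>lborel)
          = ennreal ((L2_norm (\<lambda>x. f n x - f (r j) x))\<^sup>2)"
        by (rule nn_integral_L2) (intro L2_diff f)
      also have "\<dots> \<le> ennreal (((1/2)^k)\<^sup>2)"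
        by (intro ennreal_leI power_mono N n \<open>r j \<ge> N k\<close>) simp
      finally show "(\<integral>\<^sup>+x. ennreal ((norm (f n x - f (r j) x))\<^sup>2) \<partial>lborel) \<le> ennreal (((1/2)^k)\<^sup>2)" .
    qed
    also have "\<dots> = ennreal (((1/2)^k)\<^sup>2)" by (simp add: Liminf_const)
    finally show ?thesis .
  qed
  have cl: "(\<lambda>x. f n x - g x) \<in> L2_space" "L2_norm (\<lambda>x. f n x - g x) \<le> (1/2)^k" if "n \<ge> N k" for n k
    using L2_norm_leI[OF close[OF that]] by auto
  have "g \<in> L2_space"
    using L2_diff[OF f[of "N 0"] cl(1)[of 0 "N 0"]] by simp
  moreover have "(\<lambda>n. L2_norm (\<lambda>x. f n x - g x)) \<longlonglongrightarrow> 0"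
  proof (rule LIMSEQ_I)
    fix e :: real assume "e > 0"
    then obtain k where "(1/2::real)^k < e" using real_arch_pow_inv[of e "1/2"] by auto
    then show "\<exists>no. \<forall>n\<ge>no. norm (L2_norm (\<lambda>x. f n x - g x) - 0) < e"
      using cl(2)[of k] by (intro exI[of _ "N k"]) (auto intro: le_less_trans)
  qed
  ultimately show ?thesis by (rule that)
qed

section \<open>Continuity of translations\<close>

lemma ennreal_tendsto_0I:
  fixes f :: "'a \<Rightarrow> ennreal"
  assumes "\<And>e::real. e > 0 \<Longrightarrow> eventually (\<lambda>n. f n \<le> ennreal e) F"
  shows "(f \<longlongrightarrow> 0) F"
proof (rule order_tendstoI)
  fix a :: ennreal assume "0 < a"
  then obtain b where b: "0 < b" "b < a" using dense by blast
  then have "b \<noteq> \<infinity>" by auto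
  then obtain e where e: "b = ennreal e" "0 \<le> e" by (rule ennreal_finiteE)
  then have "e > 0" using b by (cases "e = 0") auto
  show "eventually (\<lambda>n. f n < a) F"
    using assms[OF \<open>e > 0\<close>] by eventually_elim (use b e in auto)
qed auto

lemma ennreal_tendsto_0D:
  fixes f :: "'a \<Rightarrow> ennreal"
  assumes "(f \<longlongrightarrow> 0) F" "e > (0::real)"
  shows "eventually (\<lambda>n. f n \<le> ennreal e) F"
proof -
  have "eventually (\<lambda>n. f n < ennreal e) F"
    using assms by (intro order_tendstoD(2)[OF assms(1)]) simp
  then show ?thesis by eventually_elim auto
qed

lemma nn_integral_translate:
  fixes f :: "real \<Rightarrow> ennreal"
  assumes [measurable]: "f \<in> borel_measurable borel"
  shows "(\<integral>\<^sup>+x. f (x + z) \<partial>lborel) = (\<integral>\<^sup>+x. f x \<partial>lborel)"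
  using nn_integral_real_affine[of f 1 z] by (simp add: add.commute)

text \<open>
  A point of an open set stays in the set under small shifts. The part of \<open>U\<close> that a shift moves out of
  \<open>U\<close> thus shrinks to a null set; by invariance of the measure, the part that moves in is governed by
  the opposite shift.
\<close>

lemma open_translation_continuous:
  fixes U :: "real set"
  assumes U: "open U" and fin: "emeasure lborel U < \<infinity>" and z: "z \<longlonglongrightarrow> 0"
  shows "(\<lambda>n. \<integral>\<^sup>+x. ennreal \<bar>indicator U (x + z n) - indicator U x\<bar> \<partial>lborel) \<longlonglongrightarrow> 0"
proof -
  have [measurable]: "U \<in> sets borel" using U by simp
  have half: "(\<lambda>n. \<integral>\<^sup>+x. indicator U x * (1 - indicator U (x + y n)) \<partial>lborel) \<longlonglongrightarrow> 0"
    if y: "y \<longlonglongrightarrow> 0" for y :: "nat \<Rightarrow> real"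
  proof -
    have "(\<lambda>n. \<integral>\<^sup>+x. indicator U x * (1 - indicator U (x + y n)) \<partial>lborel) \<longlonglongrightarrow> (\<integral>\<^sup>+x. 0 \<partial>(lborel::real measure))"
    proof (rule nn_integral_dominated_convergence[where w="indicator U"])
      show "(\<integral>\<^sup>+x. indicator U x \<partial>lborel) < \<infinity>" using fin by simp
      show "AE x in lborel. (\<lambda>n. indicator U x * (1 - indicator U (x + y n)) :: ennreal) \<longlonglongrightarrow> 0"
      proof (rule AE_I2)
        fix x :: real
        show "(\<lambda>n. indicator U x * (1 - indicator U (x + y n)) :: ennreal) \<longlonglongrightarrow> 0"
        proof (cases "x \<in> U")
          case True
          have "(\<lambda>n. x + y n) \<longlonglongrightarrow> x + 0" by (intro tendsto_intros y)
          then have "eventually (\<lambda>n. x + y n \<in> U) sequentially"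
            using U True by (intro topological_tendstoD) auto
          then have "eventually (\<lambda>n. indicator U x * (1 - indicator U (x + y n)) = (0::ennreal)) sequentially"
            by eventually_elim simp
          then show ?thesis by (rule tendsto_eventually)
        qed simp
      qed
      show "AE x in lborel. indicator U x * (1 - indicator U (x + y n)) \<le> (indicator U x :: ennreal)" for n
        by (auto simp: indicator_def)
    qed measurable
    then show ?thesis by simp
  qed
  have eq: "(\<integral>\<^sup>+x. ennreal \<bar>indicator U (x + w) - indicator U x\<bar> \<partial>lborel)
      = (\<integral>\<^sup>+x. indicator U x * (1 - indicator U (x + w)) \<partial>lborel)
        + (\<integral>\<^sup>+x. indicator U x * (1 - indicator U (x + - w)) \<partial>lborel)" for w
  proof -
    have "(\<integral>\<^sup>+x. ennreal \<bar>indicator U (x + w) - indicator U x\<bar> \<partial>lborel)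
        = (\<integral>\<^sup>+x. indicator U x * (1 - indicator U (x + w))
            + indicator U (x + w) * (1 - indicator U (x + w + - w)) \<partial>lborel)"
      by (intro nn_integral_cong) (auto simp: indicator_def)
    also have "\<dots> = (\<integral>\<^sup>+x. indicator U x * (1 - indicator U (x + w)) \<partial>lborel)
        + (\<integral>\<^sup>+x. indicator U (x + w) * (1 - indicator U (x + w + - w)) \<partial>lborel)"
      by (rule nn_integral_add) measurable
    also have "(\<integral>\<^sup>+x. indicator U (x + w) * (1 - indicator U (x + w + - w)) \<partial>lborel)
        = (\<integral>\<^sup>+x. indicator U x * (1 - indicator U (x + - w)) \<partial>lborel :: ennreal)"
      by (rule nn_integral_translate) measurable
    finally show ?thesis .
  qed
  have "(\<lambda>n. - z n) \<longlonglongrightarrow> 0" using tendsto_minus[OF z] by simp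
  from tendsto_add[OF half[OF z] half[OF this]] show ?thesis unfolding eq by simp
qed

text \<open>
  The property is additive and survives dominated limits, so that only indicators of sets of finite
  measure matter; outer regularity replaces such a set by an open one.
\<close>

lemma L1_translation_continuous:
  fixes f :: "real \<Rightarrow> complex"
  assumes "integrable lborel f" and "z \<longlonglongrightarrow> 0"
  shows "(\<lambda>n. \<integral>\<^sup>+x. ennreal (norm (f (x + z n) - f x)) \<partial>lborel) \<longlonglongrightarrow> 0"
  using assms(1)
proof (induction rule: integrable_induct)
  case (base A c)
  then have [measurable]: "A \<in> sets borel" by simp
  show ?case
  proof (rule ennreal_tendsto_0I)
    fix e :: real assume e: "e > 0"
    \<comment> \<open>The error splits into two copies of \<open>U - A\<close> and the effect of the shift on \<open>U\<close>; the summand 1 covers \<open>c = 0\<close>.\<close>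
    define r where "r = e / (3 * (norm c + 1))"
    have r: "r > 0" unfolding r_def using e by (simp add: add_nonneg_pos)
    obtain U where U: "open U" "A \<subseteq> U" "emeasure lborel (U - A) < ennreal r"
      using outer_regular_lborel[OF _ r, of A] by auto
    have [measurable]: "U \<in> sets borel" using U by simp
    have "emeasure lborel U = emeasure lborel (A \<union> (U - A))" using U(2) by (simp add: Un_absorb1)
    also have "\<dots> \<le> emeasure lborel A + emeasure lborel (U - A)"
      by (intro emeasure_subadditive) auto
    also have "\<dots> < \<infinity>" using base U(3) by (auto simp: less_top[symmetric])
    finally have "emeasure lborel U < \<infinity>" .
    from open_translation_continuous[OF U(1) this assms(2)]
    have "eventually (\<lambda>n. (\<integral>\<^sup>+x. ennreal \<bar>indicator U (x + z n) - indicator U x\<bar> \<partial>lborel) \<le> ennreal r) sequentially"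
      using r by (rule ennreal_tendsto_0D)
    then show "eventually (\<lambda>n. (\<integral>\<^sup>+x. ennreal (norm (indicator A (x + z n) *\<^sub>R c - indicator A x *\<^sub>R c)) \<partial>lborel) \<le> ennreal e) sequentially"
    proof eventually_elim
      case (elim n)
      have "(\<integral>\<^sup>+x. ennreal (norm (indicator A (x + z n) *\<^sub>R c - indicator A x *\<^sub>R c)) \<partial>lborel)
          \<le> (\<integral>\<^sup>+x. ennreal (norm c) * (indicator (U - A) (x + z n) + indicator (U - A) x
              + ennreal \<bar>indicator U (x + z n) - indicator U x\<bar>) \<partial>lborel)"
        using U(2) by (intro nn_integral_mono) (auto simp: indicator_def)
      also have "\<dots> = ennreal (norm c) * ((\<integral>\<^sup>+x. indicator (U - A) (x + z n) \<partial>lborel)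
          + (\<integral>\<^sup>+x. indicator (U - A) x \<partial>lborel)
          + (\<integral>\<^sup>+x. ennreal \<bar>indicator U (x + z n) - indicator U x\<bar> \<partial>lborel))"
        by (subst nn_integral_cmult) (auto simp: nn_integral_add)
      also have "(\<integral>\<^sup>+x. indicator (U - A) (x + z n) \<partial>lborel) = (\<integral>\<^sup>+x. indicator (U - A) x \<partial>lborel)"
        by (rule nn_integral_translate) measurable
      also have "ennreal (norm c) * ((\<integral>\<^sup>+x. indicator (U - A) x \<partial>lborel) + (\<integral>\<^sup>+x. indicator (U - A) x \<partial>lborel)
          + (\<integral>\<^sup>+x. ennreal \<bar>indicator U (x + z n) - indicator U x\<bar> \<partial>lborel))
        \<le> ennreal (norm c) * (ennreal r + ennreal r + ennreal r)"
        using elim U(3) by (intro mult_left_mono add_mono) auto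
      also have "\<dots> = ennreal (norm c * (3 * r))"
        using r by (subst ennreal_mult) (auto simp flip: ennreal_plus)
      also have "\<dots> \<le> ennreal e"
      proof (rule ennreal_leI)
        have "norm c * (3 * r) \<le> (norm c + 1) * (3 * r)" using r by (intro mult_right_mono) auto
        also have "\<dots> = e" unfolding r_def by (simp add: field_simps add_nonneg_eq_0_iff)
        finally show "norm c * (3 * r) \<le> e" .
      qed
      finally show ?case .
    qed
  qed
next
  case (add f g)
  have [measurable]: "f \<in> borel_measurable borel" "g \<in> borel_measurable borel" using add by auto
  show ?case
  proof (rule tendsto_sandwich[OF _ _ tendsto_const])
    show "(\<lambda>n. (\<integral>\<^sup>+x. ennreal (norm (f (x + z n) - f x)) \<partial>lborel)
        + (\<integral>\<^sup>+x. ennreal (norm (g (x + z n) - g x)) \<partial>lborel)) \<longlonglongrightarrow> 0"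
      using tendsto_add[OF add.IH] by simp
    show "\<forall>\<^sub>F n in sequentially. (\<integral>\<^sup>+x. ennreal (norm (f (x + z n) + g (x + z n) - (f x + g x))) \<partial>lborel)
      \<le> (\<integral>\<^sup>+x. ennreal (norm (f (x + z n) - f x)) \<partial>lborel) + (\<integral>\<^sup>+x. ennreal (norm (g (x + z n) - g x)) \<partial>lborel)"
    proof (rule always_eventually, rule allI)
      fix n
      show "(\<integral>\<^sup>+x. ennreal (norm (f (x + z n) + g (x + z n) - (f x + g x))) \<partial>lborel)
      \<le> (\<integral>\<^sup>+x. ennreal (norm (f (x + z n) - f x)) \<partial>lborel) + (\<integral>\<^sup>+x. ennreal (norm (g (x + z n) - g x)) \<partial>lborel)"
        by (subst nn_integral_add[symmetric])
          (auto intro!: nn_integral_mono norm_diff_triangle_ineq simp: ennreal_plus[symmetric] simp del: ennreal_plus)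
    qed
  qed simp
next
  case (lim f s)
  have [measurable]: "f \<in> borel_measurable borel" "s i \<in> borel_measurable borel" for i using lim by auto
  have conv: "(\<lambda>i. \<integral>\<^sup>+x. ennreal (norm (s i x - f x)) \<partial>lborel) \<longlonglongrightarrow> (\<integral>\<^sup>+x. 0 \<partial>(lborel::real measure))"
  proof (rule nn_integral_dominated_convergence[where w="\<lambda>x. ennreal (3 * norm (f x))"])
    show "(\<integral>\<^sup>+x. ennreal (3 * norm (f x)) \<partial>lborel) < \<infinity>"
      using integrable_iff_bounded[THEN iffD1, OF integrable_mult_right[OF integrable_norm[OF lim.hyps(4)], of 3]]
      by simp
    show "AE x in lborel. ennreal (norm (s i x - f x)) \<le> ennreal (3 * norm (f x))" for i
    proof (rule AE_I2, rule ennreal_leI)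
      fix x show "norm (s i x - f x) \<le> 3 * norm (f x)"
        using norm_triangle_ineq4[of "s i x" "f x"] lim.hyps(3)[of x i] by simp
    qed
    show "AE x in lborel. (\<lambda>i. ennreal (norm (s i x - f x))) \<longlonglongrightarrow> 0"
    proof (rule AE_I2)
      fix x
      have "(\<lambda>i. s i x) \<longlonglongrightarrow> f x" using lim.hyps(2) by simp
      then have "(\<lambda>i. norm (s i x - f x)) \<longlonglongrightarrow> 0"
        by (intro tendsto_norm_zero) (simp add: LIM_zero)
      then show "(\<lambda>i. ennreal (norm (s i x - f x))) \<longlonglongrightarrow> 0"
        by (rule tendsto_ennrealI[where x=0, unfolded ennreal_0])
    qed
  qed measurable
  show ?case
  proof (rule ennreal_tendsto_0I)
    fix e :: real assume e: "e > 0"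
    then have e3: "e / 3 > 0" by simp
    have "eventually (\<lambda>i. (\<integral>\<^sup>+x. ennreal (norm (s i x - f x)) \<partial>lborel) \<le> ennreal (e/3)) sequentially"
      using conv e3 by (intro ennreal_tendsto_0D) simp_all
    then obtain i where i: "(\<integral>\<^sup>+x. ennreal (norm (s i x - f x)) \<partial>lborel) \<le> ennreal (e/3)"
      unfolding eventually_sequentially by blast
    from ennreal_tendsto_0D[OF lim.IH[of i] e3]
    show "eventually (\<lambda>n. (\<integral>\<^sup>+x. ennreal (norm (f (x + z n) - f x)) \<partial>lborel) \<le> ennreal e) sequentially"
    proof eventually_elim
      case (elim n)
      have "norm (f (x + z n) - f x) \<le> norm (s i (x + z n) - f (x + z n)) + norm (s i x - f x)
          + norm (s i (x + z n) - s i x)" for x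
      proof -
        have "f (x + z n) - f x = - (s i (x + z n) - f (x + z n)) + (s i x - f x) + (s i (x + z n) - s i x)"
          by simp
        also have "norm \<dots> \<le> norm (s i (x + z n) - f (x + z n)) + norm (s i x - f x) + norm (s i (x + z n) - s i x)"
          using norm_triangle_ineq[of "- (s i (x + z n) - f (x + z n)) + (s i x - f x)" "s i (x + z n) - s i x"]
            norm_triangle_ineq[of "- (s i (x + z n) - f (x + z n))" "s i x - f x"]
          unfolding norm_minus_cancel by linarith
        finally show ?thesis .
      qed
      then have "(\<integral>\<^sup>+x. ennreal (norm (f (x + z n) - f x)) \<partial>lborel)
        \<le> (\<integral>\<^sup>+x. ennreal (norm (s i (x + z n) - f (x + z n))) + ennreal (norm (s i x - f x))
          + ennreal (norm (s i (x + z n) - s i x)) \<partial>lborel)"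
        by (intro nn_integral_mono) (simp add: ennreal_plus[symmetric] del: ennreal_plus)
      also have "\<dots> = (\<integral>\<^sup>+x. ennreal (norm (s i (x + z n) - f (x + z n))) \<partial>lborel)
          + (\<integral>\<^sup>+x. ennreal (norm (s i x - f x)) \<partial>lborel)
          + (\<integral>\<^sup>+x. ennreal (norm (s i (x + z n) - s i x)) \<partial>lborel)"
        by (simp add: nn_integral_add)
      also have "(\<integral>\<^sup>+x. ennreal (norm (s i (x + z n) - f (x + z n))) \<partial>lborel)
          = (\<integral>\<^sup>+x. ennreal (norm (s i x - f x)) \<partial>lborel)"
        by (rule nn_integral_translate) measurable
      also have "(\<integral>\<^sup>+x. ennreal (norm (s i x - f x)) \<partial>lborel) + (\<integral>\<^sup>+x. ennreal (norm (s i x - f x)) \<partial>lborel)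
          + (\<integral>\<^sup>+x. ennreal (norm (s i (x + z n) - s i x)) \<partial>lborel) \<le> ennreal (e/3) + ennreal (e/3) + ennreal (e/3)"
        by (intro add_mono i elim)
      also have "\<dots> = ennreal e" using e by (simp add: ennreal_plus[symmetric] del: ennreal_plus)
      finally show ?case .
    qed
  qed
qed

text \<open>
  The map \<open>z \<mapsto> |z| z\<close> carries \<open>L\<^sup>2\<close> into \<open>L\<^sup>1\<close> and its inverse is Hoelder continuous with
  exponent 1/2, which reduces translations in \<open>L\<^sup>2\<close> to translations in \<open>L\<^sup>1\<close>.
\<close>

lemma norm_diff_sq_le:
  fixes a b :: complex
  shows "(norm (a - b))\<^sup>2 \<le> 2 * norm (norm a *\<^sub>R a - norm b *\<^sub>R b)"
proof (rule power2_le_imp_le)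
  define r s x where "r = norm a" and "s = norm b" and "x = inner a b"
  have x: "\<bar>x\<bar> \<le> r * s" unfolding x_def r_def s_def by (rule Cauchy_Schwarz_ineq2)
  have n1: "(norm (a - b))\<^sup>2 = r\<^sup>2 + s\<^sup>2 - 2 * x"
    unfolding r_def s_def x_def power2_norm_eq_inner
    by (simp add: inner_diff_left inner_diff_right inner_commute)
  have n2: "(norm (norm a *\<^sub>R a - norm b *\<^sub>R b))\<^sup>2 = r^4 + s^4 - 2 * (r * s * x)"
  proof -
    have "(norm (norm a *\<^sub>R a - norm b *\<^sub>R b))\<^sup>2 = r * r * inner a a + s * s * inner b b - 2 * (r * s * x)"
      unfolding power2_norm_eq_inner
      by (simp add: inner_diff_left inner_diff_right inner_commute r_def s_def x_def algebra_simps)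
    moreover have "inner a a = r\<^sup>2" "inner b b = s\<^sup>2" by (simp_all add: r_def s_def power2_norm_eq_inner)
    ultimately show ?thesis by (simp add: power2_eq_square power4_eq_xxxx)
  qed
  \<comment> \<open>The difference is concave in \<open>x\<close> and nonnegative at \<open>x = r s\<close> and \<open>x = - r s\<close>.\<close>
  have "4 * (r^4 + s^4 - 2 * (r * s * x)) - (r\<^sup>2 + s\<^sup>2 - 2 * x)\<^sup>2
     = 3 * (r\<^sup>2 - s\<^sup>2)\<^sup>2 + 4 * (r * s - x) * (r * s + x) + 4 * x * (r - s)\<^sup>2"
    by (simp add: power2_eq_square power4_eq_xxxx algebra_simps)
  moreover have "3 * (r\<^sup>2 - s\<^sup>2)\<^sup>2 + 4 * x * (r - s)\<^sup>2 = (r - s)\<^sup>2 * (3 * (r + s)\<^sup>2 + 4 * x)"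
    by (simp add: power2_eq_square algebra_simps)
  moreover have "0 \<le> (r - s)\<^sup>2 * (3 * (r + s)\<^sup>2 + 4 * x)"
  proof -
    have "0 \<le> 3 * r\<^sup>2 + 3 * s\<^sup>2 + 2 * (r * s)" by (simp add: r_def s_def)
    moreover have "- (r * s) \<le> x" using x by linarith
    moreover have "3 * (r + s)\<^sup>2 = 3 * r\<^sup>2 + 3 * s\<^sup>2 + 6 * (r * s)" by (simp add: power2_sum)
    ultimately have "0 \<le> 3 * (r + s)\<^sup>2 + 4 * x" by linarith
    then show ?thesis by simp
  qed
  moreover have "0 \<le> 4 * (r * s - x) * (r * s + x)" using x by simp
  ultimately have "(r\<^sup>2 + s\<^sup>2 - 2 * x)\<^sup>2 \<le> 4 * (r^4 + s^4 - 2 * (r * s * x))" by linarith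
  then show "((norm (a - b))\<^sup>2)\<^sup>2 \<le> (2 * norm (norm a *\<^sub>R a - norm b *\<^sub>R b))\<^sup>2"
    unfolding n1 power_mult_distrib n2 by simp
qed simp

lemma L2_translate:
  assumes "f \<in> L2_space" shows "(\<lambda>x. f (x + z)) \<in> L2_space" "L2_norm (\<lambda>x. f (x + z)) = L2_norm f"
proof -
  note [measurable] = L2_spaceD(1)[OF assms]
  have "(\<integral>\<^sup>+x. ennreal ((norm (f (x + z)))\<^sup>2) \<partial>lborel) = (\<integral>\<^sup>+x. ennreal ((norm (f x))\<^sup>2) \<partial>lborel)"
    by (rule nn_integral_translate) measurable
  then have eq: "(\<integral>\<^sup>+x. ennreal ((norm (f (x + z)))\<^sup>2) \<partial>lborel) = ennreal ((L2_norm f)\<^sup>2)"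
    by (simp add: nn_integral_L2 assms)
  then show *: "(\<lambda>x. f (x + z)) \<in> L2_space" by (intro L2_spaceI) auto
  show "L2_norm (\<lambda>x. f (x + z)) = L2_norm f"
    using eq unfolding nn_integral_L2[OF *] by (simp add: power2_eq_iff_nonneg)
qed

lemma L2_translation_continuous:
  assumes f: "f \<in> L2_space" and z: "z \<longlonglongrightarrow> 0"
  shows "(\<lambda>n. L2_norm (\<lambda>x. f (x + z n) - f x)) \<longlonglongrightarrow> 0"
proof -
  note [measurable] = L2_spaceD(1)[OF f]
  let ?g = "\<lambda>x. norm (f x) *\<^sub>R f x"
  have "integrable lborel ?g"
  proof (rule Bochner_Integration.integrable_bound[OF L2_spaceD(2)[OF f]])
    show "AE x in lborel. norm (norm (f x) *\<^sub>R f x) \<le> norm ((norm (f x))\<^sup>2)"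
      by (simp add: power2_eq_square)
  qed measurable
  from L1_translation_continuous[OF this z]
  have t: "(\<lambda>n. 2 * (\<integral>\<^sup>+x. ennreal (norm (?g (x + z n) - ?g x)) \<partial>lborel)) \<longlonglongrightarrow> 2 * 0"
    by (intro ennreal_tendsto_cmult) auto
  have "(\<lambda>n. ennreal ((L2_norm (\<lambda>x. f (x + z n) - f x))\<^sup>2)) \<longlonglongrightarrow> 0"
  proof (rule tendsto_sandwich[OF _ _ tendsto_const])
    show "(\<lambda>n. 2 * (\<integral>\<^sup>+x. ennreal (norm (?g (x + z n) - ?g x)) \<partial>lborel)) \<longlonglongrightarrow> 0" using t by simp
    show "\<forall>\<^sub>F n in sequentially. ennreal ((L2_norm (\<lambda>x. f (x + z n) - f x))\<^sup>2)
        \<le> 2 * (\<integral>\<^sup>+x. ennreal (norm (?g (x + z n) - ?g x)) \<partial>lborel)"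
    proof (rule always_eventually, rule allI)
      fix n
      have "ennreal ((L2_norm (\<lambda>x. f (x + z n) - f x))\<^sup>2) = (\<integral>\<^sup>+x. ennreal ((norm (f (x + z n) - f x))\<^sup>2) \<partial>lborel)"
        by (rule nn_integral_L2[symmetric]) (intro L2_diff L2_translate f)
      also have "\<dots> \<le> (\<integral>\<^sup>+x. 2 * ennreal (norm (?g (x + z n) - ?g x)) \<partial>lborel)"
        by (intro nn_integral_mono) (use norm_diff_sq_le in \<open>simp add: ennreal_mult' [symmetric] flip: ennreal_numeral\<close>)
      also have "\<dots> = 2 * (\<integral>\<^sup>+x. ennreal (norm (?g (x + z n) - ?g x)) \<partial>lborel)"
        by (rule nn_integral_cmult) measurable
      finally show "ennreal ((L2_norm (\<lambda>x. f (x + z n) - f x))\<^sup>2)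
        \<le> 2 * (\<integral>\<^sup>+x. ennreal (norm (?g (x + z n) - ?g x)) \<partial>lborel)" .
    qed
  qed simp
  then have "(\<lambda>n. (L2_norm (\<lambda>x. f (x + z n) - f x))\<^sup>2) \<longlonglongrightarrow> 0"
    using tendsto_ennreal_iff[of "\<lambda>n. (L2_norm (\<lambda>x. f (x + z n) - f x))\<^sup>2" sequentially 0] by simp
  from tendsto_real_sqrt[OF this] show ?thesis by simp
qed

section \<open>The Plancherel theorem for integrable functions\<close>

lemma fourier_integral_measurable [measurable]:
  assumes [measurable]: "f \<in> borel_measurable borel"
  shows "fourier_integral f \<in> borel_measurable borel"
  unfolding fourier_integral_def by measurable

lemma norm_exp_i_real [simp]: "norm (exp (- (\<i> * complex_of_real r))) = 1" "norm (exp (\<i> * complex_of_real r)) = 1"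
  using norm_exp_i_times[of "-r"] by simp_all

lemma fourier_integrand_integrable:
  assumes "integrable lborel f"
  shows "integrable lborel (\<lambda>x. exp (- (\<i> * of_real (k * x))) * f x)"
proof (rule Bochner_Integration.integrable_bound[OF assms])
  have [measurable]: "f \<in> borel_measurable borel" using assms by auto
  show "(\<lambda>x. exp (- (\<i> * of_real (k * x))) * f x) \<in> borel_measurable lborel" by measurable
qed (simp add: norm_mult del: of_real_mult)

lemma norm_fourier_integral_le:
  "norm (fourier_integral f k) \<le> (LINT x|lborel. norm (f x))"
proof -
  have "norm (fourier_integral f k) \<le> (LINT x|lborel. norm (exp (- (\<i> * of_real (k * x))) * f x))"
    unfolding fourier_integral_def by (rule integral_norm_bound)
  also have "\<dots> = (LINT x|lborel. norm (f x))" by (simp add: norm_mult del: of_real_mult)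
  finally show ?thesis .
qed

lemma fourier_integral_diff:
  assumes "integrable lborel f" "integrable lborel g"
  shows "fourier_integral (\<lambda>x. f x - g x) k = fourier_integral f k - fourier_integral g k"
  unfolding fourier_integral_def
  using fourier_integrand_integrable[OF assms(1), of k] fourier_integrand_integrable[OF assms(2), of k]
  by (simp add: right_diff_distrib del: of_real_mult)

text \<open>
  The form of Fubini's theorem that serves oscillatory kernels: absolute convergence comes from the two
  densities alone.
\<close>

lemma Fubini_bounded_kernel:
  fixes p q :: "real \<Rightarrow> complex" and K :: "real \<Rightarrow> real \<Rightarrow> complex"
  assumes p: "integrable lborel p" and q: "integrable lborel q"
    and K [measurable]: "(\<lambda>(x, y). K x y) \<in> borel_measurable (borel \<Otimes>\<^sub>M borel)"
    and B: "\<And>x y. norm (K x y) \<le> B"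
  shows "(LINT y|lborel. LINT x|lborel. p x * q y * K x y) = (LINT x|lborel. LINT y|lborel. p x * q y * K x y)"
proof (rule lborel_pair.Fubini_integral)
  have [measurable]: "p \<in> borel_measurable borel" "q \<in> borel_measurable borel" using p q by auto
  have pq: "integrable (lborel \<Otimes>\<^sub>M lborel) (\<lambda>(x, y). p x * q y)"
    by (rule lborel_pair.Fubini_integrable) (use p q in \<open>auto simp: norm_mult\<close>)
  show "integrable (lborel \<Otimes>\<^sub>M lborel) (\<lambda>(x, y). p x * q y * K x y)"
  proof (rule Bochner_Integration.integrable_bound)
    show "integrable (lborel \<Otimes>\<^sub>M lborel) (\<lambda>z. B *\<^sub>R (case z of (x, y) \<Rightarrow> p x * q y))"
      using pq by simp
    show "AE z in lborel \<Otimes>\<^sub>M lborel. norm (case z of (x, y) \<Rightarrow> p x * q y * K x y)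
        \<le> norm (B *\<^sub>R (case z of (x, y) \<Rightarrow> p x * q y))"
    proof (rule AE_I2, clarify)
      fix x y
      have "norm (K x y) \<le> \<bar>B\<bar>" using B[of x y] by linarith
      then show "norm (p x * q y * K x y) \<le> norm (B *\<^sub>R (p x * q y))"
        by (simp add: norm_mult mult.commute mult_right_mono mult_left_mono)
    qed
    show "(\<lambda>(x, y). p x * q y * K x y) \<in> borel_measurable (lborel \<Otimes>\<^sub>M lborel)"
      by measurable
  qed
qed

lemma fourier_integral_gaussian:
  assumes "e > (0::real)"
  shows "fourier_integral (\<lambda>k. complex_of_real (exp (- (e * k)\<^sup>2 / 2))) z
    = complex_of_real (sqrt (2 * pi) / e * exp (- (z / e)\<^sup>2 / 2))"
    and "integrable lborel (\<lambda>k. complex_of_real (exp (- (e * k)\<^sup>2 / 2)))"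
proof -
  have sn: "exp (- (e * k)\<^sup>2 / 2) = sqrt (2 * pi) * std_normal_density (e * k)" for k
    by (simp add: std_normal_density_def)
  have "integrable lborel (\<lambda>k. std_normal_density (0 + e * k))"
    using assms by (intro lborel_integrable_real_affine) auto
  then show "integrable lborel (\<lambda>k. complex_of_real (exp (- (e * k)\<^sup>2 / 2)))"
    unfolding sn by simp
  have "fourier_integral (\<lambda>k. complex_of_real (exp (- (e * k)\<^sup>2 / 2))) z
      = \<bar>1 / e\<bar> *\<^sub>R (LINT k|lborel. exp (- (\<i> * of_real (z * (0 + 1 / e * k)))) * complex_of_real (exp (- (e * (0 + 1 / e * k))\<^sup>2 / 2)))"
    unfolding fourier_integral_def using assms by (intro lborel_integral_real_affine) auto
  also have "\<dots> = (1 / e) *\<^sub>R (LINT k|lborel. sqrt (2 * pi) * (std_normal_density k *\<^sub>R exp (\<i> * of_real ((- z / e) * k))))"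
    using assms by (intro arg_cong2[where f=scaleR] Bochner_Integration.integral_cong)
      (auto simp: std_normal_density_def scaleR_conv_of_real field_simps)
  also have "\<dots> = (1 / e) *\<^sub>R (sqrt (2 * pi) * (LINT k|lborel. (std_normal_density k *\<^sub>R exp (\<i> * of_real ((- z / e) * k)))))"
    by (simp only: integral_mult_right_zero)
  also have "(LINT k|lborel. (std_normal_density k *\<^sub>R exp (\<i> * of_real ((- z / e) * k)))) = char std_normal_distribution (- z / e)"
    unfolding char_def by (subst integral_density) auto
  also have "\<dots> = complex_of_real (exp (- (z / e)\<^sup>2 / 2))"
    by (simp add: char_std_normal_distribution power_divide)
  finally show "fourier_integral (\<lambda>k. complex_of_real (exp (- (e * k)\<^sup>2 / 2))) z
    = complex_of_real (sqrt (2 * pi) / e * exp (- (z / e)\<^sup>2 / 2))"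
    by (simp add: scaleR_conv_of_real)
qed

definition autocorrelation :: "(real \<Rightarrow> complex) \<Rightarrow> real \<Rightarrow> complex" where
  "autocorrelation u z = (LINT y|lborel. u (y + z) * cnj (u y))"

lemma cnj_measurable [measurable (raw)]:
  "f \<in> borel_measurable M \<Longrightarrow> (\<lambda>x. cnj (f x)) \<in> borel_measurable M"
  by (auto intro!: measurable_compose[OF _ borel_measurable_continuous_onI[of cnj]] continuous_intros)

text \<open>
  The product of \<open>fourier_integral u k\<close> with its conjugate is a double integral in \<open>x\<close> and \<open>y\<close> with phase
  \<open>k (x - y)\<close>; the substitution \<open>x = y + z\<close> separates the phase from the integral over \<open>y\<close>.
\<close>

lemma fourier_integral_autocorrelation:
  assumes u: "integrable lborel u"
  shows "integrable lborel (autocorrelation u)"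
    and "fourier_integral (autocorrelation u) k = complex_of_real ((norm (fourier_integral u k))\<^sup>2)"
proof -
  have [measurable]: "u \<in> borel_measurable borel" using u by auto
  let ?E = "\<lambda>z. exp (- (\<i> * complex_of_real (k * z)))"
  have tr: "(LINT z|lborel. f (y + z)) = (LINT z|lborel. f z)" for f :: "real \<Rightarrow> complex" and y
    using lborel_integral_real_affine[of 1 f y] by simp
  have tr': "(LINT z|lborel. f (y + z)) = (LINT z|lborel. f z)" for f :: "real \<Rightarrow> real" and y
    using lborel_integral_real_affine[of 1 f y] by simp
  have ti: "integrable lborel (\<lambda>z. u (y + z))" for y
    using lborel_integrable_real_affine[OF u, of 1 y] by simp
  have i0: "integrable (lborel \<Otimes>\<^sub>M lborel) (\<lambda>(y, z). u (y + z) * cnj (u y))"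
  proof (rule lborel_pair.Fubini_integrable)
    show "AE y in lborel. integrable lborel (\<lambda>z. case (y, z) of (y, z) \<Rightarrow> u (y + z) * cnj (u y))"
      using ti by simp
    have "(LINT z|lborel. norm (u (y + z) * cnj (u y))) = (LINT z|lborel. norm (u z)) * norm (u y)" for y
      by (simp add: norm_mult tr'[of "\<lambda>z. norm (u z)" y])
    then show "integrable lborel (\<lambda>y. LINT z|lborel. norm (case (y, z) of (y, z) \<Rightarrow> u (y + z) * cnj (u y)))"
      using u by simp
  qed measurable
  then have "integrable lborel (\<lambda>z. LINT y|lborel. u (y + z) * cnj (u y))"
    by (rule lborel_pair.integrable_snd)
  then show "integrable lborel (autocorrelation u)"
    unfolding autocorrelation_def[abs_def] .
  have i1: "integrable (lborel \<Otimes>\<^sub>M lborel) (\<lambda>(y, z). ?E z * (u (y + z) * cnj (u y)))"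
  proof (rule Bochner_Integration.integrable_bound[OF i0])
    show "(\<lambda>(y, z). ?E z * (u (y + z) * cnj (u y))) \<in> borel_measurable (lborel \<Otimes>\<^sub>M lborel)" by measurable
  qed (auto simp: norm_mult simp del: of_real_mult)
  have "fourier_integral (autocorrelation u) k = (LINT z|lborel. LINT y|lborel. ?E z * (u (y + z) * cnj (u y)))"
    unfolding fourier_integral_def autocorrelation_def by simp
  also have "\<dots> = (LINT y|lborel. LINT z|lborel. ?E z * (u (y + z) * cnj (u y)))"
    by (rule lborel_pair.Fubini_integral[OF i1])
  also have "\<dots> = (LINT y|lborel. cnj (?E y * u y) * fourier_integral u k)"
  proof (rule Bochner_Integration.integral_cong[OF refl])
    fix y
    have "?E z * (u (y + z) * cnj (u y)) = cnj (?E y * u y) * (?E (y + z) * u (y + z))" for z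
    proof -
      have "?E z = cnj (?E y) * ?E (y + z)"
        by (simp add: exp_cnj exp_add[symmetric] algebra_simps)
      then show ?thesis by simp
    qed
    then have "(LINT z|lborel. ?E z * (u (y + z) * cnj (u y))) = cnj (?E y * u y) * (LINT z|lborel. ?E (y + z) * u (y + z))"
      by (simp only: integral_mult_right_zero)
    then show "(LINT z|lborel. ?E z * (u (y + z) * cnj (u y))) = cnj (?E y * u y) * fourier_integral u k"
      using tr[of "\<lambda>z. ?E z * u z" y] by (simp add: fourier_integral_def)
  qed
  also have "\<dots> = (LINT y|lborel. cnj (?E y * u y)) * fourier_integral u k" by simp
  also have "(LINT y|lborel. cnj (?E y * u y)) = cnj (fourier_integral u k)"
    unfolding fourier_integral_def by (rule Bochner_Integration.integral_cnj)
  finally show "fourier_integral (autocorrelation u) k = complex_of_real ((norm (fourier_integral u k))\<^sup>2)"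
    by (simp only: complex_norm_square mult.commute)
qed

lemma autocorrelation_measurable [measurable]:
  assumes [measurable]: "u \<in> borel_measurable borel"
  shows "autocorrelation u \<in> borel_measurable borel"
  unfolding autocorrelation_def[abs_def] by measurable

lemma autocorrelation_continuous_0:
  assumes u: "u \<in> L2_space" and z: "z \<longlonglongrightarrow> 0"
  shows "(\<lambda>n. autocorrelation u (z n)) \<longlonglongrightarrow> complex_of_real ((L2_norm u)\<^sup>2)"
proof -
  have "(\<lambda>n. autocorrelation u (z n) - complex_of_real ((L2_norm u)\<^sup>2)) \<longlonglongrightarrow> 0"
  proof (rule Lim_null_comparison)
    show "(\<lambda>n. L2_norm (\<lambda>x. u (x + z n) - u x) * L2_norm u) \<longlonglongrightarrow> 0"
      using tendsto_mult_right[OF L2_translation_continuous[OF u z], of "L2_norm u"] by simp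
    show "\<forall>\<^sub>F n in sequentially. norm (autocorrelation u (z n) - complex_of_real ((L2_norm u)\<^sup>2))
        \<le> L2_norm (\<lambda>x. u (x + z n) - u x) * L2_norm u"
    proof (rule always_eventually, rule allI)
      fix n
      have "complex_of_real ((L2_norm u)\<^sup>2) = (LINT x|lborel. u x * cnj (u x))"
        by (simp add: L2_norm_sq complex_norm_square[symmetric] del: of_real_power)
      then have "autocorrelation u (z n) - complex_of_real ((L2_norm u)\<^sup>2)
          = (LINT x|lborel. u (x + z n) * cnj (u x)) - (LINT x|lborel. u x * cnj (u x))"
        by (simp add: autocorrelation_def)
      also have "\<dots> = (LINT x|lborel. (u (x + z n) - u x) * cnj (u x))"
        unfolding left_diff_distrib
        by (rule Bochner_Integration.integral_diff[symmetric]) (intro L2_mult_integrable L2_translate u L2_cnj)+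
      finally show "norm (autocorrelation u (z n) - complex_of_real ((L2_norm u)\<^sup>2))
        \<le> L2_norm (\<lambda>x. u (x + z n) - u x) * L2_norm u"
        using L2_Cauchy_Schwarz(2)[OF L2_diff[OF L2_translate(1)[OF u, of "z n"] u] L2_cnj[OF u]]
        by (simp add: L2_norm_cnj)
    qed
  qed
  then show ?thesis by (simp add: LIM_zero_iff)
qed

text \<open>
  This bound is the integrable majorant for the average over a Gaussian in Plancherel's theorem.
\<close>

lemma norm_autocorrelation_le:
  assumes u: "u \<in> L2_space"
  shows "norm (autocorrelation u z) \<le> (L2_norm u)\<^sup>2"
  using L2_Cauchy_Schwarz(2)[OF L2_translate(1)[OF u, of z] L2_cnj[OF u]]
  by (simp add: autocorrelation_def L2_norm_cnj L2_translate(2)[OF u] power2_eq_square)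

text \<open>
  \<open>|u^|\<^sup>2\<close> is the Fourier integral of the autocorrelation of \<open>u\<close>. Against a wide Gaussian weight, one
  exchange of integrals turns its integral into an average of the autocorrelation over a
  narrow Gaussian, which tends to the value \<open>\<parallel>u\<parallel>\<^sup>2\<close> at the origin.
\<close>

theorem Plancherel_L1_L2:
  assumes u1: "integrable lborel u" and u2: "u \<in> L2_space"
  shows "(\<integral>\<^sup>+k. ennreal ((norm (fourier_integral u k))\<^sup>2) \<partial>lborel) = ennreal (2 * pi * (L2_norm u)\<^sup>2)"
proof -
  have [measurable]: "u \<in> borel_measurable borel" using u1 by auto
  let ?G = "\<lambda>e k. exp (- (e * k)\<^sup>2 / 2)"
  note A = fourier_integral_autocorrelation[OF u1]
  have weighted: "(\<integral>\<^sup>+k. ennreal (?G e k * (norm (fourier_integral u k))\<^sup>2) \<partial>lborel)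
      = ennreal (Re (2 * pi * (LINT w|lborel. std_normal_density w *\<^sub>R autocorrelation u (e * w))))" if e: "e > 0" for e
  proof -
    note G = fourier_integral_gaussian[OF e]
    let ?K = "\<lambda>k z. exp (- (\<i> * complex_of_real (k * z)))"
    have gi: "integrable lborel (\<lambda>k. ?G e k * (norm (fourier_integral u k))\<^sup>2)"
    proof (rule Bochner_Integration.integrable_bound)
      show "integrable lborel (\<lambda>k. ?G e k * (LINT x|lborel. norm (u x))\<^sup>2)"
        using G(2) by (simp only: complex_of_real_integrable_eq integrable_mult_left)
      show "AE k in lborel. norm (?G e k * (norm (fourier_integral u k))\<^sup>2) \<le> norm (?G e k * (LINT x|lborel. norm (u x))\<^sup>2)"
        by (auto simp: abs_mult intro!: mult_left_mono power_mono norm_fourier_integral_le)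
    qed measurable
    have "complex_of_real (LINT k|lborel. ?G e k * (norm (fourier_integral u k))\<^sup>2)
        = (LINT k|lborel. complex_of_real (?G e k) * fourier_integral (autocorrelation u) k)"
      by (simp add: A(2) flip: integral_complex_of_real)
    also have "\<dots> = (LINT k|lborel. LINT z|lborel. autocorrelation u z * complex_of_real (?G e k) * ?K k z)"
      unfolding fourier_integral_def
      by (subst integral_mult_right_zero[symmetric]) (simp add: mult_ac del: of_real_mult)
    also have "\<dots> = (LINT z|lborel. LINT k|lborel. autocorrelation u z * complex_of_real (?G e k) * ?K k z)"
      by (rule Fubini_bounded_kernel[OF A(1) G(2), where B=1]) (simp_all del: of_real_mult)
    also have "\<dots> = (LINT z|lborel. autocorrelation u z * fourier_integral (\<lambda>k. complex_of_real (?G e k)) z)"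
      unfolding fourier_integral_def
      by (subst integral_mult_right_zero[symmetric]) (simp add: mult_ac)
    also have "\<dots> = (LINT z|lborel. (sqrt (2 * pi) / e * exp (- (z / e)\<^sup>2 / 2)) *\<^sub>R autocorrelation u z)"
      unfolding G(1) by (simp add: scaleR_conv_of_real mult_ac)
    also have "\<dots> = \<bar>e\<bar> *\<^sub>R (LINT w|lborel. (sqrt (2 * pi) / e * exp (- ((0 + e * w) / e)\<^sup>2 / 2)) *\<^sub>R autocorrelation u (0 + e * w))"
      using e by (intro lborel_integral_real_affine) auto
    also have "\<dots> = e *\<^sub>R (LINT w|lborel. (2 * pi / e) *\<^sub>R (std_normal_density w *\<^sub>R autocorrelation u (e * w)))"
    proof (rule arg_cong2[where f=scaleR], use e in simp, rule Bochner_Integration.integral_cong[OF refl])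
      fix w
      have "2 * pi / e * std_normal_density w = 2 * pi / sqrt (2 * pi) / e * exp (- w\<^sup>2 / 2)"
        by (simp add: std_normal_density_def)
      also have "\<dots> = sqrt (2 * pi) / e * exp (- ((0 + e * w) / e)\<^sup>2 / 2)"
        using e by (subst real_div_sqrt) auto
      finally show "(sqrt (2 * pi) / e * exp (- ((0 + e * w) / e)\<^sup>2 / 2)) *\<^sub>R autocorrelation u (0 + e * w)
          = (2 * pi / e) *\<^sub>R (std_normal_density w *\<^sub>R autocorrelation u (e * w))"
        by (simp only: scaleR_scaleR add_0)
    qed
    also have "\<dots> = 2 * pi * (LINT w|lborel. std_normal_density w *\<^sub>R autocorrelation u (e * w))"
      using e by (simp only: integral_scaleR_right) (simp add: scaleR_conv_of_real)
    finally have "complex_of_real (LINT k|lborel. ?G e k * (norm (fourier_integral u k))\<^sup>2)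
        = 2 * pi * (LINT w|lborel. std_normal_density w *\<^sub>R autocorrelation u (e * w))" .
    from arg_cong[OF this, of Re] have "(LINT k|lborel. ?G e k * (norm (fourier_integral u k))\<^sup>2)
        = Re (2 * pi * (LINT w|lborel. std_normal_density w *\<^sub>R autocorrelation u (e * w)))"
      unfolding Re_complex_of_real .
    then show ?thesis using gi by (subst nn_integral_eq_integral) auto
  qed
  define e where "e n = 1 / real (Suc n)" for n
  have e0: "e \<longlonglongrightarrow> 0" unfolding e_def by (rule LIMSEQ_Suc[OF lim_1_over_n])
  have epos: "e n > 0" for n unfolding e_def by simp
  have "(\<lambda>n. LINT w|lborel. std_normal_density w *\<^sub>R autocorrelation u (e n * w))
      \<longlonglongrightarrow> (LINT w|lborel. std_normal_density w *\<^sub>R complex_of_real ((L2_norm u)\<^sup>2))"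
  proof (rule integral_dominated_convergence[where w="\<lambda>w. std_normal_density w * (L2_norm u)\<^sup>2"])
    show "AE w in lborel. (\<lambda>n. std_normal_density w *\<^sub>R autocorrelation u (e n * w))
        \<longlonglongrightarrow> std_normal_density w *\<^sub>R complex_of_real ((L2_norm u)\<^sup>2)"
    proof (rule AE_I2)
      fix w :: real
      have "(\<lambda>n. e n * w) \<longlonglongrightarrow> 0" using tendsto_mult_right[OF e0, of w] by simp
      from autocorrelation_continuous_0[OF u2 this]
      show "(\<lambda>n. std_normal_density w *\<^sub>R autocorrelation u (e n * w))
        \<longlonglongrightarrow> std_normal_density w *\<^sub>R complex_of_real ((L2_norm u)\<^sup>2)"
        by (intro tendsto_intros)
    qed
    show "AE w in lborel. norm (std_normal_density w *\<^sub>R autocorrelation u (e n * w)) \<le> std_normal_density w * (L2_norm u)\<^sup>2" for n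
      by (simp add: mult_left_mono norm_autocorrelation_le[OF u2])
  qed auto
  also have "(LINT w|lborel. std_normal_density w *\<^sub>R complex_of_real ((L2_norm u)\<^sup>2)) = complex_of_real ((L2_norm u)\<^sup>2)"
    by simp
  finally have "(\<lambda>n. Re (2 * pi * (LINT w|lborel. std_normal_density w *\<^sub>R autocorrelation u (e n * w))))
      \<longlonglongrightarrow> Re (2 * pi * complex_of_real ((L2_norm u)\<^sup>2))"
    by (intro tendsto_intros)
  then have "(\<lambda>n. ennreal (Re (2 * pi * (LINT w|lborel. std_normal_density w *\<^sub>R autocorrelation u (e n * w)))))
      \<longlonglongrightarrow> ennreal (Re (2 * pi * complex_of_real ((L2_norm u)\<^sup>2)))"
    by (intro tendsto_ennrealI)
  then have lim1: "(\<lambda>n. \<integral>\<^sup>+k. ennreal (?G (e n) k * (norm (fourier_integral u k))\<^sup>2) \<partial>lborel)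
      \<longlonglongrightarrow> ennreal (2 * pi * (L2_norm u)\<^sup>2)"
    unfolding weighted[OF epos] by simp
  have dec: "e n \<le> e m" if "m \<le> n" for m n using that unfolding e_def by (simp add: frac_le)
  have inc: "incseq (\<lambda>n k. ennreal (?G (e n) k * (norm (fourier_integral u k))\<^sup>2))"
  proof (intro monoI le_funI ennreal_leI mult_right_mono)
    fix m n :: nat and k :: real assume "m \<le> n"
    have "(e n * k)\<^sup>2 \<le> (e m * k)\<^sup>2"
      unfolding power_mult_distrib
      using dec[OF \<open>m \<le> n\<close>] epos[of n] by (intro mult_right_mono power_mono) auto
    then show "?G (e m) k \<le> ?G (e n) k" by simp
  qed simp
  have eq1: "(\<integral>\<^sup>+k. (SUP n. ennreal (?G (e n) k * (norm (fourier_integral u k))\<^sup>2)) \<partial>lborel)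
      = (SUP n. \<integral>\<^sup>+k. ennreal (?G (e n) k * (norm (fourier_integral u k))\<^sup>2) \<partial>lborel)"
    by (rule nn_integral_monotone_convergence_SUP[OF inc]) measurable
  have eq2: "(SUP n. \<integral>\<^sup>+k. ennreal (?G (e n) k * (norm (fourier_integral u k))\<^sup>2) \<partial>lborel)
      = ennreal (2 * pi * (L2_norm u)\<^sup>2)"
  proof (rule LIMSEQ_unique[OF LIMSEQ_SUP lim1])
    show "incseq (\<lambda>n. \<integral>\<^sup>+k. ennreal (?G (e n) k * (norm (fourier_integral u k))\<^sup>2) \<partial>lborel)"
      by (intro monoI nn_integral_mono le_funD[OF monoD[OF inc]])
  qed
  have eq3: "(SUP n. ennreal (?G (e n) k * (norm (fourier_integral u k))\<^sup>2)) = ennreal ((norm (fourier_integral u k))\<^sup>2)" for k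
  proof (rule LIMSEQ_unique[OF LIMSEQ_SUP])
    show "incseq (\<lambda>n. ennreal (?G (e n) k * (norm (fourier_integral u k))\<^sup>2))"
      by (intro monoI le_funD[OF monoD[OF inc]])
    have "(\<lambda>n. ?G (e n) k * (norm (fourier_integral u k))\<^sup>2) \<longlonglongrightarrow> exp (- (0 * k)\<^sup>2 / 2) * (norm (fourier_integral u k))\<^sup>2"
      by (intro tendsto_intros e0) simp
    then show "(\<lambda>n. ennreal (?G (e n) k * (norm (fourier_integral u k))\<^sup>2)) \<longlonglongrightarrow> ennreal ((norm (fourier_integral u k))\<^sup>2)"
      by (intro tendsto_ennrealI) simp
  qed
  show ?thesis using eq1 unfolding eq2 eq3 .
qed

section \<open>The Fourier transform of square integrable functions\<close>

lemma L2_norm_triangle_diff: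
  assumes "f \<in> L2_space" "g \<in> L2_space"
  shows "L2_norm (\<lambda>x. f x - g x) \<le> L2_norm f + L2_norm g"
  using L2_norm_triangle[OF assms(1) L2_cmult[OF assms(2), of "-1"]] L2_norm_cmult[of "-1" g]
  by simp

definition trunc :: "real \<Rightarrow> (real \<Rightarrow> complex) \<Rightarrow> real \<Rightarrow> complex" where
  "trunc R u = (\<lambda>x. indicator {-R..R} x *\<^sub>R u x)"

lemma trunc_L2:
  assumes "u \<in> L2_space" shows "trunc R u \<in> L2_space"
proof -
  note [measurable] = L2_spaceD(1)[OF assms]
  have "integrable lborel (\<lambda>x. (norm (trunc R u x))\<^sup>2)"
    by (rule Bochner_Integration.integrable_bound[OF L2_spaceD(2)[OF assms]])
      (auto simp: trunc_def indicator_def)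
  then show ?thesis unfolding L2_space_def trunc_def by simp
qed

lemma indicator_L2: "(\<lambda>x. indicator {a..b::real} x) \<in> L2_space"
proof -
  have "(\<integral>\<^sup>+x. ennreal ((norm (indicator {a..b} x :: complex))\<^sup>2) \<partial>lborel) = (\<integral>\<^sup>+x. indicator {a..b} x \<partial>lborel)"
    by (intro nn_integral_cong) (simp add: indicator_def)
  also have "\<dots> < \<infinity>" by (cases "a \<le> b") auto
  finally show ?thesis by (intro L2_spaceI) simp_all
qed

lemma trunc_L1:
  assumes "u \<in> L2_space" shows "integrable lborel (trunc R u)"
proof -
  have "trunc R u = (\<lambda>x. indicator {-R..R} x * u x)" by (simp add: trunc_def indicator_def fun_eq_iff)
  then show ?thesis using L2_mult_integrable[OF indicator_L2 assms] by simp
qed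

lemma trunc_tendsto:
  assumes u: "u \<in> L2_space"
  shows "((\<lambda>R. L2_norm (\<lambda>x. u x - trunc R u x)) \<longlongrightarrow> 0) at_top"
proof -
  note [measurable] = L2_spaceD(1)[OF u]
  have [measurable]: "trunc R u \<in> borel_measurable borel" for R unfolding trunc_def by measurable
  have "((\<lambda>R. LINT x|lborel. (norm (u x - trunc R u x))\<^sup>2) \<longlongrightarrow> (LINT x|(lborel::real measure). 0)) at_top"
  proof (rule integral_dominated_convergence_at_top[where w="\<lambda>x. (norm (u x))\<^sup>2"])
    show "AE x in lborel. ((\<lambda>R. (norm (u x - trunc R u x))\<^sup>2) \<longlongrightarrow> 0) at_top"
    proof (rule AE_I2)
      fix x :: real
      have "eventually (\<lambda>R. R \<ge> \<bar>x\<bar>) at_top" by (rule eventually_ge_at_top)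
      then have "eventually (\<lambda>R. (norm (u x - trunc R u x))\<^sup>2 = 0) at_top"
        by eventually_elim (auto simp: trunc_def indicator_def)
      then show "((\<lambda>R. (norm (u x - trunc R u x))\<^sup>2) \<longlongrightarrow> 0) at_top" by (rule tendsto_eventually)
    qed
    show "\<forall>\<^sub>F R in at_top. AE x in lborel. norm ((norm (u x - trunc R u x))\<^sup>2) \<le> (norm (u x))\<^sup>2"
      by (intro always_eventually allI AE_I2) (simp add: trunc_def indicator_def)
  qed (use L2_spaceD(2)[OF u] in auto)
  from tendsto_real_sqrt[OF this] show ?thesis by (simp add: L2_norm_def)
qed

text \<open>
  On truncated functions Plancherel's theorem holds for the convergent Fourier integral. The defining
  limit of the transform can then be read in the norm of \<open>L\<^sup>2\<close>.
\<close>

lemma is_fourier_iff: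
  assumes "u \<in> L2_space"
  shows "is_fourier u v \<longleftrightarrow> v \<in> L2_space \<and>
    ((\<lambda>R. L2_norm (\<lambda>k. fourier_integral (trunc R u) k - v k)) \<longlongrightarrow> 0) at_top" (is "_ \<longleftrightarrow> _ \<and> ?L")
    and "fourier_integral (trunc R u) \<in> L2_space"
    and "L2_norm (fourier_integral (trunc R u)) = sqrt (2 * pi) * L2_norm (trunc R u)"
proof -
  note P = Plancherel_L1_L2[OF trunc_L1[OF assms] trunc_L2[OF assms]]
  have [measurable]: "trunc R u \<in> borel_measurable borel" for R using L2_spaceD trunc_L2[OF assms] by blast
  show F: "fourier_integral (trunc R u) \<in> L2_space" for R
    using P by (intro L2_spaceI) auto
  have "ennreal ((L2_norm (fourier_integral (trunc R u)))\<^sup>2) = ennreal (2 * pi * (L2_norm (trunc R u))\<^sup>2)"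
    using P nn_integral_L2[OF F] by simp
  then have "(L2_norm (fourier_integral (trunc R u)))\<^sup>2 = 2 * pi * (L2_norm (trunc R u))\<^sup>2" by simp
  then have "sqrt ((L2_norm (fourier_integral (trunc R u)))\<^sup>2) = sqrt (2 * pi * (L2_norm (trunc R u))\<^sup>2)" by simp
  then show "L2_norm (fourier_integral (trunc R u)) = sqrt (2 * pi) * L2_norm (trunc R u)"
    by (simp add: real_sqrt_mult)
  have "?L \<longleftrightarrow> ((\<lambda>R. \<integral>\<^sup>+ k. ennreal ((norm (fourier_integral (trunc R u) k - v k))\<^sup>2) \<partial>lborel) \<longlongrightarrow> 0) at_top"
    if v: "v \<in> L2_space"
  proof -
    have "(\<integral>\<^sup>+ k. ennreal ((norm (fourier_integral (trunc R u) k - v k))\<^sup>2) \<partial>lborel)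
        = ennreal ((L2_norm (\<lambda>k. fourier_integral (trunc R u) k - v k))\<^sup>2)" for R
      by (rule nn_integral_L2) (intro L2_diff F v)
    moreover have "?L \<longleftrightarrow> ((\<lambda>R. (L2_norm (\<lambda>k. fourier_integral (trunc R u) k - v k))\<^sup>2) \<longlongrightarrow> 0) at_top"
    proof
      assume ?L
      from tendsto_power[OF this, of 2]
      show "((\<lambda>R. (L2_norm (\<lambda>k. fourier_integral (trunc R u) k - v k))\<^sup>2) \<longlongrightarrow> 0) at_top" by simp
    next
      assume "((\<lambda>R. (L2_norm (\<lambda>k. fourier_integral (trunc R u) k - v k))\<^sup>2) \<longlongrightarrow> 0) at_top"
      from tendsto_real_sqrt[OF this] show ?L by simp
    qed
    ultimately show ?thesis
      using tendsto_ennreal_iff[of "\<lambda>R. (L2_norm (\<lambda>k. fourier_integral (trunc R u) k - v k))\<^sup>2" at_top 0] by simp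
  qed
  then show "is_fourier u v \<longleftrightarrow> v \<in> L2_space \<and> ?L"
    unfolding is_fourier_def trunc_def by blast
qed

lemma is_fourier_norm:
  assumes u: "u \<in> L2_space" and v: "is_fourier u v"
  shows "L2_norm v = sqrt (2 * pi) * L2_norm u"
proof -
  have v2: "v \<in> L2_space" and lim: "((\<lambda>R. L2_norm (\<lambda>k. fourier_integral (trunc R u) k - v k)) \<longlongrightarrow> 0) at_top"
    using v is_fourier_iff(1)[OF u] by auto
  have a: "((\<lambda>R. L2_norm (fourier_integral (trunc R u)) - L2_norm v) \<longlongrightarrow> 0) at_top"
    by (rule Lim_null_comparison[OF _ lim])
      (auto intro!: always_eventually L2_norm_diff_triangle is_fourier_iff(2)[OF u] v2)
  have b: "((\<lambda>R. L2_norm (trunc R u) - L2_norm u) \<longlongrightarrow> 0) at_top"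
  proof (rule Lim_null_comparison[OF _ trunc_tendsto[OF u]])
    show "\<forall>\<^sub>F R in at_top. norm (L2_norm (trunc R u) - L2_norm u) \<le> L2_norm (\<lambda>x. u x - trunc R u x)"
      using L2_norm_diff_triangle[OF u trunc_L2[OF u]]
      by (intro always_eventually) (simp add: abs_minus_commute)
  qed
  have "((\<lambda>R. L2_norm (trunc R u)) \<longlongrightarrow> L2_norm u) at_top" using b by (simp add: LIM_zero_iff)
  then have "((\<lambda>R. sqrt (2 * pi) * L2_norm (trunc R u)) \<longlongrightarrow> sqrt (2 * pi) * L2_norm u) at_top"
    by (intro tendsto_intros)
  moreover have "((\<lambda>R. sqrt (2 * pi) * L2_norm (trunc R u)) \<longlongrightarrow> L2_norm v) at_top"
    using a unfolding is_fourier_iff(3)[OF u] by (simp add: LIM_zero_iff)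
  ultimately show ?thesis
    by (rule tendsto_unique[OF trivial_limit_at_top_linorder, rotated])
qed

text \<open>
  Plancherel's theorem transfers the Cauchy property from the truncations to their Fourier integrals,
  with the tails of \<open>u\<close> as a modulus; completeness supplies a limit along the integers, and the same
  modulus extends it to all radii.
\<close>

lemma is_fourier_exists:
  assumes u: "u \<in> L2_space" shows "\<exists>v. is_fourier u v"
proof -
  note F = is_fourier_iff(2,3)[OF u]
  have diff: "L2_norm (\<lambda>k. fourier_integral (trunc R u) k - fourier_integral (trunc S u) k)
      \<le> sqrt (2 * pi) * (L2_norm (\<lambda>x. u x - trunc R u x) + L2_norm (\<lambda>x. u x - trunc S u x))" for R S
  proof -
    let ?w = "\<lambda>x. trunc R u x - trunc S u x"
    have w: "?w \<in> L2_space" "integrable lborel ?w"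
      by (auto intro!: L2_diff trunc_L2 u trunc_L1)
    have eq: "fourier_integral ?w = (\<lambda>k. fourier_integral (trunc R u) k - fourier_integral (trunc S u) k)"
      using fourier_integral_diff[OF trunc_L1[OF u] trunc_L1[OF u]] by blast
    have le: "L2_norm ?w \<le> L2_norm (\<lambda>x. u x - trunc R u x) + L2_norm (\<lambda>x. u x - trunc S u x)"
      using L2_norm_triangle[OF L2_diff[OF trunc_L2[OF u, of R] u] L2_diff[OF u trunc_L2[OF u, of S]]]
        L2_norm_minus_commute[of u "trunc R u"] by simp
    have [measurable]: "fourier_integral ?w \<in> borel_measurable borel"
      using w(2) by (intro fourier_integral_measurable) auto
    have "L2_norm (fourier_integral ?w) \<le> sqrt (2 * pi) * L2_norm ?w"
    proof (rule L2_norm_leI(2))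
      show "(\<integral>\<^sup>+k. ennreal ((norm (fourier_integral ?w k))\<^sup>2) \<partial>lborel) \<le> ennreal ((sqrt (2 * pi) * L2_norm ?w)\<^sup>2)"
        using Plancherel_L1_L2[OF w(2,1)] by (simp add: power_mult_distrib)
    qed auto
    also have "\<dots> \<le> sqrt (2 * pi) * (L2_norm (\<lambda>x. u x - trunc R u x) + L2_norm (\<lambda>x. u x - trunc S u x))"
      by (intro mult_left_mono le) simp
    finally show ?thesis unfolding eq .
  qed
  have small: "\<exists>r. \<forall>R\<ge>r. sqrt (2 * pi) * (L2_norm (\<lambda>x. u x - trunc R u x)) \<le> e / 2" if "e > 0" for e :: real
  proof -
    have "((\<lambda>R. sqrt (2 * pi) * L2_norm (\<lambda>x. u x - trunc R u x)) \<longlongrightarrow> sqrt (2 * pi) * 0) at_top"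
      by (intro tendsto_intros trunc_tendsto u)
    then have "eventually (\<lambda>R. sqrt (2 * pi) * L2_norm (\<lambda>x. u x - trunc R u x) < e / 2) at_top"
      using that by (intro order_tendstoD(2)) auto
    then show ?thesis unfolding eventually_at_top_linorder by (meson less_imp_le)
  qed
  obtain g where g: "g \<in> L2_space"
    and lim: "(\<lambda>n. L2_norm (\<lambda>k. fourier_integral (trunc (real n) u) k - g k)) \<longlonglongrightarrow> 0"
  proof (rule L2_complete[of "\<lambda>n. fourier_integral (trunc (real n) u)"])
    fix e :: real assume "e > 0"
    from small[OF this] obtain r where r: "\<And>R. R \<ge> r \<Longrightarrow> sqrt (2 * pi) * (L2_norm (\<lambda>x. u x - trunc R u x)) \<le> e / 2"
      by blast
    obtain N where N: "real N \<ge> r" using real_arch_simple by blast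
    show "\<exists>N. \<forall>m\<ge>N. \<forall>n\<ge>N. L2_norm (\<lambda>x. fourier_integral (trunc (real m) u) x - fourier_integral (trunc (real n) u) x) \<le> e"
    proof (intro exI[of _ N] allI impI)
      fix m n assume "m \<ge> N" "n \<ge> N"
      then have "real m \<ge> r" "real n \<ge> r" using N by linarith+
      from r[OF this(1)] r[OF this(2)] diff[of "real m" "real n"]
      show "L2_norm (\<lambda>x. fourier_integral (trunc (real m) u) x - fourier_integral (trunc (real n) u) x) \<le> e"
        unfolding distrib_left by linarith
    qed
  qed (use F in auto)
  have "((\<lambda>R. L2_norm (\<lambda>k. fourier_integral (trunc R u) k - g k)) \<longlongrightarrow> 0) at_top"
  proof (rule Lim_null_comparison)
    show "((\<lambda>R. sqrt (2 * pi) * L2_norm (\<lambda>x. u x - trunc R u x)) \<longlongrightarrow> 0) at_top"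
      using tendsto_mult_left[OF trunc_tendsto[OF u], of "sqrt (2 * pi)"] by simp
    show "\<forall>\<^sub>F R in at_top. norm (L2_norm (\<lambda>k. fourier_integral (trunc R u) k - g k))
        \<le> sqrt (2 * pi) * L2_norm (\<lambda>x. u x - trunc R u x)"
    proof (intro always_eventually allI)
      fix R :: real
      have "(\<lambda>n. sqrt (2 * pi) * (L2_norm (\<lambda>x. u x - trunc R u x) + L2_norm (\<lambda>x. u x - trunc (real n) u x))
            + L2_norm (\<lambda>k. fourier_integral (trunc (real n) u) k - g k))
          \<longlonglongrightarrow> sqrt (2 * pi) * (L2_norm (\<lambda>x. u x - trunc R u x) + 0) + 0"
        by (intro tendsto_intros lim filterlim_compose[OF trunc_tendsto[OF u] filterlim_real_sequentially])
      then have "L2_norm (\<lambda>k. fourier_integral (trunc R u) k - g k)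
          \<le> sqrt (2 * pi) * (L2_norm (\<lambda>x. u x - trunc R u x) + 0) + 0"
      proof (rule LIMSEQ_le_const, intro exI allI impI)
        fix n :: nat
        have "L2_norm (\<lambda>k. fourier_integral (trunc R u) k - g k)
          \<le> L2_norm (\<lambda>k. fourier_integral (trunc R u) k - fourier_integral (trunc (real n) u) k)
            + L2_norm (\<lambda>k. fourier_integral (trunc (real n) u) k - g k)"
          using L2_norm_triangle[OF L2_diff[OF F(1) F(1)] L2_diff[OF F(1) g], of R n n] by simp
        then show "L2_norm (\<lambda>k. fourier_integral (trunc R u) k - g k)
          \<le> sqrt (2 * pi) * (L2_norm (\<lambda>x. u x - trunc R u x) + L2_norm (\<lambda>x. u x - trunc (real n) u x))
            + L2_norm (\<lambda>k. fourier_integral (trunc (real n) u) k - g k)"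
          using diff[of R "real n"] by linarith
      qed
      then show "norm (L2_norm (\<lambda>k. fourier_integral (trunc R u) k - g k))
        \<le> sqrt (2 * pi) * L2_norm (\<lambda>x. u x - trunc R u x)" by simp
    qed
  qed
  then show ?thesis using is_fourier_iff(1)[OF u] g by blast
qed

lemma is_fourier_diff:
  assumes u: "u \<in> L2_space" "w \<in> L2_space" and f: "is_fourier u f" "is_fourier w g"
  shows "is_fourier (\<lambda>x. u x - w x) (\<lambda>k. f k - g k)"
proof -
  note F = f(1)[unfolded is_fourier_iff(1)[OF u(1)]] f(2)[unfolded is_fourier_iff(1)[OF u(2)]]
  have tr: "trunc R (\<lambda>x. u x - w x) = (\<lambda>x. trunc R u x - trunc R w x)" for R
    by (simp add: trunc_def fun_eq_iff scaleR_diff_right)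
  have eq: "fourier_integral (trunc R (\<lambda>x. u x - w x)) k - (f k - g k)
      = (fourier_integral (trunc R u) k - f k) - (fourier_integral (trunc R w) k - g k)" for R k
    unfolding tr fourier_integral_diff[OF trunc_L1[OF u(1)] trunc_L1[OF u(2)]] by simp
  have "((\<lambda>R. L2_norm (\<lambda>k. fourier_integral (trunc R (\<lambda>x. u x - w x)) k - (f k - g k))) \<longlongrightarrow> 0) at_top"
  proof (rule Lim_null_comparison)
    show "((\<lambda>R. L2_norm (\<lambda>k. fourier_integral (trunc R u) k - f k)
        + L2_norm (\<lambda>k. fourier_integral (trunc R w) k - g k)) \<longlongrightarrow> 0) at_top"
      using tendsto_add[OF conjunct2[OF F(1)] conjunct2[OF F(2)]] by simp
    show "\<forall>\<^sub>F R in at_top. norm (L2_norm (\<lambda>k. fourier_integral (trunc R (\<lambda>x. u x - w x)) k - (f k - g k)))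
      \<le> L2_norm (\<lambda>k. fourier_integral (trunc R u) k - f k)
        + L2_norm (\<lambda>k. fourier_integral (trunc R w) k - g k)"
    proof (intro always_eventually allI)
      fix R
      have a: "(\<lambda>k. fourier_integral (trunc R u) k - f k) \<in> L2_space" "(\<lambda>k. fourier_integral (trunc R w) k - g k) \<in> L2_space"
        using F by (auto intro!: L2_diff is_fourier_iff(2) u)
      show "norm (L2_norm (\<lambda>k. fourier_integral (trunc R (\<lambda>x. u x - w x)) k - (f k - g k)))
      \<le> L2_norm (\<lambda>k. fourier_integral (trunc R u) k - f k)
        + L2_norm (\<lambda>k. fourier_integral (trunc R w) k - g k)"
        unfolding eq using L2_norm_triangle_diff[OF a] by simp
    qed
  qed
  then show ?thesis
    unfolding is_fourier_iff(1)[OF L2_diff[OF u]] using F by (auto intro: L2_diff)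
qed

lemma is_fourier_fourier: "u \<in> L2_space \<Longrightarrow> is_fourier u (fourier u)"
  unfolding fourier_def by (rule someI_ex[OF is_fourier_exists])

lemma fourier_L2: "u \<in> L2_space \<Longrightarrow> fourier u \<in> L2_space"
  using is_fourier_fourier unfolding is_fourier_def by blast

lemma fourier_isometry:
  assumes "u \<in> L2_space" "w \<in> L2_space"
  shows "L2_norm (\<lambda>k. fourier u k - fourier w k) = sqrt (2 * pi) * L2_norm (\<lambda>x. u x - w x)"
  using assms by (intro is_fourier_norm L2_diff is_fourier_diff is_fourier_fourier)

lemma fourier_eqI:
  assumes u: "u \<in> L2_space" and v: "is_fourier u v"
  shows "AE k in lborel. fourier u k = v k"
proof -
  have z: "(\<lambda>x::real. 0::complex) \<in> L2_space" by (simp add: L2_space_def)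
  have "is_fourier (\<lambda>x. u x - u x) (\<lambda>k. fourier u k - v k)"
    by (intro is_fourier_diff u v is_fourier_fourier)
  then have "L2_norm (\<lambda>k. fourier u k - v k) = sqrt (2 * pi) * L2_norm (\<lambda>x::real. 0)"
    using is_fourier_norm[OF z] by simp
  moreover have "L2_norm (\<lambda>x::real. 0) = 0" by (simp add: L2_norm_def)
  ultimately have "L2_norm (\<lambda>k. fourier u k - v k) = 0" by simp
  moreover have "(\<lambda>k. fourier u k - v k) \<in> L2_space"
    using v by (intro L2_diff fourier_L2 u) (simp add: is_fourier_def)
  ultimately have "AE k in lborel. fourier u k - v k = 0" by (intro L2_norm_eq_0)
  then show ?thesis by eventually_elim simp
qed

text \<open>
  Injectivity is the isometry applied to a difference. It carries uniqueness from the Fourier side back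
  to physical space.
\<close>

lemma fourier_inj:
  assumes u: "u \<in> L2_space" "w \<in> L2_space" and eq: "AE k in lborel. fourier u k = fourier w k"
  shows "AE x in lborel. u x = w x"
proof -
  have m: "fourier u \<in> borel_measurable borel" "fourier w \<in> borel_measurable borel"
    by (intro L2_spaceD fourier_L2 u)+
  have "L2_norm (\<lambda>k. fourier u k - fourier w k) = L2_norm (\<lambda>k::real. 0)"
  proof (rule L2_norm_cong_AE)
    show "AE k in lborel. fourier u k - fourier w k = 0" using eq by eventually_elim simp
  qed (use m in auto)
  also have "L2_norm (\<lambda>k::real. 0) = 0" by (simp add: L2_norm_def)
  finally have "L2_norm (\<lambda>x. u x - w x) = 0" using fourier_isometry[OF u] by simp
  from L2_norm_eq_0[OF L2_diff[OF u] this] show ?thesis by eventually_elim simp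
qed

definition inverse_fourier_integral :: "(real \<Rightarrow> complex) \<Rightarrow> real \<Rightarrow> complex" where
  "inverse_fourier_integral f x = fourier_integral f (- x) / (2 * pi)"

lemma inverse_fourier_integral_L2:
  assumes f: "integrable lborel f" "f \<in> L2_space"
  shows "inverse_fourier_integral f \<in> L2_space"
    and "L2_norm f = sqrt (2 * pi) * L2_norm (inverse_fourier_integral f)"
proof -
  have [measurable]: "f \<in> borel_measurable borel" using f by auto
  have [measurable]: "inverse_fourier_integral f \<in> borel_measurable borel"
    unfolding inverse_fourier_integral_def[abs_def] by measurable
  have "(\<integral>\<^sup>+x. ennreal ((norm (inverse_fourier_integral f x))\<^sup>2) \<partial>lborel)
      = (\<integral>\<^sup>+x. ennreal (1 / (2 * pi)\<^sup>2) * ennreal ((norm (fourier_integral f (0 + -1 * x)))\<^sup>2) \<partial>lborel)"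
    by (intro nn_integral_cong)
      (simp add: inverse_fourier_integral_def norm_divide power_divide norm_mult ennreal_mult[symmetric])
  also have "\<dots> = ennreal (1 / (2 * pi)\<^sup>2) * (\<integral>\<^sup>+x. ennreal ((norm (fourier_integral f x))\<^sup>2) \<partial>lborel)"
    by (subst nn_integral_cmult, measurable, subst (2) nn_integral_real_affine[where c="-1" and t=0]) auto
  also have "\<dots> = ennreal (1 / (2 * pi)\<^sup>2 * (2 * pi * (L2_norm f)\<^sup>2))"
    unfolding Plancherel_L1_L2[OF f] by (rule ennreal_mult[symmetric]) auto
  also have "1 / (2 * pi)\<^sup>2 * (2 * pi * (L2_norm f)\<^sup>2) = (L2_norm f)\<^sup>2 / (2 * pi)"
    by (simp add: power2_eq_square)
  finally have n: "(\<integral>\<^sup>+x. ennreal ((norm (inverse_fourier_integral f x))\<^sup>2) \<partial>lborel) = ennreal ((L2_norm f)\<^sup>2 / (2 * pi))" .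
  show *: "inverse_fourier_integral f \<in> L2_space" by (rule L2_spaceI) (auto simp: n)
  have "(L2_norm (inverse_fourier_integral f))\<^sup>2 = (L2_norm f)\<^sup>2 / (2 * pi)"
    using n unfolding nn_integral_L2[OF *] by simp
  then have "(L2_norm f)\<^sup>2 = (sqrt (2 * pi) * L2_norm (inverse_fourier_integral f))\<^sup>2"
    by (simp add: power_mult_distrib)
  then show "L2_norm f = sqrt (2 * pi) * L2_norm (inverse_fourier_integral f)"
    by (simp add: power2_eq_iff_nonneg)
qed

text \<open>
  Fourier inversion follows from the isometry and one duality. Let \<open>w\<close> be the inverse integral of \<open>f\<close> and
  \<open>w\<^sub>R\<close> its truncation. Expanding the square, the cross term is \<open>2\<pi> \<parallel>w\<^sub>R\<parallel>\<^sup>2\<close> by Fubini, so that the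
  distance of \<open>fourier_integral w\<^sub>R\<close> to \<open>f\<close> has square \<open>2\<pi> (\<parallel>w\<parallel>\<^sup>2 - \<parallel>w\<^sub>R\<parallel>\<^sup>2)\<close>, which tends to zero.
\<close>

lemma is_fourier_inverse_fourier_integral:
  assumes f: "integrable lborel f" "f \<in> L2_space"
  shows "is_fourier (inverse_fourier_integral f) f"
proof -
  let ?w = "inverse_fourier_integral f"
  note W = inverse_fourier_integral_L2[OF f]
  note T = is_fourier_iff(2,3)[OF W(1)]
  have [measurable]: "f \<in> borel_measurable borel" "?w \<in> borel_measurable borel"
    using f W(1) L2_spaceD by auto
  have adj: "(LINT k|lborel. fourier_integral (trunc R ?w) k * cnj (f k))
     = complex_of_real (2 * pi * (L2_norm (trunc R ?w))\<^sup>2)" for R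
  proof -
    let ?K = "\<lambda>k x. exp (- (\<i> * complex_of_real (k * x)))"
    have "(LINT k|lborel. fourier_integral (trunc R ?w) k * cnj (f k))
        = (LINT k|lborel. LINT x|lborel. trunc R ?w x * cnj (f k) * ?K k x)"
      unfolding fourier_integral_def
      by (subst integral_mult_left_zero[symmetric]) (simp add: mult_ac del: of_real_mult)
    also have "\<dots> = (LINT x|lborel. LINT k|lborel. trunc R ?w x * cnj (f k) * ?K k x)"
      by (rule Fubini_bounded_kernel[where B=1])
        (use f in \<open>simp_all add: trunc_L1[OF W(1)] del: of_real_mult\<close>)
    also have "\<dots> = (LINT x|lborel. trunc R ?w x * cnj (2 * pi * ?w x))"
    proof (rule Bochner_Integration.integral_cong[OF refl])
      fix x
      have "(LINT k|lborel. trunc R ?w x * cnj (f k) * ?K k x) = trunc R ?w x * (LINT k|lborel. cnj (exp (- (\<i> * complex_of_real (- x * k))) * f k))"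
        by (subst integral_mult_right_zero[symmetric]) (simp add: mult_ac exp_cnj)
      also have "(LINT k|lborel. cnj (exp (- (\<i> * complex_of_real (- x * k))) * f k)) = cnj (fourier_integral f (- x))"
        unfolding fourier_integral_def by (rule Bochner_Integration.integral_cnj)
      also have "fourier_integral f (- x) = 2 * pi * ?w x" by (simp add: inverse_fourier_integral_def)
      finally show "(LINT k|lborel. trunc R ?w x * cnj (f k) * ?K k x) = trunc R ?w x * cnj (2 * pi * ?w x)" .
    qed
    also have "\<dots> = (LINT x|lborel. complex_of_real (2 * pi * (norm (trunc R ?w x))\<^sup>2))"
    proof (rule Bochner_Integration.integral_cong[OF refl])
      fix x
      have "trunc R ?w x * cnj (?w x) = complex_of_real ((norm (trunc R ?w x))\<^sup>2)"
        unfolding complex_norm_square by (simp add: trunc_def indicator_def)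
      then show "trunc R ?w x * cnj (2 * pi * ?w x) = complex_of_real (2 * pi * (norm (trunc R ?w x))\<^sup>2)"
        by (simp add: mult_ac)
    qed
    also have "\<dots> = complex_of_real (2 * pi * (L2_norm (trunc R ?w))\<^sup>2)"
      unfolding L2_norm_sq by (simp only: integral_complex_of_real integral_mult_right_zero)
    finally show ?thesis .
  qed
  have sq: "(L2_norm (\<lambda>k. fourier_integral (trunc R ?w) k - f k))\<^sup>2
      = 2 * pi * ((L2_norm ?w)\<^sup>2 - (L2_norm (trunc R ?w))\<^sup>2)" for R
  proof -
    let ?h = "fourier_integral (trunc R ?w)"
    have pt: "(norm (?h k - f k))\<^sup>2 = (norm (?h k))\<^sup>2 + (norm (f k))\<^sup>2 - 2 * Re (?h k * cnj (f k))" for k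
      unfolding cmod_power2 by (simp add: power2_diff algebra_simps)
    have i: "integrable lborel (\<lambda>k. ?h k * cnj (f k))"
      by (intro L2_mult_integrable T L2_cnj f)
    have "(L2_norm (\<lambda>k. ?h k - f k))\<^sup>2 = (LINT k|lborel. (norm (?h k))\<^sup>2 + (norm (f k))\<^sup>2 - 2 * Re (?h k * cnj (f k)))"
      unfolding L2_norm_sq pt ..
    also have "\<dots> = (L2_norm ?h)\<^sup>2 + (L2_norm f)\<^sup>2 - 2 * (LINT k|lborel. Re (?h k * cnj (f k)))"
      using i L2_spaceD(2)[OF T(1)[of R]] L2_spaceD(2)[OF f(2)]
      by (simp add: L2_norm_sq integrable_Re del: times_complex.sel)
    also have "(LINT k|lborel. Re (?h k * cnj (f k))) = Re (LINT k|lborel. ?h k * cnj (f k))"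
      by (rule integral_Re[OF i])
    also have "Re (LINT k|lborel. ?h k * cnj (f k)) = 2 * pi * (L2_norm (trunc R ?w))\<^sup>2"
      unfolding adj by (rule Re_complex_of_real)
    finally show ?thesis
      unfolding T(2) W(2) by (simp add: power_mult_distrib algebra_simps)
  qed
  have b: "((\<lambda>R. L2_norm (trunc R ?w) - L2_norm ?w) \<longlongrightarrow> 0) at_top"
  proof (rule Lim_null_comparison[OF _ trunc_tendsto[OF W(1)]])
    show "\<forall>\<^sub>F R in at_top. norm (L2_norm (trunc R ?w) - L2_norm ?w) \<le> L2_norm (\<lambda>x. ?w x - trunc R ?w x)"
      using L2_norm_diff_triangle[OF W(1) trunc_L2[OF W(1)]]
      by (intro always_eventually) (simp add: abs_minus_commute)
  qed
  then have "((\<lambda>R. L2_norm (trunc R ?w)) \<longlongrightarrow> L2_norm ?w) at_top" by (simp add: LIM_zero_iff)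
  then have "((\<lambda>R. sqrt (2 * pi * ((L2_norm ?w)\<^sup>2 - (L2_norm (trunc R ?w))\<^sup>2)))
      \<longlongrightarrow> sqrt (2 * pi * ((L2_norm ?w)\<^sup>2 - (L2_norm ?w)\<^sup>2))) at_top"
    by (intro tendsto_intros)
  then have "((\<lambda>R. L2_norm (\<lambda>k. fourier_integral (trunc R ?w) k - f k)) \<longlongrightarrow> 0) at_top"
    unfolding sq[symmetric] by simp
  then show ?thesis using is_fourier_iff(1)[OF W(1)] f(2) by blast
qed

section \<open>Absence of resonances\<close>

text \<open>
  The imaginary part of the bilinear phase up to sign: the defect of subadditivity of the dispersion relation.
\<close>

definition gap :: "real \<Rightarrow> real \<Rightarrow> real" where
  "gap a b = sqrt (1 + a\<^sup>2) + sqrt (1 + b\<^sup>2) - sqrt (1 + (a + b)\<^sup>2)"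

lemma abs_le_sqrt_1: "\<bar>a\<bar> \<le> sqrt (1 + a\<^sup>2)"
  by (rule real_le_rsqrt) simp

lemma gap_ge_aux: "sqrt (1 + a\<^sup>2) - \<bar>a\<bar> \<le> gap a b"
proof -
  have "a * b \<le> \<bar>a\<bar> * \<bar>b\<bar>" using abs_ge_self[of "a * b"] by (simp only: abs_mult)
  also have "\<dots> \<le> \<bar>a\<bar> * sqrt (1 + b\<^sup>2)" by (intro mult_left_mono abs_le_sqrt_1) simp
  finally have "a * b \<le> \<bar>a\<bar> * sqrt (1 + b\<^sup>2)" .
  then have "1 + (a + b)\<^sup>2 \<le> (sqrt (1 + b\<^sup>2) + \<bar>a\<bar>)\<^sup>2"
    by (simp add: power2_sum algebra_simps)
  then have "sqrt (1 + (a + b)\<^sup>2) \<le> sqrt (1 + b\<^sup>2) + \<bar>a\<bar>"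
    by (rule real_le_lsqrt[rotated]) simp
  then show ?thesis by (simp add: gap_def)
qed

lemma gap_commute: "gap a b = gap b a"
  by (simp add: gap_def add.commute)

lemma gap_nonneg: "0 \<le> gap a b"
  using gap_ge_aux[of a b] abs_le_sqrt_1[of a] by simp

text \<open>
  A shift by \<open>a\<close> changes \<open>sqrt (1 + x\<^sup>2)\<close> by at most \<open>\<bar>a\<bar>\<close>, and \<open>sqrt (1 + a\<^sup>2)\<close> exceeds \<open>\<bar>a\<bar>\<close> by a
  definite amount as long as \<open>a\<close> is bounded.
\<close>

lemma gap_small:
  assumes "\<bar>a\<bar> \<le> 1" shows "1 / 3 \<le> gap a b"
proof -
  have "(\<bar>a\<bar> + 1 / 3)\<^sup>2 \<le> 1 + a\<^sup>2"
    using assms by (simp add: power2_sum power2_eq_square algebra_simps)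
  then have "\<bar>a\<bar> + 1 / 3 \<le> sqrt (1 + a\<^sup>2)" by (rule real_le_rsqrt)
  then show ?thesis using gap_ge_aux[of a b] by simp
qed

lemma gap_opposite:
  assumes "a * b \<le> 0" shows "1 \<le> gap a b"
proof -
  have *: "1 \<le> gap x y" if xy: "x * y \<le> 0" "\<bar>x\<bar> \<le> \<bar>y\<bar>" for x y
  proof -
    have "(x + y)\<^sup>2 \<le> y\<^sup>2"
    proof -
      have "\<bar>x + y\<bar> \<le> \<bar>y\<bar>" using xy unfolding mult_le_0_iff by linarith
      then show ?thesis by (simp add: abs_le_square_iff)
    qed
    then have "sqrt (1 + (x + y)\<^sup>2) \<le> sqrt (1 + y\<^sup>2)" by simp
    moreover have "1 \<le> sqrt (1 + x\<^sup>2)" by (rule real_le_rsqrt) simp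
    ultimately show ?thesis unfolding gap_def by linarith
  qed
  show ?thesis
  proof (cases "\<bar>a\<bar> \<le> \<bar>b\<bar>")
    case True then show ?thesis by (rule *[OF assms])
  next
    case False
    then have "1 \<le> gap b a" using assms by (intro *) (simp_all add: mult.commute)
    then show ?thesis by (simp only: gap_commute)
  qed
qed

text \<open>
  Three mechanisms exclude resonances: a small frequency, or two frequencies of opposite sign, make
  the imaginary part of the phase at least \<open>1/3\<close>; frequencies of one sign and modulus at least 1
  make the viscous part at least \<open>2d\<close>.
\<close>

lemma bilinear_phase_bound:
  assumes "d > 0"
  shows "min (1/3) (2 * d) \<le> norm (symbol d a + symbol d b - symbol d (a + b))"
proof -
  let ?z = "symbol d a + symbol d b - symbol d (a + b)"
  have re: "Re ?z = 2 * d * (a * b)" by (simp add: symbol_def power2_sum algebra_simps)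
  have im: "- Im ?z = gap a b" by (simp add: symbol_def gap_def)
  show ?thesis
  proof (cases "\<bar>a\<bar> \<le> 1 \<or> \<bar>b\<bar> \<le> 1 \<or> a * b \<le> 0")
    case True
    then have "1 / 3 \<le> gap a b"
      using gap_small[of a b] gap_small[of b a] gap_opposite[of a b] gap_commute[of a b] by linarith
    then have "1 / 3 \<le> \<bar>Im ?z\<bar>" using im by linarith
    then show ?thesis using abs_Im_le_cmod[of ?z] by linarith
  next
    case False
    then have "1 \<le> \<bar>a\<bar> * \<bar>b\<bar>" using mult_mono[of 1 "\<bar>a\<bar>" 1 "\<bar>b\<bar>"] by simp
    then have "1 \<le> a * b" using False by (simp flip: abs_mult)
    then have "2 * d * 1 \<le> 2 * d * (a * b)" using assms by (intro mult_left_mono) auto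
    then have "2 * d \<le> \<bar>Re ?z\<bar>" unfolding re by linarith
    then show ?thesis using abs_Re_le_cmod[of ?z] by linarith
  qed
qed

lemma trilinear_phase_bound:
  assumes "d > 0"
  shows "min (1/3) (2 * d) \<le> norm (symbol d a + symbol d b + symbol d c - symbol d (a + b + c))"
proof -
  let ?z = "symbol d a + symbol d b + symbol d c - symbol d (a + b + c)"
  have re: "Re ?z = 2 * d * (a * b + b * c + a * c)" by (simp add: symbol_def power2_sum algebra_simps)
  have im: "- Im ?z = gap a b + gap (a + b) c" by (simp add: symbol_def gap_def)
  have im': "- Im ?z = gap b c + gap a (b + c)" "- Im ?z = gap a c + gap (a + c) b"
    by (simp_all add: symbol_def gap_def add_ac)
  have ge: "- Im ?z \<ge> gap a b" "- Im ?z \<ge> gap b c" "- Im ?z \<ge> gap a c"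
    using gap_nonneg[of "a + b" c] gap_nonneg[of a "b + c"] gap_nonneg[of "a + c" b] im im' by linarith+
  have one: "1 \<le> x * y" if "\<not> \<bar>x\<bar> \<le> 1" "\<not> \<bar>y\<bar> \<le> 1" "\<not> x * y \<le> 0" for x y :: real
  proof -
    have "1 \<le> \<bar>x\<bar> * \<bar>y\<bar>" using mult_mono[of 1 "\<bar>x\<bar>" 1 "\<bar>y\<bar>"] that by simp
    then show ?thesis using that by (simp flip: abs_mult)
  qed
  show ?thesis
  proof (cases "\<bar>a\<bar> \<le> 1 \<or> \<bar>b\<bar> \<le> 1 \<or> \<bar>c\<bar> \<le> 1 \<or> a * b \<le> 0 \<or> b * c \<le> 0 \<or> a * c \<le> 0")
    case True
    have "1 / 3 \<le> gap a b \<or> 1 / 3 \<le> gap b c \<or> 1 / 3 \<le> gap a c"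
      using True gap_small[of a b] gap_small[of b c] gap_small[of c b, unfolded gap_commute[of c b]]
        order_trans[OF _ gap_opposite, of "1/3"] by auto
    then have "1 / 3 \<le> - Im ?z" using ge by linarith
    then show ?thesis using abs_Im_le_cmod[of ?z] by linarith
  next
    case False
    then have "1 \<le> a * b" "1 \<le> b * c" "1 \<le> a * c" using one by auto
    then have "2 * d * 1 \<le> 2 * d * (a * b + b * c + a * c)" using assms by (intro mult_left_mono) auto
    then have "2 * d \<le> \<bar>Re ?z\<bar>" unfolding re by linarith
    then show ?thesis using abs_Re_le_cmod[of ?z] by linarith
  qed
qed

lemma norm_exp_symbol: "norm (exp (of_real t * symbol d k)) = exp (- (t * d * k\<^sup>2))"
  by (simp add: symbol_def)

section \<open>Convolutions and the heat semigroup\<close>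

text \<open>
  Two constants rather than one norm: decay in time enters through the integral alone, and the sup bound
  of a convolution uses the sup of one factor and the integral of the other. Nonnegative extended values
  let Tonelli's theorem apply without integrability conditions.
\<close>

definition XB :: "(real \<Rightarrow> ennreal) \<Rightarrow> real \<Rightarrow> real \<Rightarrow> bool" where
  "XB F A B \<longleftrightarrow> F \<in> borel_measurable borel \<and> 0 \<le> A \<and> 0 \<le> B \<and> (\<forall>k. F k \<le> ennreal A)
    \<and> (\<integral>\<^sup>+k. F k \<partial>lborel) \<le> ennreal B"

definition conv :: "(real \<Rightarrow> ennreal) \<Rightarrow> (real \<Rightarrow> ennreal) \<Rightarrow> real \<Rightarrow> ennreal" where
  "conv F G k = (\<integral>\<^sup>+l. F (k - l) * G l \<partial>lborel)"

lemma nn_integral_reflect: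
  fixes f :: "real \<Rightarrow> ennreal"
  assumes [measurable]: "f \<in> borel_measurable borel"
  shows "(\<integral>\<^sup>+l. f (k - l) \<partial>lborel) = (\<integral>\<^sup>+l. f l \<partial>lborel)"
  using nn_integral_real_affine[of f "-1" k] by simp

lemma XBI:
  assumes "F \<in> borel_measurable borel" "0 \<le> A" "0 \<le> B" "\<And>k. F k \<le> ennreal A"
    "(\<integral>\<^sup>+k. F k \<partial>lborel) \<le> ennreal B"
  shows "XB F A B"
  using assms by (simp add: XB_def)

lemma XBD:
  assumes "XB F A B"
  shows "F \<in> borel_measurable borel" "0 \<le> A" "0 \<le> B" "F k \<le> ennreal A"
    "(\<integral>\<^sup>+k. F k \<partial>lborel) \<le> ennreal B"
  using assms by (simp_all add: XB_def)

lemma conv_measurable [measurable]: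
  assumes [measurable]: "F \<in> borel_measurable borel" "G \<in> borel_measurable borel"
  shows "conv F G \<in> borel_measurable borel"
  unfolding conv_def[abs_def] by measurable

lemma XB_conv:
  assumes F: "XB F A B" and G: "XB G A' B'"
  shows "XB (conv F G) (A * B') (B * B')"
proof -
  have [measurable]: "F \<in> borel_measurable borel" "G \<in> borel_measurable borel"
    using F G by (auto simp: XB_def)
  have pos: "0 \<le> A" "0 \<le> B" "0 \<le> B'" using F G by (auto simp: XB_def)
  have "conv F G k \<le> ennreal (A * B')" for k
  proof -
    have "conv F G k \<le> (\<integral>\<^sup>+l. ennreal A * G l \<partial>lborel)"
      unfolding conv_def using F by (intro nn_integral_mono mult_right_mono) (auto simp: XB_def)
    also have "\<dots> = ennreal A * (\<integral>\<^sup>+l. G l \<partial>lborel)" by (rule nn_integral_cmult) measurable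
    also have "\<dots> \<le> ennreal A * ennreal B'" using G by (intro mult_left_mono) (auto simp: XB_def)
    finally show ?thesis using pos by (simp add: ennreal_mult)
  qed
  moreover have "(\<integral>\<^sup>+k. conv F G k \<partial>lborel) \<le> ennreal (B * B')"
  proof -
    have "(\<integral>\<^sup>+k. conv F G k \<partial>lborel) = (\<integral>\<^sup>+l. \<integral>\<^sup>+k. F (k - l) * G l \<partial>lborel \<partial>lborel)"
      unfolding conv_def by (rule lborel_pair.Fubini') measurable
    also have "\<dots> = (\<integral>\<^sup>+l. (\<integral>\<^sup>+k. F k \<partial>lborel) * G l \<partial>lborel)"
    proof (rule nn_integral_cong)
      fix l
      have "(\<integral>\<^sup>+k. F (k - l) * G l \<partial>lborel) = (\<integral>\<^sup>+k. F (k + - l) \<partial>lborel) * G l"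
        by (subst nn_integral_multc[symmetric]) auto
      then show "(\<integral>\<^sup>+k. F (k - l) * G l \<partial>lborel) = (\<integral>\<^sup>+k. F k \<partial>lborel) * G l"
        by (subst (asm) nn_integral_translate) auto
    qed
    also have "\<dots> = (\<integral>\<^sup>+k. F k \<partial>lborel) * (\<integral>\<^sup>+k. G k \<partial>lborel)" by (rule nn_integral_cmult) measurable
    also have "\<dots> \<le> ennreal B * ennreal B'" using F G by (intro mult_mono) (auto simp: XB_def)
    finally show ?thesis using pos by (simp add: ennreal_mult)
  qed
  ultimately show ?thesis using pos by (intro XBI) auto
qed

lemma XB_mono:
  assumes "XB F A B" "A \<le> A'" "B \<le> B'" "G \<in> borel_measurable borel" "\<And>k. G k \<le> F k"
  shows "XB G A' B'"
proof -
  have "(\<integral>\<^sup>+k. G k \<partial>lborel) \<le> (\<integral>\<^sup>+k. F k \<partial>lborel)" by (intro nn_integral_mono assms)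
  also have "\<dots> \<le> ennreal B" using assms by (simp add: XB_def)
  also have "\<dots> \<le> ennreal B'" using assms by (intro ennreal_leI)
  finally have "(\<integral>\<^sup>+k. G k \<partial>lborel) \<le> ennreal B'" .
  moreover have "G k \<le> ennreal A'" for k
    by (rule order_trans[OF assms(5) order_trans[OF XBD(4)[OF assms(1)] ennreal_leI[OF assms(2)]]])
  moreover have "0 \<le> A'" "0 \<le> B'" using XBD(2,3)[OF assms(1)] assms(2,3) by linarith+
  ultimately show ?thesis by (intro XBI assms(4))
qed

lemma XB_weaken: "XB F A B \<Longrightarrow> A \<le> A' \<Longrightarrow> B \<le> B' \<Longrightarrow> XB F A' B'"
  by (rule XB_mono[OF _ _ _ XBD(1) order_refl])

lemma XB_add:
  assumes "XB F A B" "XB G A' B'"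
  shows "XB (\<lambda>k. F k + G k) (A + A') (B + B')"
proof -
  have [measurable]: "F \<in> borel_measurable borel" "G \<in> borel_measurable borel"
    using assms by (auto simp: XB_def)
  have "(\<integral>\<^sup>+k. F k + G k \<partial>lborel) \<le> ennreal B + ennreal B'"
    using assms by (subst nn_integral_add) (auto simp: XB_def intro!: add_mono)
  moreover have "F k + G k \<le> ennreal A + ennreal A'" for k
    using assms by (auto simp: XB_def intro!: add_mono)
  ultimately show ?thesis using XBD(2,3)[OF assms(1)] XBD(2,3)[OF assms(2)]
    by (intro XBI) (auto simp: ennreal_plus)
qed

lemma XB_cmult:
  assumes "XB F A B" "0 \<le> c"
  shows "XB (\<lambda>k. ennreal c * F k) (c * A) (c * B)"
proof -
  have [measurable]: "F \<in> borel_measurable borel" using assms by (auto simp: XB_def)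
  have "(\<integral>\<^sup>+k. ennreal c * F k \<partial>lborel) \<le> ennreal (c * B)"
    using assms by (subst nn_integral_cmult) (auto simp: XB_def ennreal_mult intro!: mult_left_mono)
  moreover have "ennreal c * F k \<le> ennreal (c * A)" for k
    using assms by (auto simp: XB_def ennreal_mult intro!: mult_left_mono)
  ultimately show ?thesis using assms(2) XBD(2,3)[OF assms(1)] by (intro XBI) auto
qed

text \<open>
  Every decay rate of the proof is a power of this one, which is normalised to be 1 at time 0.
\<close>

definition rho :: "real \<Rightarrow> real" where "rho t = 1 / sqrt (1 + t)"

lemma rho_bounds: "0 \<le> t \<Longrightarrow> 0 < rho t" "0 \<le> t \<Longrightarrow> rho t \<le> 1"
  by (simp_all add: rho_def)

lemma rho_power_le: "0 \<le> t \<Longrightarrow> m \<le> n \<Longrightarrow> rho t ^ n \<le> rho t ^ m"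
  by (rule power_decreasing) (use rho_bounds in \<open>auto simp: less_imp_le\<close>)

lemma rho_measurable [measurable]: "rho \<in> borel_measurable borel"
  unfolding rho_def[abs_def] by measurable

text \<open>
  The factor \<open>sqrt 2\<close> pays for short times, where \<open>rho t\<close> is at least \<open>1 / sqrt 2\<close>, and \<open>sqrt (pi / d)\<close> is the
  integral of the Gaussian at time 1.
\<close>

definition heat_const :: "real \<Rightarrow> real" where
  "heat_const d = sqrt 2 * (1 + sqrt (pi / d))"

lemma heat_const_ge_1: "d > 0 \<Longrightarrow> 1 \<le> heat_const d"
proof -
  assume "d > 0"
  then have "1 * 1 \<le> sqrt 2 * (1 + sqrt (pi / d))" by (intro mult_mono) auto
  then show ?thesis by (simp add: heat_const_def)
qed

lemma nn_integral_heat: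
  assumes "a > 0"
  shows "(\<integral>\<^sup>+k. ennreal (exp (- (a * k\<^sup>2))) \<partial>lborel) = ennreal (sqrt (pi / a))"
proof -
  define s where "s = sqrt (1 / (2 * a))"
  have s: "s > 0" "s\<^sup>2 = 1 / (2 * a)" using assms by (simp_all add: s_def)
  have "exp (- (a * k\<^sup>2)) = sqrt (pi / a) * normal_density 0 s k" for k
  proof -
    have "- ((k - 0)\<^sup>2 / (2 * s\<^sup>2)) = - (a * k\<^sup>2)" using assms by (simp add: s(2))
    moreover have "2 * pi * s\<^sup>2 = pi / a" using assms by (simp add: s(2))
    ultimately show ?thesis using assms by (simp add: normal_density_def)
  qed
  then have "(\<integral>\<^sup>+k. ennreal (exp (- (a * k\<^sup>2))) \<partial>lborel) = (\<integral>\<^sup>+k. ennreal (sqrt (pi / a) * normal_density 0 s k) \<partial>lborel)"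
    by simp
  also have "\<dots> = ennreal (LINT k|lborel. sqrt (pi / a) * normal_density 0 s k)"
    by (rule nn_integral_eq_integral) (use s assms in auto)
  also have "(LINT k|lborel. sqrt (pi / a) * normal_density 0 s k) = sqrt (pi / a)"
    using s by simp
  finally show ?thesis .
qed

text \<open>
  For \<open>t \<le> 1\<close> the Gaussian factor is dropped; for \<open>t > 1\<close> its own integral, of order \<open>t\<close> to the power
  \<open>-1/2\<close>, multiplies the sup bound.
\<close>

lemma XB_heat:
  assumes F: "XB F h h" and t: "0 \<le> t" and d: "d > 0"
  shows "XB (\<lambda>k. ennreal (exp (- (t * d * k\<^sup>2))) * F k) h (heat_const d * h * rho t)"
proof -
  have [measurable]: "F \<in> borel_measurable borel" and h: "0 \<le> h" using F by (auto simp: XB_def)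
  let ?G = "\<lambda>k. ennreal (exp (- (t * d * k\<^sup>2)))"
  have e1: "?G k \<le> 1" for k using t d by (simp add: ennreal_le_1)
  have le: "?G k * F k \<le> F k" for k using mult_right_mono[OF e1, of "F k" k] by simp
  have r: "0 < rho t" using t rho_bounds by simp
  have "(\<integral>\<^sup>+k. ?G k * F k \<partial>lborel) \<le> ennreal (heat_const d * h * rho t)"
  proof (cases "t \<le> 1")
    case True
    have "(\<integral>\<^sup>+k. ?G k * F k \<partial>lborel) \<le> (\<integral>\<^sup>+k. F k \<partial>lborel)" by (intro nn_integral_mono le)
    also have "\<dots> \<le> ennreal h" using F by (simp add: XB_def)
    also have "h \<le> heat_const d * h * rho t"
    proof -
      have "1 \<le> sqrt 2 * rho t" using True t by (simp add: rho_def)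
      also have "\<dots> \<le> heat_const d * rho t" using r d by (intro mult_right_mono) (auto simp: heat_const_def)
      finally show ?thesis using mult_left_mono[of 1 "heat_const d * rho t" h] h by (simp add: mult_ac)
    qed
    finally show ?thesis by (simp add: ennreal_leI)
  next
    case False
    have "(\<integral>\<^sup>+k. ?G k * F k \<partial>lborel) \<le> (\<integral>\<^sup>+k. ?G k * ennreal h \<partial>lborel)"
      using F by (intro nn_integral_mono mult_left_mono) (auto simp: XB_def)
    also have "\<dots> = (\<integral>\<^sup>+k. ?G k \<partial>lborel) * ennreal h" by (rule nn_integral_multc) measurable
    also have "\<dots> = ennreal (sqrt (pi / (t * d)) * h)"
      using False d h by (subst nn_integral_heat) (auto simp: ennreal_mult)
    also have "sqrt (pi / (t * d)) * h \<le> heat_const d * h * rho t"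
    proof -
      have "pi / (t * d) \<le> 2 * (pi / d) * (1 / (1 + t))"
      proof -
        have "1 / t \<le> 2 * (1 / (1 + t))" using False by (simp add: field_simps)
        then have "pi / d * (1 / t) \<le> pi / d * (2 * (1 / (1 + t)))" using d by (intro mult_left_mono) auto
        then show ?thesis by (simp add: mult.commute)
      qed
      then have "sqrt (pi / (t * d)) \<le> sqrt (2 * (pi / d) * (1 / (1 + t)))" by (rule real_sqrt_le_mono)
      also have "\<dots> = sqrt 2 * sqrt (pi / d) * rho t" by (simp add: rho_def real_sqrt_mult real_sqrt_divide)
      also have "\<dots> \<le> heat_const d * rho t" using r by (intro mult_right_mono) (auto simp: heat_const_def algebra_simps)
      finally have "sqrt (pi / (t * d)) * h \<le> heat_const d * rho t * h" using h by (rule mult_right_mono)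
      then show ?thesis by (simp only: mult_ac)
    qed
    finally show ?thesis by (simp add: ennreal_leI)
  qed
  moreover have "?G k * F k \<le> ennreal h" for k by (rule order_trans[OF le XBD(4)[OF F]])
  ultimately show ?thesis using h r heat_const_ge_1[OF d] by (intro XBI) auto
qed

lemma rho_cube_integral:
  assumes "0 \<le> t"
  shows "(\<integral>\<^sup>+s\<in>{0..t}. ennreal (rho s ^ 3) \<partial>lborel) \<le> 2"
    and "(\<integral>\<^sup>+s\<in>{0..t}. ennreal (rho (t - s) ^ 3) \<partial>lborel) \<le> 2"
proof -
  have D: "((\<lambda>s. - 2 * rho s) has_real_derivative rho s ^ 3) (at s)" if "0 \<le> s" for s
  proof -
    have "((\<lambda>s. - 2 * (1 / sqrt (1 + s))) has_real_derivative rho s ^ 3) (at s)"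
      using that by (auto intro!: derivative_eq_intros simp: rho_def power3_eq_cube field_simps)
    then show ?thesis by (simp add: rho_def[abs_def])
  qed
  have "(\<integral>\<^sup>+s. ennreal (rho s ^ 3) * indicator {0..t} s \<partial>lborel) = ennreal (- 2 * rho t - (- 2 * rho 0))"
  proof (rule nn_integral_FTC_Icc[OF _ _ _ assms])
    fix s assume "s \<in> {0..t}"
    then have s: "0 \<le> s" by simp
    show "((\<lambda>s. - 2 * rho s) has_real_derivative rho s ^ 3) (at s)" by (rule D[OF s])
    show "0 \<le> rho s ^ 3" by (rule zero_le_power[OF less_imp_le[OF rho_bounds(1)[OF s]]])
  qed (use rho_measurable in measurable)
  also have "\<dots> \<le> ennreal 2"
  proof (rule ennreal_leI)
    have "rho 0 = 1" by (simp add: rho_def)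
    then show "- 2 * rho t - (- 2 * rho 0) \<le> 2" using rho_bounds(1)[OF assms] by linarith
  qed
  finally show *: "(\<integral>\<^sup>+s\<in>{0..t}. ennreal (rho s ^ 3) \<partial>lborel) \<le> 2" by simp
  have "(\<integral>\<^sup>+s. ennreal (rho (t - s) ^ 3) * indicator {0..t} s \<partial>lborel)
      = (\<integral>\<^sup>+s. ennreal (rho (t - s) ^ 3) * indicator {0..t} (t - s) \<partial>lborel)"
    by (intro nn_integral_cong) (auto simp: indicator_def)
  also have "\<dots> = (\<integral>\<^sup>+s. ennreal (rho s ^ 3) * indicator {0..t} s \<partial>lborel)"
    by (rule nn_integral_reflect[of "\<lambda>s. ennreal (rho s ^ 3) * indicator {0..t} s"]) measurable
  finally show "(\<integral>\<^sup>+s\<in>{0..t}. ennreal (rho (t - s) ^ 3) \<partial>lborel) \<le> 2" using * by simp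
qed

text \<open>
  Since \<open>1 + t\<close> is at most \<open>(1 + (t - s)) + (1 + s)\<close>, one of the two factors is at least as small as
  \<open>rho t\<close>, up to a constant. Extracting it leaves a cube that is integrable in time, and this makes the
  quartic remainder harmless while a cubic one would lose a logarithm.
\<close>

lemma rho_product_le:
  assumes "0 \<le> s" "s \<le> t"
  shows "rho (t - s) * rho s ^ 3 \<le> rho t * (2 * rho s ^ 3 + rho (t - s) ^ 3)"
proof -
  define x y where "x = rho (t - s)" and "y = rho s"
  have pos: "0 < x" "0 < y" "0 < rho t" unfolding x_def y_def using assms rho_bounds by auto
  have "1 / rho t \<le> 1 / x + 1 / y"
  proof -
    have "sqrt (1 + t) \<le> sqrt ((1 + (t - s)) + (1 + s))" by simp
    also have "\<dots> \<le> sqrt (1 + (t - s)) + sqrt (1 + s)"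
      using assms by (intro sqrt_add_le_add_sqrt) auto
    finally show ?thesis by (simp add: rho_def x_def y_def)
  qed
  then have "x * y ^ 3 \<le> rho t * ((1 / x + 1 / y) * (x * y ^ 3))"
    using mult_left_mono[of 1 "rho t * (1 / x + 1 / y)" "x * y ^ 3"] pos
    by (simp add: field_simps)
  also have "(1 / x + 1 / y) * (x * y ^ 3) = y ^ 3 + x * y\<^sup>2"
    using pos by (simp add: field_simps power2_eq_square power3_eq_cube)
  also have "rho t * (y ^ 3 + x * y\<^sup>2) \<le> rho t * (2 * y ^ 3 + x ^ 3)"
  proof (rule mult_left_mono)
    have "x * y\<^sup>2 \<le> y ^ 3 + x ^ 3"
    proof (cases "x \<le> y")
      case True
      then have "x * y\<^sup>2 \<le> y * y\<^sup>2" by (intro mult_right_mono) auto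
      also have "\<dots> \<le> y ^ 3 + x ^ 3" using pos by (simp add: power2_eq_square power3_eq_cube)
      finally show ?thesis .
    next
      case False
      then have "x * y\<^sup>2 \<le> x * x\<^sup>2" using pos by (intro mult_left_mono power_mono) auto
      also have "\<dots> \<le> y ^ 3 + x ^ 3" using pos by (simp add: power2_eq_square power3_eq_cube)
      finally show ?thesis .
    qed
    then show "y ^ 3 + x * y\<^sup>2 \<le> 2 * y ^ 3 + x ^ 3" by simp
  qed (use pos in auto)
  finally show ?thesis by (simp add: x_def y_def)
qed

text \<open>
  The quartic forcing decays like \<open>rho\<close> cubed in the sup norm as well as in the integral. The sup bound of
  its Duhamel integral is then uniform in time, and the heat semigroup adds the decay of the integral.
\<close>

lemma XB_duhamel:
  assumes Q [measurable]: "(\<lambda>(s, k). Q s k) \<in> borel_measurable (borel \<Otimes>\<^sub>M borel)"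
    and b: "\<And>s. 0 \<le> s \<Longrightarrow> s \<le> t \<Longrightarrow> XB (Q s) (q * rho s ^ 3) (q * rho s ^ 3)"
    and t: "0 \<le> t" and d: "d > 0" and q: "0 \<le> q"
  shows "XB (\<lambda>k. \<integral>\<^sup>+s\<in>{0..t}. ennreal (exp (- ((t - s) * d * k\<^sup>2))) * Q s k \<partial>lborel)
    (2 * q) (6 * heat_const d * q * rho t)"
proof -
  let ?G = "\<lambda>s k. ennreal (exp (- ((t - s) * d * k\<^sup>2))) * Q s k"
  note C1 = heat_const_ge_1[OF d]
  have H: "XB (?G s) (q * rho s ^ 3) (heat_const d * (q * rho s ^ 3) * rho (t - s))" if "0 \<le> s" "s \<le> t" for s
    using XB_heat[OF b[OF that] _ d, of "t - s"] that by simp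
  have r: "0 < rho t" using t rho_bounds by simp
  have "(\<integral>\<^sup>+s\<in>{0..t}. ?G s k \<partial>lborel) \<le> ennreal (2 * q)" for k
  proof -
    have "(\<integral>\<^sup>+s\<in>{0..t}. ?G s k \<partial>lborel) \<le> (\<integral>\<^sup>+s. ennreal q * (ennreal (rho s ^ 3) * indicator {0..t} s) \<partial>lborel)"
    proof (rule nn_integral_mono)
      fix s
      show "?G s k * indicator {0..t} s \<le> ennreal q * (ennreal (rho s ^ 3) * indicator {0..t} s)"
        using H[of s] q rho_bounds(1)[of s] by (auto simp: indicator_def XB_def ennreal_mult)
    qed
    also have "\<dots> = ennreal q * (\<integral>\<^sup>+s\<in>{0..t}. ennreal (rho s ^ 3) \<partial>lborel)"
      by (rule nn_integral_cmult) measurable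
    also have "\<dots> \<le> ennreal q * 2" by (intro mult_left_mono rho_cube_integral t) simp
    also have "\<dots> = ennreal (2 * q)" using q by (simp add: ennreal_mult mult.commute)
    finally show ?thesis .
  qed
  moreover have "(\<integral>\<^sup>+k. (\<integral>\<^sup>+s\<in>{0..t}. ?G s k \<partial>lborel) \<partial>lborel) \<le> ennreal (6 * heat_const d * q * rho t)"
  proof -
    have "(\<integral>\<^sup>+k. (\<integral>\<^sup>+s\<in>{0..t}. ?G s k \<partial>lborel) \<partial>lborel) = (\<integral>\<^sup>+s. \<integral>\<^sup>+k. ?G s k * indicator {0..t} s \<partial>lborel \<partial>lborel)"
    proof (rule lborel_pair.Fubini'[of "\<lambda>s k. ?G s k * indicator {0..t} s"])
      show "(\<lambda>(s, k). ?G s k * indicator {0..t} s) \<in> borel_measurable (lborel \<Otimes>\<^sub>M lborel)"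
        by measurable
    qed
    also have "\<dots> \<le> (\<integral>\<^sup>+s. ennreal (heat_const d * q * rho t) * (2 * (ennreal (rho s ^ 3) * indicator {0..t} s)
          + ennreal (rho (t - s) ^ 3) * indicator {0..t} s) \<partial>lborel)"
    proof (rule nn_integral_mono)
      fix s
      show "(\<integral>\<^sup>+k. ?G s k * indicator {0..t} s \<partial>lborel) \<le> ennreal (heat_const d * q * rho t) * (2 * (ennreal (rho s ^ 3) * indicator {0..t} s)
          + ennreal (rho (t - s) ^ 3) * indicator {0..t} s)"
      proof (cases "0 \<le> s \<and> s \<le> t")
        case True
        then have rs: "0 < rho s" "0 < rho (t - s)" using rho_bounds by auto
        have "(\<integral>\<^sup>+k. ?G s k * indicator {0..t} s \<partial>lborel) = (\<integral>\<^sup>+k. ?G s k \<partial>lborel)" using True by simp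
        also have "\<dots> \<le> ennreal (heat_const d * (q * rho s ^ 3) * rho (t - s))"
          using H[of s] True by (intro XBD(5)[of _ "q * rho s ^ 3"]) auto
        also have "\<dots> \<le> ennreal (heat_const d * q * rho t * (2 * rho s ^ 3 + rho (t - s) ^ 3))"
          using mult_left_mono[OF rho_product_le[of s t], of "heat_const d * q"] True C1 q
          by (intro ennreal_leI) (simp add: mult_ac)
        also have "\<dots> = ennreal (heat_const d * q * rho t) * (2 * (ennreal (rho s ^ 3) * indicator {0..t} s)
          + ennreal (rho (t - s) ^ 3) * indicator {0..t} s)"
        proof -
          have "ennreal (2 * rho s ^ 3 + rho (t - s) ^ 3) = 2 * ennreal (rho s ^ 3) + ennreal (rho (t - s) ^ 3)"
            using rs by (subst ennreal_plus) (auto simp: ennreal_mult)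
          moreover have "0 \<le> 2 * rho s ^ 3 + rho (t - s) ^ 3" using rs by simp
          ultimately show ?thesis using True C1 q r by (subst ennreal_mult) auto
        qed
        finally show ?thesis .
      qed simp
    qed
    also have "\<dots> = ennreal (heat_const d * q * rho t) * (2 * (\<integral>\<^sup>+s\<in>{0..t}. ennreal (rho s ^ 3) \<partial>lborel)
          + (\<integral>\<^sup>+s\<in>{0..t}. ennreal (rho (t - s) ^ 3) \<partial>lborel))"
      by (subst nn_integral_cmult, use rho_measurable in measurable, subst nn_integral_add,
          use rho_measurable in measurable, subst nn_integral_cmult, use rho_measurable in measurable)
    also have "\<dots> \<le> ennreal (heat_const d * q * rho t) * (2 * 2 + 2)"
      by (intro mult_left_mono add_mono rho_cube_integral t) auto
    also have "(2 * 2 + 2 :: ennreal) = ennreal 6" by simp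
    also have "ennreal (heat_const d * q * rho t) * ennreal 6 = ennreal (6 * heat_const d * q * rho t)"
      using q C1 r by (subst ennreal_mult[symmetric]) (auto simp: mult_ac)
    finally show ?thesis .
  qed
  ultimately show ?thesis using q C1 r by (intro XBI) auto
qed

section \<open>Integration by parts in time\<close>

abbreviation nrm :: "(real \<Rightarrow> complex) \<Rightarrow> real \<Rightarrow> ennreal" where
  "nrm f \<equiv> (\<lambda>k. ennreal (norm (f k)))"

definition bil :: "(real \<times> real \<Rightarrow> complex) \<Rightarrow> (real \<Rightarrow> complex) \<Rightarrow> (real \<Rightarrow> complex) \<Rightarrow> real \<Rightarrow> complex" where
  "bil b f g k = (LINT l|lborel. b (k, l) * f (k - l) * g l)"

text \<open>
  The linear part acts diagonally, so that the equation is an ordinary one at each frequency. The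
  continuity of the forcing \<open>q\<close> is part of the
  definition because it licenses the fundamental theorem of calculus.
\<close>

definition evolves :: "real \<Rightarrow> (real \<Rightarrow> real \<Rightarrow> complex) \<Rightarrow> (real \<Rightarrow> real \<Rightarrow> complex) \<Rightarrow> bool" where
  "evolves d f q \<longleftrightarrow> (\<forall>k. continuous_on {0..} (\<lambda>t. q t k)) \<and>
    (\<forall>k. \<forall>t\<ge>0. ((\<lambda>t. f t k) has_vector_derivative symbol d k * f t k + q t k) (at t within {0..}))"

lemma norm_integral_le_nn_integral:
  fixes f :: "'a \<Rightarrow> complex"
  shows "ennreal (norm (LINT x|M. f x)) \<le> (\<integral>\<^sup>+x. ennreal (norm (f x)) \<partial>M)"
proof (cases "integrable M f")
  case True then show ?thesis by (rule integral_norm_bound_ennreal)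
next
  case False then show ?thesis by (simp add: not_integrable_integral_eq)
qed

lemma norm_set_integral_le_nn_integral:
  fixes f :: "real \<Rightarrow> complex"
  shows "ennreal (norm (LINT s:A|lborel. f s)) \<le> (\<integral>\<^sup>+s\<in>A. ennreal (norm (f s)) \<partial>lborel)"
proof -
  have "ennreal (norm (LINT s:A|lborel. f s)) \<le> (\<integral>\<^sup>+s. ennreal (norm (indicator A s *\<^sub>R f s)) \<partial>lborel)"
    unfolding set_lebesgue_integral_def by (rule norm_integral_le_nn_integral)
  also have "\<dots> = (\<integral>\<^sup>+s\<in>A. ennreal (norm (f s)) \<partial>lborel)"
    by (intro nn_integral_cong) (simp add: indicator_def)
  finally show ?thesis .
qed

text \<open>
  The order of integration is exchanged before the absolute value is taken: the oscillation in \<open>s\<close> at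
  fixed frequencies is what the normal form exploits, and it would be lost under the integral over \<open>l\<close>.
\<close>

lemma norm_integral_swap_le:
  fixes b' :: "real \<Rightarrow> complex" and H :: "real \<Rightarrow> real \<Rightarrow> complex"
  assumes [measurable]: "b' \<in> borel_measurable borel" and b': "\<And>l. norm (b' l) \<le> \<beta>"
    and H [measurable]: "(\<lambda>(s, l). H s l) \<in> borel_measurable (borel \<Otimes>\<^sub>M borel)"
    and fin: "(\<integral>\<^sup>+s\<in>{0..t}. (\<integral>\<^sup>+l. ennreal (norm (H s l)) \<partial>lborel) \<partial>lborel) < \<infinity>"
  shows "ennreal (norm (LINT s:{0..t}|lborel. LINT l|lborel. b' l * H s l))
    \<le> ennreal \<beta> * (\<integral>\<^sup>+l. ennreal (norm (LINT s:{0..t}|lborel. H s l)) \<partial>lborel)"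
proof -
  have \<beta>: "0 \<le> \<beta>" using b'[of 0] norm_ge_zero[of "b' 0"] by linarith
  have int: "integrable (lborel \<Otimes>\<^sub>M lborel) (\<lambda>(s, l). indicator {0..t} s *\<^sub>R (b' l * H s l))"
  proof (rule integrableI_bounded)
    show "(\<lambda>(s, l). indicator {0..t} s *\<^sub>R (b' l * H s l)) \<in> borel_measurable (lborel \<Otimes>\<^sub>M lborel)"
      by measurable
    have "(\<integral>\<^sup>+z. ennreal (norm (case z of (s, l) \<Rightarrow> indicator {0..t} s *\<^sub>R (b' l * H s l))) \<partial>(lborel \<Otimes>\<^sub>M lborel))
        = (\<integral>\<^sup>+s. \<integral>\<^sup>+l. ennreal (norm (indicator {0..t} s *\<^sub>R (b' l * H s l))) \<partial>lborel \<partial>lborel)"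
      by (subst lborel.nn_integral_fst[symmetric]) auto
    also have "\<dots> \<le> (\<integral>\<^sup>+s. \<integral>\<^sup>+l. ennreal \<beta> * indicator {0..t} s * ennreal (norm (H s l)) \<partial>lborel \<partial>lborel)"
    proof (intro nn_integral_mono)
      fix s l
      have "norm (b' l * H s l) \<le> \<beta> * norm (H s l)"
        unfolding norm_mult by (intro mult_right_mono b') simp
      then have "ennreal (norm (b' l * H s l)) \<le> ennreal \<beta> * ennreal (norm (H s l))"
        using \<beta> by (subst ennreal_mult[symmetric]) (auto intro: ennreal_leI)
      then show "ennreal (norm (indicator {0..t} s *\<^sub>R (b' l * H s l)))
        \<le> ennreal \<beta> * indicator {0..t} s * ennreal (norm (H s l))"
        by (simp add: indicator_def)
    qed
    also have "\<dots> = (\<integral>\<^sup>+s. ennreal \<beta> * ((\<integral>\<^sup>+l. ennreal (norm (H s l)) \<partial>lborel) * indicator {0..t} s) \<partial>lborel)"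
    proof (intro nn_integral_cong)
      fix s
      have "(\<integral>\<^sup>+l. ennreal \<beta> * indicator {0..t} s * ennreal (norm (H s l)) \<partial>lborel)
          = ennreal \<beta> * indicator {0..t} s * (\<integral>\<^sup>+l. ennreal (norm (H s l)) \<partial>lborel)"
        by (rule nn_integral_cmult) measurable
      then show "(\<integral>\<^sup>+l. ennreal \<beta> * indicator {0..t} s * ennreal (norm (H s l)) \<partial>lborel)
          = ennreal \<beta> * ((\<integral>\<^sup>+l. ennreal (norm (H s l)) \<partial>lborel) * indicator {0..t} s)"
        by (simp only: mult_ac)
    qed
    also have "\<dots> = ennreal \<beta> * (\<integral>\<^sup>+s\<in>{0..t}. (\<integral>\<^sup>+l. ennreal (norm (H s l)) \<partial>lborel) \<partial>lborel)"
      by (rule nn_integral_cmult) measurable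
    also have "\<dots> < \<infinity>" using fin by (simp add: ennreal_mult_less_top)
    finally show "(\<integral>\<^sup>+z. ennreal (norm (case z of (s, l) \<Rightarrow> indicator {0..t} s *\<^sub>R (b' l * H s l))) \<partial>(lborel \<Otimes>\<^sub>M lborel)) < \<infinity>" .
  qed
  have "(LINT s:{0..t}|lborel. LINT l|lborel. b' l * H s l)
      = (LINT s|lborel. LINT l|lborel. indicator {0..t} s *\<^sub>R (b' l * H s l))"
    unfolding set_lebesgue_integral_def by (simp only: integral_scaleR_right)
  also have "\<dots> = (LINT l|lborel. LINT s|lborel. indicator {0..t} s *\<^sub>R (b' l * H s l))"
    by (rule lborel_pair.Fubini_integral[OF int, symmetric])
  also have "\<dots> = (LINT l|lborel. b' l * (LINT s:{0..t}|lborel. H s l))"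
    unfolding set_lebesgue_integral_def
    by (simp only: integral_mult_right_zero mult_scaleR_right[symmetric])
  finally have eq: "(LINT s:{0..t}|lborel. LINT l|lborel. b' l * H s l) = (LINT l|lborel. b' l * (LINT s:{0..t}|lborel. H s l))" .
  have "ennreal (norm (LINT s:{0..t}|lborel. LINT l|lborel. b' l * H s l))
      \<le> (\<integral>\<^sup>+l. ennreal (norm (b' l * (LINT s:{0..t}|lborel. H s l))) \<partial>lborel)"
    unfolding eq by (rule norm_integral_le_nn_integral)
  also have "\<dots> \<le> (\<integral>\<^sup>+l. ennreal \<beta> * ennreal (norm (LINT s:{0..t}|lborel. H s l)) \<partial>lborel)"
    using \<beta> b' by (intro nn_integral_mono) (auto simp: norm_mult ennreal_mult intro!: mult_right_mono ennreal_leI)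
  also have "\<dots> = ennreal \<beta> * (\<integral>\<^sup>+l. ennreal (norm (LINT s:{0..t}|lborel. H s l)) \<partial>lborel)"
    unfolding set_lebesgue_integral_def by (rule nn_integral_cmult) measurable
  finally show ?thesis .
qed

lemma set_integral_eq_HK:
  fixes f :: "real \<Rightarrow> complex"
  assumes "continuous_on {0..t} f"
  shows "(LINT s:{0..t}|lborel. f s) = integral {0..t} f" "set_integrable lborel {0..t} f"
proof -
  show *: "set_integrable lborel {0..t} f"
    using borel_integrable_atLeastAtMost'[OF assms] .
  show "(LINT s:{0..t}|lborel. f s) = integral {0..t} f"
    by (rule set_borel_integral_eq_integral(2)[OF *])
qed

text \<open>
  The derivative of \<open>exp ((t - s) \<mu>) P s\<close> is \<open>\<Lambda> - \<mu>\<close> times itself plus the contribution of \<open>Q\<close>. Dividing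
  by the nonvanishing phase trades the time integral for boundary terms and an integral of higher order
  in the unknown.
\<close>

lemma duhamel_by_parts:
  fixes P Q :: "real \<Rightarrow> complex"
  assumes t: "0 \<le> t" and c: "0 < c" "c \<le> norm (\<Lambda> - \<mu>)"
    and der: "\<And>s. s \<in> {0..t} \<Longrightarrow> (P has_vector_derivative \<Lambda> * P s + Q s) (at s within {0..t})"
    and Q: "continuous_on {0..t} Q"
  shows "norm (LINT s:{0..t}|lborel. exp (of_real (t - s) * \<mu>) * P s)
    \<le> 1 / c * (norm (P t) + norm (exp (of_real t * \<mu>)) * norm (P 0)
        + norm (LINT s:{0..t}|lborel. exp (of_real (t - s) * \<mu>) * Q s))"
proof -
  define E where "E s = exp (of_real (t - s) * \<mu>)" for s
  have P: "continuous_on {0..t} P"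
    using der by (rule continuous_on_vector_derivative)
  have E: "continuous_on {0..t} E" unfolding E_def by (intro continuous_intros)
  have dE: "(E has_vector_derivative - \<mu> * E s) (at s within {0..t})" for s
  proof -
    have "((\<lambda>z. exp ((of_real t - z) * \<mu>)) has_field_derivative - \<mu> * E s) (at (of_real s))"
      unfolding E_def by (auto intro!: derivative_eq_intros)
    from has_vector_derivative_real_field[OF this] show ?thesis
      unfolding E_def[abs_def] by simp
  qed
  have "((\<lambda>s. (\<Lambda> - \<mu>) * (E s * P s) + E s * Q s) has_integral E t * P t - E 0 * P 0) {0..t}"
  proof (rule fundamental_theorem_of_calculus[OF t])
    fix s assume s: "s \<in> {0..t}"
    have "((\<lambda>s. E s * P s) has_vector_derivative E s * (\<Lambda> * P s + Q s) + - \<mu> * E s * P s) (at s within {0..t})"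
      by (intro has_vector_derivative_mult dE der s)
    then show "((\<lambda>s. E s * P s) has_vector_derivative (\<Lambda> - \<mu>) * (E s * P s) + E s * Q s) (at s within {0..t})"
      by (simp add: algebra_simps)
  qed
  moreover have "((\<lambda>s. (\<Lambda> - \<mu>) * (E s * P s) + E s * Q s) has_integral
      (\<Lambda> - \<mu>) * integral {0..t} (\<lambda>s. E s * P s) + integral {0..t} (\<lambda>s. E s * Q s)) {0..t}"
    by (intro has_integral_add has_integral_mult_right integrable_integral integrable_continuous_interval
        continuous_intros E P Q)
  ultimately have eq: "(\<Lambda> - \<mu>) * integral {0..t} (\<lambda>s. E s * P s) + integral {0..t} (\<lambda>s. E s * Q s) = E t * P t - E 0 * P 0"
    using has_integral_unique by blast
  have Et: "E t = 1" by (simp add: E_def)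
  have "(\<Lambda> - \<mu>) * integral {0..t} (\<lambda>s. E s * P s) = P t - E 0 * P 0 - integral {0..t} (\<lambda>s. E s * Q s)"
    using eq unfolding Et by (simp add: algebra_simps)
  then have "norm (\<Lambda> - \<mu>) * norm (integral {0..t} (\<lambda>s. E s * P s)) = norm (P t - E 0 * P 0 - integral {0..t} (\<lambda>s. E s * Q s))"
    by (metis norm_mult)
  also have "\<dots> \<le> norm (P t) + norm (E 0) * norm (P 0) + norm (integral {0..t} (\<lambda>s. E s * Q s))"
    using norm_triangle_ineq4[of "P t - E 0 * P 0" "integral {0..t} (\<lambda>s. E s * Q s)"] norm_triangle_ineq4[of "P t" "E 0 * P 0"]
    unfolding norm_mult by linarith
  finally have "c * norm (integral {0..t} (\<lambda>s. E s * P s)) \<le> norm (P t) + norm (E 0) * norm (P 0) + norm (integral {0..t} (\<lambda>s. E s * Q s))"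
    using mult_right_mono[OF c(2), of "norm (integral {0..t} (\<lambda>s. E s * P s))"] by simp
  then have "norm (integral {0..t} (\<lambda>s. E s * P s)) \<le> 1 / c * (norm (P t) + norm (E 0) * norm (P 0) + norm (integral {0..t} (\<lambda>s. E s * Q s)))"
    using c(1) by (simp add: field_simps)
  moreover have "integral {0..t} (\<lambda>s. E s * P s) = (LINT s:{0..t}|lborel. E s * P s)"
    by (rule set_integral_eq_HK(1)[symmetric]) (intro continuous_intros E P)
  moreover have "integral {0..t} (\<lambda>s. E s * Q s) = (LINT s:{0..t}|lborel. E s * Q s)"
    by (rule set_integral_eq_HK(1)[symmetric]) (intro continuous_intros E Q)
  ultimately show ?thesis by (simp add: E_def)
qed

lemma evolvesD:
  assumes "evolves d f q"
  shows "s \<in> {0..t} \<Longrightarrow> ((\<lambda>t. f t k) has_vector_derivative symbol d k * f s k + q s k) (at s within {0..t})"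
    and "continuous_on {0..t} (\<lambda>s. q s k)" "continuous_on {0..t} (\<lambda>s. f s k)"
proof -
  have D: "((\<lambda>t. f t k) has_vector_derivative symbol d k * f s k + q s k) (at s within {0..t})" if "s \<in> {0..t}" for s
    by (rule has_vector_derivative_within_subset[where S="{0..}"])
      (use assms that in \<open>auto simp: evolves_def\<close>)
  then show "s \<in> {0..t} \<Longrightarrow> ((\<lambda>t. f t k) has_vector_derivative symbol d k * f s k + q s k) (at s within {0..t})" .
  show "continuous_on {0..t} (\<lambda>s. f s k)"
    using D by (rule continuous_on_vector_derivative)
  show "continuous_on {0..t} (\<lambda>s. q s k)"
    by (rule continuous_on_subset[where s="{0..}"]) (use assms in \<open>auto simp: evolves_def\<close>)
qed

definition phase_gap :: "real \<Rightarrow> real" where "phase_gap d = min (1/3) (2 * d)"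

lemma phase_gap_pos: "d > 0 \<Longrightarrow> 0 < phase_gap d" by (simp add: phase_gap_def)

lemma duhamel_product2:
  assumes d: "d > 0" and t: "0 \<le> t" and f: "evolves d f q" and g: "evolves d g r"
  shows "norm (LINT s:{0..t}|lborel. exp (of_real (t - s) * symbol d (x + y)) * (f s x * g s y))
    \<le> 1 / phase_gap d * (norm (f t x * g t y) + exp (- (t * d * (x + y)\<^sup>2)) * norm (f 0 x * g 0 y)
      + norm (LINT s:{0..t}|lborel. exp (of_real (t - s) * symbol d (x + y)) * (q s x * g s y))
      + norm (LINT s:{0..t}|lborel. exp (of_real (t - s) * symbol d (x + y)) * (r s y * f s x)))"
proof -
  let ?e = "\<lambda>s. exp (of_real (t - s) * symbol d (x + y))"
  note cf = evolvesD(2,3)[OF f, of t] and cg = evolvesD(2,3)[OF g, of t]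
  have "norm (LINT s:{0..t}|lborel. ?e s * (f s x * g s y))
    \<le> 1 / phase_gap d * (norm (f t x * g t y) + norm (exp (of_real t * symbol d (x + y))) * norm (f 0 x * g 0 y)
      + norm (LINT s:{0..t}|lborel. ?e s * (q s x * g s y + r s y * f s x)))"
  proof (rule duhamel_by_parts[OF t phase_gap_pos[OF d]])
    show "phase_gap d \<le> norm (symbol d x + symbol d y - symbol d (x + y))"
      unfolding phase_gap_def by (rule bilinear_phase_bound[OF d])
    show "continuous_on {0..t} (\<lambda>s. q s x * g s y + r s y * f s x)"
      by (intro continuous_intros cf cg)
    fix s assume s: "s \<in> {0..t}"
    have "((\<lambda>s. f s x * g s y) has_vector_derivative
        f s x * (symbol d y * g s y + r s y) + (symbol d x * f s x + q s x) * g s y) (at s within {0..t})"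
      by (intro has_vector_derivative_mult evolvesD(1)[OF f s] evolvesD(1)[OF g s])
    then show "((\<lambda>s. f s x * g s y) has_vector_derivative
        (symbol d x + symbol d y) * (f s x * g s y) + (q s x * g s y + r s y * f s x)) (at s within {0..t})"
      by (simp add: algebra_simps)
  qed
  also have "(LINT s:{0..t}|lborel. ?e s * (q s x * g s y + r s y * f s x))
      = (LINT s:{0..t}|lborel. ?e s * (q s x * g s y)) + (LINT s:{0..t}|lborel. ?e s * (r s y * f s x))"
    unfolding distrib_left
    by (rule set_integral_add; rule set_integral_eq_HK(2); intro continuous_intros cf cg)
  finally have "norm (LINT s:{0..t}|lborel. ?e s * (f s x * g s y))
      \<le> 1 / phase_gap d * (norm (f t x * g t y) + exp (- (t * d * (x + y)\<^sup>2)) * norm (f 0 x * g 0 y)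
        + norm ((LINT s:{0..t}|lborel. ?e s * (q s x * g s y)) + (LINT s:{0..t}|lborel. ?e s * (r s y * f s x))))"
    unfolding norm_exp_symbol .
  also have "\<dots> \<le> 1 / phase_gap d * (norm (f t x * g t y) + exp (- (t * d * (x + y)\<^sup>2)) * norm (f 0 x * g 0 y)
        + norm (LINT s:{0..t}|lborel. ?e s * (q s x * g s y)) + norm (LINT s:{0..t}|lborel. ?e s * (r s y * f s x)))"
    by (intro mult_left_mono)
      (use norm_triangle_ineq[of "LINT s:{0..t}|lborel. ?e s * (q s x * g s y)" "LINT s:{0..t}|lborel. ?e s * (r s y * f s x)"]
        phase_gap_pos[OF d] in \<open>simp_all only: add.assoc add_left_mono, simp\<close>)
  finally show ?thesis .
qed

lemma duhamel_product3:
  assumes d: "d > 0" and t: "0 \<le> t"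
    and f: "evolves d f1 q1" "evolves d f2 q2" "evolves d f3 q3"
  shows "ennreal (norm (LINT s:{0..t}|lborel. exp (of_real (t - s) * symbol d (x + y + z)) * (f1 s x * f2 s y * f3 s z)))
    \<le> ennreal (1 / phase_gap d) * (nrm (f1 t) x * nrm (f2 t) y * nrm (f3 t) z
      + ennreal (exp (- (t * d * (x + y + z)\<^sup>2))) * (nrm (f1 0) x * nrm (f2 0) y * nrm (f3 0) z)
      + (\<integral>\<^sup>+s\<in>{0..t}. ennreal (exp (- ((t - s) * d * (x + y + z)\<^sup>2))) *
          (nrm (q1 s) x * nrm (f2 s) y * nrm (f3 s) z + nrm (f1 s) x * nrm (q2 s) y * nrm (f3 s) z
            + nrm (f1 s) x * nrm (f2 s) y * nrm (q3 s) z) \<partial>lborel))"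
proof -
  let ?e = "\<lambda>s. exp (of_real (t - s) * symbol d (x + y + z))"
  let ?Q = "\<lambda>s. q1 s x * f2 s y * f3 s z + f1 s x * q2 s y * f3 s z + f1 s x * f2 s y * q3 s z"
  have c: "0 \<le> 1 / phase_gap d" using phase_gap_pos[OF d] by simp
  note c1 = evolvesD(2,3)[OF f(1), of t] and c2 = evolvesD(2,3)[OF f(2), of t] and c3 = evolvesD(2,3)[OF f(3), of t]
  have "norm (LINT s:{0..t}|lborel. ?e s * (f1 s x * f2 s y * f3 s z))
    \<le> 1 / phase_gap d * (norm (f1 t x * f2 t y * f3 t z) + norm (exp (of_real t * symbol d (x + y + z))) * norm (f1 0 x * f2 0 y * f3 0 z)
      + norm (LINT s:{0..t}|lborel. ?e s * ?Q s))"
  proof (rule duhamel_by_parts[OF t phase_gap_pos[OF d]])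
    show "phase_gap d \<le> norm (symbol d x + symbol d y + symbol d z - symbol d (x + y + z))"
      unfolding phase_gap_def by (rule trilinear_phase_bound[OF d])
    show "continuous_on {0..t} ?Q"
      by (intro continuous_intros c1 c2 c3)
    fix s assume s: "s \<in> {0..t}"
    have "((\<lambda>s. f1 s x * f2 s y * f3 s z) has_vector_derivative
        f1 s x * f2 s y * (symbol d z * f3 s z + q3 s z) +
        (f1 s x * (symbol d y * f2 s y + q2 s y) + (symbol d x * f1 s x + q1 s x) * f2 s y) * f3 s z) (at s within {0..t})"
      by (intro has_vector_derivative_mult evolvesD(1)[OF f(1) s] evolvesD(1)[OF f(2) s] evolvesD(1)[OF f(3) s])
    then show "((\<lambda>s. f1 s x * f2 s y * f3 s z) has_vector_derivative
        (symbol d x + symbol d y + symbol d z) * (f1 s x * f2 s y * f3 s z) + ?Q s) (at s within {0..t})"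
      by (simp add: algebra_simps)
  qed
  then have "ennreal (norm (LINT s:{0..t}|lborel. ?e s * (f1 s x * f2 s y * f3 s z)))
    \<le> ennreal (1 / phase_gap d) * (ennreal (norm (f1 t x * f2 t y * f3 t z))
      + ennreal (exp (- (t * d * (x + y + z)\<^sup>2))) * ennreal (norm (f1 0 x * f2 0 y * f3 0 z))
      + ennreal (norm (LINT s:{0..t}|lborel. ?e s * ?Q s)))"
    unfolding norm_exp_symbol using c
    by (subst ennreal_mult[symmetric], simp, simp, subst ennreal_plus[symmetric], simp, simp,
        subst ennreal_plus[symmetric], simp, simp, subst ennreal_mult[symmetric], simp, simp)
      (rule ennreal_leI)
  also have "\<dots> \<le> ennreal (1 / phase_gap d) * (nrm (f1 t) x * nrm (f2 t) y * nrm (f3 t) z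
      + ennreal (exp (- (t * d * (x + y + z)\<^sup>2))) * (nrm (f1 0) x * nrm (f2 0) y * nrm (f3 0) z)
      + (\<integral>\<^sup>+s\<in>{0..t}. ennreal (norm (?e s * ?Q s)) \<partial>lborel))"
    by (intro mult_left_mono add_mono norm_set_integral_le_nn_integral) (simp_all add: norm_mult ennreal_mult)
  also have "(\<integral>\<^sup>+s\<in>{0..t}. ennreal (norm (?e s * ?Q s)) \<partial>lborel)
    \<le> (\<integral>\<^sup>+s\<in>{0..t}. ennreal (exp (- ((t - s) * d * (x + y + z)\<^sup>2))) *
          (nrm (q1 s) x * nrm (f2 s) y * nrm (f3 s) z + nrm (f1 s) x * nrm (q2 s) y * nrm (f3 s) z
            + nrm (f1 s) x * nrm (f2 s) y * nrm (q3 s) z) \<partial>lborel)"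
  proof (intro nn_integral_mono mult_right_mono)
    fix s
    have tri: "norm (u + v + w) \<le> norm u + norm v + norm w" for u v w :: complex
      by (rule order_trans[OF norm_triangle_ineq add_right_mono[OF norm_triangle_ineq]])
    have "ennreal (norm (?e s * ?Q s)) = ennreal (exp (- ((t - s) * d * (x + y + z)\<^sup>2))) * ennreal (norm (?Q s))"
      unfolding norm_mult norm_exp_symbol by (rule ennreal_mult) auto
    also have "\<dots> \<le> ennreal (exp (- ((t - s) * d * (x + y + z)\<^sup>2))) * ennreal (norm (q1 s x * f2 s y * f3 s z)
        + norm (f1 s x * q2 s y * f3 s z) + norm (f1 s x * f2 s y * q3 s z))"
      by (intro mult_left_mono ennreal_leI tri) simp
    also have "\<dots> = ennreal (exp (- ((t - s) * d * (x + y + z)\<^sup>2))) *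
          (nrm (q1 s) x * nrm (f2 s) y * nrm (f3 s) z + nrm (f1 s) x * nrm (q2 s) y * nrm (f3 s) z
            + nrm (f1 s) x * nrm (f2 s) y * nrm (q3 s) z)"
      by (simp add: norm_mult ennreal_mult ennreal_plus)
    finally show "ennreal (norm (?e s * ?Q s)) \<le> ennreal (exp (- ((t - s) * d * (x + y + z)\<^sup>2))) *
          (nrm (q1 s) x * nrm (f2 s) y * nrm (f3 s) z + nrm (f1 s) x * nrm (q2 s) y * nrm (f3 s) z
            + nrm (f1 s) x * nrm (f2 s) y * nrm (q3 s) z)" .
  qed simp
  finally show ?thesis by (rule order_trans) (intro mult_left_mono add_mono order_refl, auto)
qed

section \<open>The a priori bound\<close>

abbreviation joint_meas :: "(real \<Rightarrow> real \<Rightarrow> 'a::topological_space) \<Rightarrow> bool" where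
  "joint_meas f \<equiv> (\<lambda>(s, k). f s k) \<in> borel_measurable (borel \<Otimes>\<^sub>M borel)"

text \<open>
  The ball of radius \<open>M\<close> in which the solution is sought. The sup bound carries no decay, because the heat
  factor does not damp the lowest frequencies.
\<close>

definition bnd :: "(real \<Rightarrow> real \<Rightarrow> complex) \<Rightarrow> real \<Rightarrow> bool" where
  "bnd f M \<longleftrightarrow> joint_meas f \<and> (\<forall>s\<ge>0. XB (nrm (f s)) M (M * rho s))"

text \<open>
  What the second integration by parts leaves of a cubic term: boundary terms at the times \<open>t\<close> and \<open>0\<close>,
  and one quartic integral for each factor on which the derivative can fall. The variable \<open>y\<close> of the third
  factor is kept free; integrating over it produces the outermost convolution.
\<close>

definition cubic_majorant :: "real \<Rightarrow> (real \<Rightarrow> real \<Rightarrow> complex) \<Rightarrow> (real \<Rightarrow> real \<Rightarrow> complex) \<Rightarrow>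
    (real \<Rightarrow> real \<Rightarrow> complex) \<Rightarrow> (real \<Rightarrow> real \<Rightarrow> complex) \<Rightarrow> real \<Rightarrow> real \<Rightarrow> real \<Rightarrow> ennreal" where
  "cubic_majorant d p r f q t x y =
     conv (nrm (p t)) (nrm (p t)) x * nrm (f t) y
     + ennreal (exp (- (t * d * (x + y)\<^sup>2))) * (conv (nrm (p 0)) (nrm (p 0)) x * nrm (f 0) y)
     + (\<integral>\<^sup>+s\<in>{0..t}. ennreal (exp (- ((t - s) * d * (x + y)\<^sup>2))) *
         (conv (nrm (r s)) (nrm (p s)) x * nrm (f s) y + conv (nrm (p s)) (nrm (r s)) x * nrm (f s) y
          + conv (nrm (p s)) (nrm (p s)) x * nrm (q s) y) \<partial>lborel)"

locale bounded_kernel =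
  fixes d \<beta> :: real and b :: "real \<times> real \<Rightarrow> complex"
  assumes d: "d > 0" and b_meas [measurable]: "b \<in> borel_measurable borel"
    and b_le: "\<And>z. norm (b z) \<le> \<beta>"
begin

lemma \<beta>_nonneg: "0 \<le> \<beta>"
  using b_le[of 0] norm_ge_zero[of "b 0"] by linarith

lemma joint_meas_bil:
  assumes [measurable]: "joint_meas f" "joint_meas g"
  shows "joint_meas (\<lambda>s. bil b (f s) (g s))"
  unfolding bil_def by measurable

lemma bil_measurable [measurable]:
  assumes [measurable]: "f \<in> borel_measurable borel" "g \<in> borel_measurable borel"
  shows "bil b f g \<in> borel_measurable borel"
  unfolding bil_def[abs_def] by measurable

lemma norm_bil_le:
  assumes [measurable]: "f \<in> borel_measurable borel" "g \<in> borel_measurable borel"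
  shows "ennreal (norm (bil b f g k)) \<le> ennreal \<beta> * conv (nrm f) (nrm g) k"
proof -
  have "ennreal (norm (bil b f g k)) \<le> (\<integral>\<^sup>+l. ennreal (norm (b (k, l) * f (k - l) * g l)) \<partial>lborel)"
    unfolding bil_def by (rule norm_integral_le_nn_integral)
  also have "\<dots> \<le> (\<integral>\<^sup>+l. ennreal \<beta> * (ennreal (norm (f (k - l))) * ennreal (norm (g l))) \<partial>lborel)"
  proof (rule nn_integral_mono)
    fix l
    have "norm (b (k, l) * f (k - l) * g l) \<le> \<beta> * (norm (f (k - l)) * norm (g l))"
      unfolding norm_mult mult.assoc by (intro mult_right_mono b_le) simp
    then show "ennreal (norm (b (k, l) * f (k - l) * g l)) \<le> ennreal \<beta> * (ennreal (norm (f (k - l))) * ennreal (norm (g l)))"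
      using \<beta>_nonneg by (simp add: ennreal_mult[symmetric] ennreal_leI)
  qed
  also have "\<dots> = ennreal \<beta> * conv (nrm f) (nrm g) k"
    unfolding conv_def by (rule nn_integral_cmult) measurable
  finally show ?thesis .
qed

lemma XB_bil:
  assumes "XB (nrm f) A B" "XB (nrm g) A' B'" "f \<in> borel_measurable borel" "g \<in> borel_measurable borel"
  shows "XB (nrm (bil b f g)) (\<beta> * (A * B')) (\<beta> * (B * B'))"
proof (rule XB_mono[OF XB_cmult[OF XB_conv[OF assms(1,2)] \<beta>_nonneg] order_refl order_refl])
  note [measurable] = assms(3,4)
  show "nrm (bil b f g) \<in> borel_measurable borel" by measurable
qed (rule norm_bil_le[OF assms(3,4)])

text \<open>
  The forcing \<open>q\<close> is again a frequency integral of a product, so that the three factors oscillate with the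
  trilinear phase once the integration over the inner frequency \<open>m\<close> has been moved outside.
\<close>

lemma cubic_duhamel_bound:
  assumes t: "0 \<le> t" and p: "evolves d p r" and f: "evolves d f q"
    and q: "\<And>s. q s = bil b (p s) (p s)"
    and bp: "bnd p M" and bf: "bnd f M" and r [measurable]: "joint_meas r"
  shows "ennreal (norm (LINT s:{0..t}|lborel. exp (of_real (t - s) * symbol d (x + y)) * (q s x * f s y)))
    \<le> ennreal (\<beta> / phase_gap d) * cubic_majorant d p r f q t x y"
proof -
  have jm [measurable]: "joint_meas p" "joint_meas f" using bp bf by (auto simp: bnd_def)
  have [measurable]: "joint_meas q" unfolding q by (rule joint_meas_bil) fact+
  note c = phase_gap_pos[OF d]
  let ?e = "\<lambda>s. exp (of_real (t - s) * symbol d (x + y))"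
  let ?en = "\<lambda>s. ennreal (exp (- ((t - s) * d * (x + y)\<^sup>2)))"
  let ?H = "\<lambda>s m. ?e s * (p s (x - m) * p s m * f s y)"
  have [measurable]: "(\<lambda>s. ?e s) \<in> borel_measurable borel" unfolding symbol_def by measurable
  have eq: "?e s * (q s x * f s y) = (LINT m|lborel. b (x, m) * ?H s m)" for s
  proof -
    have "(LINT m|lborel. b (x, m) * ?H s m) = (LINT m|lborel. ?e s * f s y * (b (x, m) * p s (x - m) * p s m))"
      by (simp only: mult_ac)
    also have "\<dots> = ?e s * f s y * q s x" unfolding q bil_def by (rule integral_mult_right_zero)
    finally show ?thesis by (simp only: mult_ac)
  qed
  have M: "0 \<le> M" using bp XBD(2)[of "nrm (p 0)"] by (auto simp: bnd_def)
  have fin: "(\<integral>\<^sup>+s\<in>{0..t}. (\<integral>\<^sup>+m. ennreal (norm (?H s m)) \<partial>lborel) \<partial>lborel) < \<infinity>"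
  proof -
    have "(\<integral>\<^sup>+s\<in>{0..t}. (\<integral>\<^sup>+m. ennreal (norm (?H s m)) \<partial>lborel) \<partial>lborel)
        \<le> (\<integral>\<^sup>+s. ennreal (M * M * M) * indicator {0..t} s \<partial>lborel)"
    proof (rule nn_integral_mono)
      fix s
      show "(\<integral>\<^sup>+m. ennreal (norm (?H s m)) \<partial>lborel) * indicator {0..t} s \<le> ennreal (M * M * M) * indicator {0..t} s"
      proof (cases "0 \<le> s \<and> s \<le> t")
        case True
        have P: "XB (nrm (p s)) M M" "XB (nrm (f s)) M M"
          using bp bf True rho_bounds(2)[of s] mult_left_mono[of "rho s" 1 M] M
          by (auto simp: bnd_def intro!: XB_weaken[of _ M "M * rho s" M M])
        have e: "norm (?e s) \<le> 1" unfolding norm_exp_symbol using True d by simp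
        have "(\<integral>\<^sup>+m. ennreal (norm (?H s m)) \<partial>lborel)
            \<le> (\<integral>\<^sup>+m. nrm (p s) (x - m) * nrm (p s) m * nrm (f s) y \<partial>lborel)"
        proof (rule nn_integral_mono)
          fix m
          have "norm (?H s m) \<le> 1 * (norm (p s (x - m)) * norm (p s m) * norm (f s y))"
            unfolding norm_mult using e[unfolded norm_mult] by (intro mult_right_mono) auto
          then show "ennreal (norm (?H s m)) \<le> nrm (p s) (x - m) * nrm (p s) m * nrm (f s) y"
            by (simp add: ennreal_mult[symmetric] ennreal_leI)
        qed
        also have "\<dots> = conv (nrm (p s)) (nrm (p s)) x * nrm (f s) y"
          unfolding conv_def by (rule nn_integral_multc) measurable
        also have "\<dots> \<le> ennreal (M * M) * ennreal M"
          by (intro mult_mono XBD(4)[OF XB_conv[OF P(1) P(1)]] XBD(4)[OF P(2)]) auto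
        also have "\<dots> = ennreal (M * M * M)" using M by (simp add: ennreal_mult)
        finally show ?thesis by (intro mult_right_mono) auto
      next
        case False then show ?thesis by (auto simp: indicator_def)
      qed
    qed
    also have "\<dots> = ennreal (M * M * M) * emeasure lborel {0..t}" by (rule nn_integral_cmult_indicator) simp
    also have "\<dots> < \<infinity>" using t by (simp add: ennreal_mult_less_top)
    finally show ?thesis .
  qed
  have "ennreal (norm (LINT s:{0..t}|lborel. ?e s * (q s x * f s y)))
      \<le> ennreal \<beta> * (\<integral>\<^sup>+m. ennreal (norm (LINT s:{0..t}|lborel. ?H s m)) \<partial>lborel)"
    unfolding eq
  proof (rule norm_integral_swap_le[OF _ _ _ fin])
    show "(\<lambda>m. b (x, m)) \<in> borel_measurable borel" by measurable
    show "(\<lambda>(s, m). ?H s m) \<in> borel_measurable (borel \<Otimes>\<^sub>M borel)" by measurable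
  qed (rule b_le)
  also have "(\<integral>\<^sup>+m. ennreal (norm (LINT s:{0..t}|lborel. ?H s m)) \<partial>lborel)
      \<le> (\<integral>\<^sup>+m. ennreal (1 / phase_gap d) * (nrm (p t) (x - m) * nrm (p t) m * nrm (f t) y
      + ennreal (exp (- (t * d * (x + y)\<^sup>2))) * (nrm (p 0) (x - m) * nrm (p 0) m * nrm (f 0) y)
      + (\<integral>\<^sup>+s\<in>{0..t}. ?en s *
          (nrm (r s) (x - m) * nrm (p s) m * nrm (f s) y + nrm (p s) (x - m) * nrm (r s) m * nrm (f s) y
            + nrm (p s) (x - m) * nrm (p s) m * nrm (q s) y) \<partial>lborel)) \<partial>lborel)"
  proof (rule nn_integral_mono)
    fix m
    have xm: "x - m + m + y = x + y" by simp
    show "ennreal (norm (LINT s:{0..t}|lborel. ?H s m)) \<le> ennreal (1 / phase_gap d) * (nrm (p t) (x - m) * nrm (p t) m * nrm (f t) y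
      + ennreal (exp (- (t * d * (x + y)\<^sup>2))) * (nrm (p 0) (x - m) * nrm (p 0) m * nrm (f 0) y)
      + (\<integral>\<^sup>+s\<in>{0..t}. ?en s *
          (nrm (r s) (x - m) * nrm (p s) m * nrm (f s) y + nrm (p s) (x - m) * nrm (r s) m * nrm (f s) y
            + nrm (p s) (x - m) * nrm (p s) m * nrm (q s) y) \<partial>lborel))"
      using duhamel_product3[OF d t p p f, of "x - m" m y] unfolding xm .
  qed
  also have "\<dots> = ennreal (1 / phase_gap d) * ((\<integral>\<^sup>+m. nrm (p t) (x - m) * nrm (p t) m * nrm (f t) y \<partial>lborel)
      + ennreal (exp (- (t * d * (x + y)\<^sup>2))) * (\<integral>\<^sup>+m. nrm (p 0) (x - m) * nrm (p 0) m * nrm (f 0) y \<partial>lborel)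
      + (\<integral>\<^sup>+m. (\<integral>\<^sup>+s\<in>{0..t}. ?en s *
          (nrm (r s) (x - m) * nrm (p s) m * nrm (f s) y + nrm (p s) (x - m) * nrm (r s) m * nrm (f s) y
            + nrm (p s) (x - m) * nrm (p s) m * nrm (q s) y) \<partial>lborel) \<partial>lborel))"
    by (simp add: nn_integral_cmult nn_integral_add)
  also have "(\<integral>\<^sup>+m. (\<integral>\<^sup>+s\<in>{0..t}. ?en s *
          (nrm (r s) (x - m) * nrm (p s) m * nrm (f s) y + nrm (p s) (x - m) * nrm (r s) m * nrm (f s) y
            + nrm (p s) (x - m) * nrm (p s) m * nrm (q s) y) \<partial>lborel) \<partial>lborel)
      = (\<integral>\<^sup>+s. (\<integral>\<^sup>+m. ?en s *
          (nrm (r s) (x - m) * nrm (p s) m * nrm (f s) y + nrm (p s) (x - m) * nrm (r s) m * nrm (f s) y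
            + nrm (p s) (x - m) * nrm (p s) m * nrm (q s) y) * indicator {0..t} s \<partial>lborel) \<partial>lborel)"
    by (rule lborel_pair.Fubini') measurable
  also have "\<dots> = (\<integral>\<^sup>+s\<in>{0..t}. ?en s *
         (conv (nrm (r s)) (nrm (p s)) x * nrm (f s) y + conv (nrm (p s)) (nrm (r s)) x * nrm (f s) y
          + conv (nrm (p s)) (nrm (p s)) x * nrm (q s) y) \<partial>lborel)"
    unfolding conv_def
    by (intro nn_integral_cong) (simp add: nn_integral_cmult nn_integral_multc nn_integral_add)
  also have "(\<integral>\<^sup>+m. nrm (p t) (x - m) * nrm (p t) m * nrm (f t) y \<partial>lborel) = conv (nrm (p t)) (nrm (p t)) x * nrm (f t) y"
    unfolding conv_def by (rule nn_integral_multc) measurable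
  also have "(\<integral>\<^sup>+m. nrm (p 0) (x - m) * nrm (p 0) m * nrm (f 0) y \<partial>lborel) = conv (nrm (p 0)) (nrm (p 0)) x * nrm (f 0) y"
    unfolding conv_def by (rule nn_integral_multc) measurable
  finally have "ennreal (norm (LINT s:{0..t}|lborel. ?e s * (q s x * f s y)))
      \<le> ennreal \<beta> * (ennreal (1 / phase_gap d) * cubic_majorant d p r f q t x y)"
    unfolding cubic_majorant_def by (rule order_trans) (intro mult_left_mono order_refl, auto)
  also have "\<dots> = ennreal (\<beta> / phase_gap d) * cubic_majorant d p r f q t x y"
    using \<beta>_nonneg c by (simp add: mult.assoc[symmetric] ennreal_mult[symmetric])
  finally show ?thesis .
qed

text \<open>
  The first integration by parts. The time derivative of \<open>f s (k - l) * f s l\<close> brings in the forcing of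
  \<open>f\<close>, itself a quadratic expression in \<open>p\<close>; the reflection of \<open>l\<close> identifies the two cubic terms, and each
  one admits a second integration by parts.
\<close>

lemma quadratic_duhamel_bound:
  assumes t: "0 \<le> t" and p: "evolves d p r" and f: "evolves d f q"
    and q: "\<And>s. q s = bil b (p s) (p s)"
    and bp: "bnd p M" and bf: "bnd f M" and r [measurable]: "joint_meas r"
  shows "ennreal (norm (LINT s:{0..t}|lborel. exp (of_real (t - s) * symbol d k) * bil b (f s) (f s) k))
    \<le> ennreal (\<beta> / phase_gap d) * (conv (nrm (f t)) (nrm (f t)) k
      + ennreal (exp (- (t * d * k\<^sup>2))) * conv (nrm (f 0)) (nrm (f 0)) k
      + ennreal (2 * (\<beta> / phase_gap d)) * (\<integral>\<^sup>+l. cubic_majorant d p r f q t (k - l) l \<partial>lborel))"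
proof -
  have jm [measurable]: "joint_meas p" "joint_meas f" using bp bf by (auto simp: bnd_def)
  have [measurable]: "joint_meas q" unfolding q by (rule joint_meas_bil) fact+
  have c: "0 < phase_gap d" by (rule phase_gap_pos[OF d])
  have bc: "0 \<le> \<beta> / phase_gap d" using \<beta>_nonneg c by simp
  let ?e = "\<lambda>s. exp (of_real (t - s) * symbol d k)"
  let ?H = "\<lambda>s l. ?e s * (f s (k - l) * f s l)"
  let ?W = "cubic_majorant d p r f q t"
  have [measurable]: "(\<lambda>s. ?e s) \<in> borel_measurable borel" unfolding symbol_def by measurable
  have Wm [measurable]: "(\<lambda>l. ?W (k - l) l) \<in> borel_measurable borel"
    unfolding cubic_majorant_def conv_def by measurable
  have Wm' [measurable]: "(\<lambda>l. ?W l (k - l)) \<in> borel_measurable borel"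
    unfolding cubic_majorant_def conv_def by measurable
  have eq: "?e s * bil b (f s) (f s) k = (LINT l|lborel. b (k, l) * ?H s l)" for s
  proof -
    have "(LINT l|lborel. b (k, l) * ?H s l) = (LINT l|lborel. ?e s * (b (k, l) * f s (k - l) * f s l))"
      by (simp only: mult_ac)
    also have "\<dots> = ?e s * bil b (f s) (f s) k" unfolding bil_def by (rule integral_mult_right_zero)
    finally show ?thesis by simp
  qed
  have M: "0 \<le> M" using bp XBD(2)[of "nrm (p 0)"] by (auto simp: bnd_def)
  have fin: "(\<integral>\<^sup>+s\<in>{0..t}. (\<integral>\<^sup>+l. ennreal (norm (?H s l)) \<partial>lborel) \<partial>lborel) < \<infinity>"
  proof -
    have "(\<integral>\<^sup>+s\<in>{0..t}. (\<integral>\<^sup>+l. ennreal (norm (?H s l)) \<partial>lborel) \<partial>lborel)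
        \<le> (\<integral>\<^sup>+s. ennreal (M * M) * indicator {0..t} s \<partial>lborel)"
    proof (rule nn_integral_mono)
      fix s
      show "(\<integral>\<^sup>+l. ennreal (norm (?H s l)) \<partial>lborel) * indicator {0..t} s \<le> ennreal (M * M) * indicator {0..t} s"
      proof (cases "0 \<le> s \<and> s \<le> t")
        case True
        have P: "XB (nrm (f s)) M M"
          using bf True rho_bounds(2)[of s] mult_left_mono[of "rho s" 1 M] M
          by (auto simp: bnd_def intro!: XB_weaken[of _ M "M * rho s" M M])
        have e: "norm (?e s) \<le> 1" unfolding norm_exp_symbol using True d by simp
        have "(\<integral>\<^sup>+l. ennreal (norm (?H s l)) \<partial>lborel) \<le> (\<integral>\<^sup>+l. nrm (f s) (k - l) * nrm (f s) l \<partial>lborel)"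
        proof (rule nn_integral_mono)
          fix l
          have "norm (?H s l) \<le> 1 * (norm (f s (k - l)) * norm (f s l))"
            unfolding norm_mult using e[unfolded norm_mult] by (intro mult_right_mono) auto
          then show "ennreal (norm (?H s l)) \<le> nrm (f s) (k - l) * nrm (f s) l"
            by (simp add: ennreal_mult[symmetric] ennreal_leI)
        qed
        also have "\<dots> \<le> ennreal (M * M)"
          using XBD(4)[OF XB_conv[OF P P], of k] unfolding conv_def .
        finally show ?thesis by (intro mult_right_mono) auto
      next
        case False then show ?thesis by (auto simp: indicator_def)
      qed
    qed
    also have "\<dots> = ennreal (M * M) * emeasure lborel {0..t}" by (rule nn_integral_cmult_indicator) simp
    also have "\<dots> < \<infinity>" using t by (simp add: ennreal_mult_less_top)
    finally show ?thesis .
  qed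
  have "ennreal (norm (LINT s:{0..t}|lborel. ?e s * bil b (f s) (f s) k))
      \<le> ennreal \<beta> * (\<integral>\<^sup>+l. ennreal (norm (LINT s:{0..t}|lborel. ?H s l)) \<partial>lborel)"
    unfolding eq
  proof (rule norm_integral_swap_le[OF _ _ _ fin])
    show "(\<lambda>l. b (k, l)) \<in> borel_measurable borel" by measurable
    show "(\<lambda>(s, l). ?H s l) \<in> borel_measurable (borel \<Otimes>\<^sub>M borel)" by measurable
  qed (rule b_le)
  also have "(\<integral>\<^sup>+l. ennreal (norm (LINT s:{0..t}|lborel. ?H s l)) \<partial>lborel)
      \<le> (\<integral>\<^sup>+l. ennreal (1 / phase_gap d) * (nrm (f t) (k - l) * nrm (f t) l
      + ennreal (exp (- (t * d * k\<^sup>2))) * (nrm (f 0) (k - l) * nrm (f 0) l)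
      + ennreal (\<beta> / phase_gap d) * ?W (k - l) l + ennreal (\<beta> / phase_gap d) * ?W l (k - l)) \<partial>lborel)"
  proof (rule nn_integral_mono)
    fix l
    have kl: "k - l + l = k" and lk: "l + (k - l) = k" by simp_all
    let ?I = "LINT s:{0..t}|lborel. ?e s * (q s (k - l) * f s l)"
    let ?J = "LINT s:{0..t}|lborel. ?e s * (q s l * f s (k - l))"
    have "ennreal (norm (LINT s:{0..t}|lborel. ?H s l))
      \<le> ennreal (1 / phase_gap d * (norm (f t (k - l) * f t l)
        + exp (- (t * d * k\<^sup>2)) * norm (f 0 (k - l) * f 0 l) + norm ?I + norm ?J))"
      using duhamel_product2[OF d t f f, of "k - l" l] unfolding kl by (rule ennreal_leI)
    also have "\<dots> = ennreal (1 / phase_gap d) * (nrm (f t) (k - l) * nrm (f t) l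
        + ennreal (exp (- (t * d * k\<^sup>2))) * (nrm (f 0) (k - l) * nrm (f 0) l) + ennreal (norm ?I) + ennreal (norm ?J))"
      by (subst ennreal_mult) (use c in \<open>auto simp: ennreal_mult ennreal_plus norm_mult\<close>)
    also have "\<dots> \<le> ennreal (1 / phase_gap d) * (nrm (f t) (k - l) * nrm (f t) l
        + ennreal (exp (- (t * d * k\<^sup>2))) * (nrm (f 0) (k - l) * nrm (f 0) l)
        + ennreal (\<beta> / phase_gap d) * ?W (k - l) l + ennreal (\<beta> / phase_gap d) * ?W l (k - l))"
      using cubic_duhamel_bound[OF t p f q bp bf r, of "k - l" l] cubic_duhamel_bound[OF t p f q bp bf r, of l "k - l"]
      unfolding kl lk by (intro mult_left_mono add_mono order_refl) auto
    finally show "ennreal (norm (LINT s:{0..t}|lborel. ?H s l)) \<le> ennreal (1 / phase_gap d) * (nrm (f t) (k - l) * nrm (f t) l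
        + ennreal (exp (- (t * d * k\<^sup>2))) * (nrm (f 0) (k - l) * nrm (f 0) l)
        + ennreal (\<beta> / phase_gap d) * ?W (k - l) l + ennreal (\<beta> / phase_gap d) * ?W l (k - l))" .
  qed
  also have "\<dots> = ennreal (1 / phase_gap d) * (conv (nrm (f t)) (nrm (f t)) k
      + ennreal (exp (- (t * d * k\<^sup>2))) * conv (nrm (f 0)) (nrm (f 0)) k
      + ennreal (\<beta> / phase_gap d) * (\<integral>\<^sup>+l. ?W (k - l) l \<partial>lborel)
      + ennreal (\<beta> / phase_gap d) * (\<integral>\<^sup>+l. ?W l (k - l) \<partial>lborel))"
    unfolding conv_def by (simp add: nn_integral_cmult nn_integral_add)
  also have "(\<integral>\<^sup>+l. ?W l (k - l) \<partial>lborel) = (\<integral>\<^sup>+l. ?W (k - l) l \<partial>lborel)"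
    using nn_integral_reflect[OF Wm, of k] by simp
  finally have "ennreal (norm (LINT s:{0..t}|lborel. ?e s * bil b (f s) (f s) k))
    \<le> ennreal \<beta> * (ennreal (1 / phase_gap d) * (conv (nrm (f t)) (nrm (f t)) k
      + ennreal (exp (- (t * d * k\<^sup>2))) * conv (nrm (f 0)) (nrm (f 0)) k
      + ennreal (\<beta> / phase_gap d) * (\<integral>\<^sup>+l. ?W (k - l) l \<partial>lborel)
      + ennreal (\<beta> / phase_gap d) * (\<integral>\<^sup>+l. ?W (k - l) l \<partial>lborel)))"
    by (rule order_trans) (intro mult_left_mono order_refl, auto)
  also have "\<dots> = ennreal (\<beta> / phase_gap d) * (conv (nrm (f t)) (nrm (f t)) k
      + ennreal (exp (- (t * d * k\<^sup>2))) * conv (nrm (f 0)) (nrm (f 0)) k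
      + (ennreal (\<beta> / phase_gap d) * (\<integral>\<^sup>+l. ?W (k - l) l \<partial>lborel)
      + ennreal (\<beta> / phase_gap d) * (\<integral>\<^sup>+l. ?W (k - l) l \<partial>lborel)))"
    using \<beta>_nonneg c by (simp add: mult.assoc[symmetric] ennreal_mult[symmetric] add.assoc)
  also have "ennreal (\<beta> / phase_gap d) * (\<integral>\<^sup>+l. ?W (k - l) l \<partial>lborel)
      + ennreal (\<beta> / phase_gap d) * (\<integral>\<^sup>+l. ?W (k - l) l \<partial>lborel)
      = ennreal (2 * (\<beta> / phase_gap d)) * (\<integral>\<^sup>+l. ?W (k - l) l \<partial>lborel)"
    using bc by (simp only: distrib_right[symmetric] ennreal_plus[symmetric] mult_2)
  finally show ?thesis .
qed

text \<open>
  The two boundary terms cost \<open>2 * heat_const d\<close> at either stage; the number 18 is the constant 6 of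
  \<open>XB_duhamel\<close> for each of the three quartic terms.
\<close>

definition growth :: real where
  "growth = \<beta> / phase_gap d * (2 * heat_const d
     + 2 * (\<beta> / phase_gap d) * (2 * heat_const d + 18 * heat_const d * \<beta>))"

lemma growth_nonneg: "0 \<le> growth"
  using \<beta>_nonneg phase_gap_pos[OF d] heat_const_ge_1[OF d] by (simp add: growth_def)

text \<open>
  The a priori bound. Boundary terms contain at least two factors and inherit the decay of one of them; the
  quartic integrals contain four, three of which contribute a factor \<open>rho\<close>. Hence the quadratic Duhamel
  term obeys the same decay as the linear one, with a constant of second order in the size \<open>M\<close>.
\<close>

lemma quadratic_duhamel_XB:
  assumes t: "0 \<le> t" and p: "evolves d p r" and f: "evolves d f q"
    and q: "\<And>s. q s = bil b (p s) (p s)"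
    and bp: "bnd p M" and bf: "bnd f M" and r [measurable]: "joint_meas r"
    and br: "\<And>s. 0 \<le> s \<Longrightarrow> XB (nrm (r s)) (\<beta> * M\<^sup>2 * rho s) (\<beta> * M\<^sup>2 * (rho s)\<^sup>2)"
    and M: "0 \<le> M" "M \<le> 1"
  shows "XB (nrm (\<lambda>k. LINT s:{0..t}|lborel. exp (of_real (t - s) * symbol d k) * bil b (f s) (f s) k))
    (growth * M\<^sup>2) (growth * M\<^sup>2 * rho t)"
proof -
  have jm [measurable]: "joint_meas p" "joint_meas f" using bp bf by (auto simp: bnd_def)
  have jq [measurable]: "joint_meas q" unfolding q by (rule joint_meas_bil) fact+
  have P: "XB (nrm (p s)) M (M * rho s)" and F: "XB (nrm (f s)) M (M * rho s)" if "0 \<le> s" for s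
    using bp bf that by (auto simp: bnd_def)
  have Q: "XB (nrm (q s)) (\<beta> * M\<^sup>2 * rho s) (\<beta> * M\<^sup>2 * (rho s)\<^sup>2)" if "0 \<le> s" for s
    using XB_bil[OF P[OF that] P[OF that]] unfolding q
    by (simp add: power2_eq_square mult_ac)
  define C where "C = heat_const d"
  have C: "1 \<le> C" unfolding C_def by (rule heat_const_ge_1[OF d])
  have c: "0 < phase_gap d" by (rule phase_gap_pos[OF d])
  have \<beta>: "0 \<le> \<beta>" by (rule \<beta>_nonneg)
  have rt: "0 < rho t" "rho t \<le> 1" using rho_bounds t by auto
  have rr: "rho t * rho t \<le> rho t" using rt mult_left_mono[of "rho t" 1 "rho t"] by simp
  have r0: "rho 0 = 1" by (simp add: rho_def)
  have MM: "M * M \<le> M" "M\<^sup>2 * M \<le> M\<^sup>2" "0 \<le> M\<^sup>2" "M\<^sup>2 * M\<^sup>2 \<le> M\<^sup>2"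
    using M mult_left_mono[of M 1 M] mult_left_mono[of M 1 "M\<^sup>2"] mult_left_mono[of "M\<^sup>2" 1 "M\<^sup>2"]
    by (auto simp: power_le_one)
  have Ft0: "M * (M * rho t) \<le> M\<^sup>2" "M * rho t * (M * rho t) \<le> M\<^sup>2 * rho t"
    using MM rt rr mult_left_mono[of "rho t" 1 "M\<^sup>2"] mult_left_mono[of "rho t * rho t" "rho t" "M\<^sup>2"]
    by (auto simp: power2_eq_square mult_ac)
  have FF: "XB (conv (nrm (f t)) (nrm (f t))) (M\<^sup>2) (M\<^sup>2 * rho t)"
    by (rule XB_weaken[OF XB_conv[OF F[OF t] F[OF t]] Ft0])
  have PP: "XB (conv (nrm (p t)) (nrm (p t))) (M\<^sup>2) (M\<^sup>2 * rho t)"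
    by (rule XB_weaken[OF XB_conv[OF P[OF t] P[OF t]] Ft0])
  have FF0: "XB (conv (nrm (f 0)) (nrm (f 0))) (M\<^sup>2) (M\<^sup>2)"
    using XB_conv[OF F F, of 0 0] by (simp add: r0 power2_eq_square)
  have PP0: "XB (conv (nrm (p 0)) (nrm (p 0))) (M\<^sup>2) (M\<^sup>2)"
    using XB_conv[OF P P, of 0 0] by (simp add: r0 power2_eq_square)
  have PPF: "XB (conv (conv (nrm (p t)) (nrm (p t))) (nrm (f t))) (M\<^sup>2) (M\<^sup>2 * rho t)"
  proof (rule XB_weaken[OF XB_conv[OF PP F[OF t]]])
    have "M * rho t \<le> 1" using mult_mono[of M 1 "rho t" 1] M rt by simp
    then show "M\<^sup>2 * (M * rho t) \<le> M\<^sup>2" "M\<^sup>2 * rho t * (M * rho t) \<le> M\<^sup>2 * rho t"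
      using mult_left_mono[of "M * rho t" 1 "M\<^sup>2"] mult_left_mono[of "M * rho t" 1 "M\<^sup>2 * rho t"] rt M by simp_all
  qed
  have PPF0: "XB (conv (conv (nrm (p 0)) (nrm (p 0))) (nrm (f 0))) (M\<^sup>2) (M\<^sup>2)"
    using XB_weaken[OF XB_conv[OF PP0 F[of 0]], of "M\<^sup>2" "M\<^sup>2"] MM by (simp add: r0)
  let ?en = "\<lambda>s k. ennreal (exp (- ((t - s) * d * k\<^sup>2)))"
  let ?e0 = "\<lambda>k. ennreal (exp (- (t * d * k\<^sup>2)))"
  let ?D = "\<lambda>s k. conv (conv (nrm (r s)) (nrm (p s))) (nrm (f s)) k + conv (conv (nrm (p s)) (nrm (r s))) (nrm (f s)) k
      + conv (conv (nrm (p s)) (nrm (p s))) (nrm (q s)) k"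
  define m where "m = 3 * \<beta> * M\<^sup>2"
  have m: "0 \<le> m" using \<beta> by (simp add: m_def)
  have D: "XB (?D s) (m * rho s ^ 3) (m * rho s ^ 3)" if s: "0 \<le> s" for s
  proof -
    have rs: "0 < rho s" "rho s \<le> 1" using rho_bounds s by auto
    note D0 = XB_add[OF XB_add[OF XB_conv[OF XB_conv[OF br[OF s] P[OF s]] F[OF s]] XB_conv[OF XB_conv[OF P[OF s] br[OF s]] F[OF s]]]
      XB_conv[OF XB_conv[OF P[OF s] P[OF s]] Q[OF s]]]
    have le: "\<beta> * (M\<^sup>2 * M\<^sup>2) * rho s ^ 3 \<le> \<beta> * M\<^sup>2 * rho s ^ 3"
      using \<beta> MM rs by (intro mult_right_mono mult_left_mono) auto
    have r4: "rho s ^ 4 \<le> rho s ^ 3" by (rule rho_power_le[OF s]) simp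
    have le4: "\<beta> * (M\<^sup>2 * M\<^sup>2) * rho s ^ 4 \<le> \<beta> * (M\<^sup>2 * M\<^sup>2) * rho s ^ 3"
      using \<beta> r4 by (intro mult_left_mono) auto
    show ?thesis
    proof (rule XB_weaken[OF D0])
      show "\<beta> * M\<^sup>2 * rho s * (M * rho s) * (M * rho s) + M * (\<beta> * M\<^sup>2 * (rho s)\<^sup>2) * (M * rho s)
          + M * (M * rho s) * (\<beta> * M\<^sup>2 * (rho s)\<^sup>2) \<le> m * rho s ^ 3"
        using le by (simp add: m_def power2_eq_square power3_eq_cube mult_ac)
      show "\<beta> * M\<^sup>2 * (rho s)\<^sup>2 * (M * rho s) * (M * rho s) + M * rho s * (\<beta> * M\<^sup>2 * (rho s)\<^sup>2) * (M * rho s)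
          + M * rho s * (M * rho s) * (\<beta> * M\<^sup>2 * (rho s)\<^sup>2) \<le> m * rho s ^ 3"
        using order_trans[OF le4 le] by (simp add: m_def power2_eq_square power3_eq_cube power4_eq_xxxx mult_ac)
    qed
  qed
  have jD [measurable]: "(\<lambda>(s, k). ?D s k) \<in> borel_measurable (borel \<Otimes>\<^sub>M borel)"
    unfolding conv_def by measurable
  have "XB (\<lambda>k. \<integral>\<^sup>+s\<in>{0..t}. (?en s k) * ?D s k \<partial>lborel) (2 * m) (6 * C * m * rho t)"
    unfolding C_def by (rule XB_duhamel[OF jD D t d m])
  then have D2: "XB (\<lambda>k. \<integral>\<^sup>+s\<in>{0..t}. (?en s k) * ?D s k \<partial>lborel) (6 * C * m) (6 * C * m * rho t)"
  proof (rule XB_weaken)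
    show "2 * m \<le> 6 * C * m" using C m by (intro mult_right_mono) auto
  qed simp
  have W: "(\<integral>\<^sup>+l. cubic_majorant d p r f q t (k - l) l \<partial>lborel)
      = conv (conv (nrm (p t)) (nrm (p t))) (nrm (f t)) k
        + ?e0 k * conv (conv (nrm (p 0)) (nrm (p 0))) (nrm (f 0)) k
        + (\<integral>\<^sup>+s\<in>{0..t}. (?en s k) * ?D s k \<partial>lborel)" for k
  proof -
    let ?G = "\<lambda>s l. conv (nrm (r s)) (nrm (p s)) (k - l) * nrm (f s) l + conv (nrm (p s)) (nrm (r s)) (k - l) * nrm (f s) l
          + conv (nrm (p s)) (nrm (p s)) (k - l) * nrm (q s) l"
    have j [measurable]: "joint_meas (\<lambda>s. conv (nrm (r s)) (nrm (p s)))" "joint_meas (\<lambda>s. conv (nrm (p s)) (nrm (r s)))"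
      "joint_meas (\<lambda>s. conv (nrm (p s)) (nrm (p s)))"
      unfolding conv_def by measurable
    have "(\<integral>\<^sup>+l. cubic_majorant d p r f q t (k - l) l \<partial>lborel)
      = (\<integral>\<^sup>+l. conv (nrm (p t)) (nrm (p t)) (k - l) * nrm (f t) l
          + ?e0 k * (conv (nrm (p 0)) (nrm (p 0)) (k - l) * nrm (f 0) l)
          + (\<integral>\<^sup>+s. (?en s k) * ?G s l * indicator {0..t} s \<partial>lborel) \<partial>lborel)"
      unfolding cubic_majorant_def by (simp only: diff_add_cancel)
    also have "\<dots> = (\<integral>\<^sup>+l. conv (nrm (p t)) (nrm (p t)) (k - l) * nrm (f t) l \<partial>lborel)
          + ?e0 k * (\<integral>\<^sup>+l. conv (nrm (p 0)) (nrm (p 0)) (k - l) * nrm (f 0) l \<partial>lborel)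
          + (\<integral>\<^sup>+l. (\<integral>\<^sup>+s. (?en s k) * ?G s l * indicator {0..t} s \<partial>lborel) \<partial>lborel)"
      by (simp add: nn_integral_add nn_integral_cmult)
    also have "(\<integral>\<^sup>+l. (\<integral>\<^sup>+s. (?en s k) * ?G s l * indicator {0..t} s \<partial>lborel) \<partial>lborel)
        = (\<integral>\<^sup>+s. (\<integral>\<^sup>+l. (?en s k) * ?G s l * indicator {0..t} s \<partial>lborel) \<partial>lborel)"
      by (rule lborel_pair.Fubini') measurable
    also have "\<dots> = (\<integral>\<^sup>+s\<in>{0..t}. (?en s k) * ?D s k \<partial>lborel)"
      unfolding conv_def[where F="conv _ _"]
      by (intro nn_integral_cong) (simp add: nn_integral_add nn_integral_cmult nn_integral_multc)
    finally show ?thesis unfolding conv_def[where F="conv _ _"] .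
  qed
  have heat: "XB (\<lambda>k. ?e0 k * G k) (M\<^sup>2) (C * M\<^sup>2 * rho t)" if "XB G (M\<^sup>2) (M\<^sup>2)" for G
    unfolding C_def by (rule XB_heat[OF that t d])
  have bc: "0 \<le> \<beta> / phase_gap d" using \<beta> c by simp
  note T = XB_cmult[OF XB_add[OF XB_add[OF FF heat[OF FF0]]
      XB_cmult[OF XB_add[OF XB_add[OF PPF heat[OF PPF0]] D2], of "2 * (\<beta> / phase_gap d)"]] bc]
  show ?thesis
  proof (rule XB_mono[OF T])
    show "0 \<le> 2 * (\<beta> / phase_gap d)" using bc by simp
    have a1: "M\<^sup>2 + M\<^sup>2 \<le> 2 * C * M\<^sup>2" using mult_right_mono[OF C, of "M\<^sup>2"] by simp
    have a2: "M\<^sup>2 * rho t + C * M\<^sup>2 * rho t \<le> 2 * C * M\<^sup>2 * rho t"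
      using mult_right_mono[OF C, of "M\<^sup>2 * rho t"] rt by (simp add: mult_ac)
    have m': "6 * C * m = 18 * C * \<beta> * M\<^sup>2" by (simp add: m_def)
    have "\<beta> / phase_gap d * (M\<^sup>2 + M\<^sup>2 + 2 * (\<beta> / phase_gap d) * (M\<^sup>2 + M\<^sup>2 + 6 * C * m))
        \<le> \<beta> / phase_gap d * (2 * C * M\<^sup>2 + 2 * (\<beta> / phase_gap d) * (2 * C * M\<^sup>2 + 18 * C * \<beta> * M\<^sup>2))"
      unfolding m' using bc a1 by (intro mult_left_mono add_mono order_refl) auto
    also have "\<dots> = growth * M\<^sup>2" unfolding growth_def C_def[symmetric] by (simp only: distrib_left distrib_right mult_ac)
    finally show "\<beta> / phase_gap d * (M\<^sup>2 + M\<^sup>2 + 2 * (\<beta> / phase_gap d) * (M\<^sup>2 + M\<^sup>2 + 6 * C * m)) \<le> growth * M\<^sup>2" .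
    have "\<beta> / phase_gap d * (M\<^sup>2 * rho t + C * M\<^sup>2 * rho t + 2 * (\<beta> / phase_gap d) * (M\<^sup>2 * rho t + C * M\<^sup>2 * rho t + 6 * C * m * rho t))
        \<le> \<beta> / phase_gap d * (2 * C * M\<^sup>2 * rho t + 2 * (\<beta> / phase_gap d) * (2 * C * M\<^sup>2 * rho t + 18 * C * \<beta> * M\<^sup>2 * rho t))"
      unfolding m' using bc a2 by (intro mult_left_mono add_mono order_refl) auto
    also have "\<dots> = growth * M\<^sup>2 * rho t" unfolding growth_def C_def[symmetric] by (simp only: distrib_left distrib_right mult_ac)
    finally show "\<beta> / phase_gap d * (M\<^sup>2 * rho t + C * M\<^sup>2 * rho t + 2 * (\<beta> / phase_gap d) * (M\<^sup>2 * rho t + C * M\<^sup>2 * rho t + 6 * C * m * rho t))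
        \<le> growth * M\<^sup>2 * rho t" .
    have [measurable]: "joint_meas (\<lambda>s. bil b (f s) (f s))" by (rule joint_meas_bil) fact+
    show "nrm (\<lambda>k. LINT s:{0..t}|lborel. exp (of_real (t - s) * symbol d k) * bil b (f s) (f s) k) \<in> borel_measurable borel"
      unfolding set_lebesgue_integral_def symbol_def by measurable
    fix k
    show "ennreal (norm (LINT s:{0..t}|lborel. exp (of_real (t - s) * symbol d k) * bil b (f s) (f s) k))
       \<le> ennreal (\<beta> / phase_gap d) * (conv (nrm (f t)) (nrm (f t)) k + ?e0 k * conv (nrm (f 0)) (nrm (f 0)) k
        + ennreal (2 * (\<beta> / phase_gap d)) * (conv (conv (nrm (p t)) (nrm (p t))) (nrm (f t)) k
          + ?e0 k * conv (conv (nrm (p 0)) (nrm (p 0))) (nrm (f 0)) k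
          + (\<integral>\<^sup>+s\<in>{0..t}. (?en s k) * ?D s k \<partial>lborel)))"
      using quadratic_duhamel_bound[OF t p f q bp bf r, of k] unfolding W .
  qed
qed

end

section \<open>Duhamel integrals\<close>

lemma ennreal_norm_triangle:
  fixes x y :: complex
  shows "ennreal (norm (x + y)) \<le> ennreal (norm x) + ennreal (norm y)"
  unfolding ennreal_plus[OF norm_ge_zero norm_ge_zero, symmetric]
  by (rule ennreal_leI[OF norm_triangle_ineq])

text \<open>
  Pointwise limits preserve the bounds, by Fatou's lemma.
\<close>

lemma XB_limit:
  assumes F: "\<And>n. XB (nrm (f n)) A B" and lim: "\<And>k. (\<lambda>n. f n k) \<longlonglongrightarrow> g k"
    and [measurable]: "\<And>n. f n \<in> borel_measurable borel" "g \<in> borel_measurable borel"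
  shows "XB (nrm g) A B"
proof (rule XBI)
  have l: "(\<lambda>n. nrm (f n) k) \<longlonglongrightarrow> nrm g k" for k
    by (intro tendsto_ennrealI tendsto_norm lim)
  show "nrm g k \<le> ennreal A" for k
    by (rule LIMSEQ_le_const2[OF l]) (use XBD(4)[OF F] in auto)
  have "(\<integral>\<^sup>+k. nrm g k \<partial>lborel) = (\<integral>\<^sup>+k. liminf (\<lambda>n. nrm (f n) k) \<partial>lborel)"
    using lim_imp_Liminf[OF trivial_limit_sequentially l] by simp
  also have "\<dots> \<le> liminf (\<lambda>n. \<integral>\<^sup>+k. nrm (f n) k \<partial>lborel)"
    by (rule nn_integral_liminf) measurable
  also have "\<dots> \<le> liminf (\<lambda>n::nat. ennreal B)"
    by (rule Liminf_mono) (use XBD(5)[OF F] in auto)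
  also have "\<dots> = ennreal B" by (simp add: Liminf_const)
  finally show "(\<integral>\<^sup>+k. nrm g k \<partial>lborel) \<le> ennreal B" .
  show "nrm g \<in> borel_measurable borel" by measurable
qed (use XBD(2,3)[OF F[of 0]] in auto)

lemma XB_time_integral:
  fixes R :: "real \<Rightarrow> real \<Rightarrow> ennreal"
  assumes R [measurable]: "joint_meas R" and a [measurable]: "a \<in> borel_measurable borel"
    and b: "\<And>s. 0 \<le> s \<Longrightarrow> s \<le> t \<Longrightarrow> XB (R s) (a s) (a s)"
    and A: "(\<integral>\<^sup>+s\<in>{0..t}. ennreal (a s) \<partial>lborel) \<le> ennreal A" "0 \<le> A"
  shows "XB (\<lambda>k. \<integral>\<^sup>+s\<in>{0..t}. R s k \<partial>lborel) A A"
proof (rule XBI)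
  show "(\<lambda>k. \<integral>\<^sup>+s\<in>{0..t}. R s k \<partial>lborel) \<in> borel_measurable borel" by measurable
  fix k
  have "(\<integral>\<^sup>+s\<in>{0..t}. R s k \<partial>lborel) \<le> (\<integral>\<^sup>+s\<in>{0..t}. ennreal (a s) \<partial>lborel)"
  proof (rule nn_integral_mono)
    fix s show "R s k * indicator {0..t} s \<le> ennreal (a s) * indicator {0..t} s"
      using XBD(4)[OF b[of s]] by (auto simp: indicator_def)
  qed
  then show "(\<integral>\<^sup>+s\<in>{0..t}. R s k \<partial>lborel) \<le> ennreal A" using A(1) by (rule order_trans)
next
  have "(\<integral>\<^sup>+k. (\<integral>\<^sup>+s\<in>{0..t}. R s k \<partial>lborel) \<partial>lborel) = (\<integral>\<^sup>+s. (\<integral>\<^sup>+k. R s k * indicator {0..t} s \<partial>lborel) \<partial>lborel)"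
    by (rule lborel_pair.Fubini') measurable
  also have "\<dots> \<le> (\<integral>\<^sup>+s\<in>{0..t}. ennreal (a s) \<partial>lborel)"
  proof (rule nn_integral_mono)
    fix s show "(\<integral>\<^sup>+k. R s k * indicator {0..t} s \<partial>lborel) \<le> ennreal (a s) * indicator {0..t} s"
      using XBD(5)[OF b[of s]] by (auto simp: indicator_def)
  qed
  also have "\<dots> \<le> ennreal A" by (rule A(1))
  finally show "(\<integral>\<^sup>+k. (\<integral>\<^sup>+s\<in>{0..t}. R s k \<partial>lborel) \<partial>lborel) \<le> ennreal A" .
qed (use A in auto)

lemma exp_time_integral:
  assumes "0 \<le> t" "0 < \<gamma>" "0 \<le> x"
  shows "(\<integral>\<^sup>+s\<in>{0..t}. ennreal (x * exp (\<gamma> * s)) \<partial>lborel) \<le> ennreal (x / \<gamma> * exp (\<gamma> * t))"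
proof -
  have "(\<integral>\<^sup>+s. ennreal (x * exp (\<gamma> * s)) * indicator {0..t} s \<partial>lborel)
      = ennreal (x / \<gamma> * exp (\<gamma> * t) - x / \<gamma> * exp (\<gamma> * 0))"
    by (rule nn_integral_FTC_Icc[OF _ _ _ assms(1)])
      (use assms in \<open>auto intro!: derivative_eq_intros\<close>)
  also have "\<dots> \<le> ennreal (x / \<gamma> * exp (\<gamma> * t))"
    using assms by (intro ennreal_leI) simp
  finally show ?thesis .
qed

context bounded_kernel
begin

definition duhamel :: "(real \<Rightarrow> complex) \<Rightarrow> (real \<Rightarrow> real \<Rightarrow> complex) \<Rightarrow> real \<Rightarrow> real \<Rightarrow> complex" where
  "duhamel g Q t k = exp (of_real t * symbol d k) * g k
     + (LINT s:{0..t}|lborel. exp (of_real (t - s) * symbol d k) * Q s k)"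

lemma joint_meas_duhamel:
  assumes [measurable]: "g \<in> borel_measurable borel" "joint_meas Q"
  shows "joint_meas (duhamel g Q)"
proof -
  have eq: "duhamel g Q t k = exp (of_real t * symbol d k) * g k
     + (LINT s|lborel. (if 0 \<le> s \<and> s \<le> t then exp (of_real (t - s) * symbol d k) * Q s k else 0))" for t k
    unfolding duhamel_def set_lebesgue_integral_def
    by (intro arg_cong2[where f=plus] refl Bochner_Integration.integral_cong) (auto simp: indicator_def)
  show ?thesis unfolding eq symbol_def by measurable
qed

lemma set_integrable_bounded:
  assumes [measurable]: "joint_meas Q" and Q: "\<And>s. 0 \<le> s \<Longrightarrow> s \<le> t \<Longrightarrow> norm (Q s k) \<le> m"
  shows "set_integrable lborel {0..t} (\<lambda>s. exp (of_real (t - s) * symbol d k) * Q s k)"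
  unfolding set_integrable_def
proof (rule Bochner_Integration.integrable_bound)
  show "integrable lborel (\<lambda>s. indicator {0..t} s *\<^sub>R m)"
    by (intro integrable_scaleR_left integrable_real_indicator) (auto simp: emeasure_lborel_Icc_eq)
  show "(\<lambda>s. indicator {0..t} s *\<^sub>R (exp (of_real (t - s) * symbol d k) * Q s k)) \<in> borel_measurable lborel"
    by measurable
  show "AE s in lborel. norm (indicator {0..t} s *\<^sub>R (exp (of_real (t - s) * symbol d k) * Q s k))
      \<le> norm (indicator {0..t} s *\<^sub>R m)"
  proof (rule AE_I2)
    fix s
    show "norm (indicator {0..t} s *\<^sub>R (exp (of_real (t - s) * symbol d k) * Q s k)) \<le> norm (indicator {0..t} s *\<^sub>R m)"
    proof (cases "0 \<le> s \<and> s \<le> t")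
      case True
      have "norm (exp (of_real (t - s) * symbol d k) * Q s k) \<le> 1 * m"
        unfolding norm_mult[of "exp _"] norm_exp_symbol using True d Q[of s]
        by (intro mult_mono) auto
      then show ?thesis using True by (simp add: indicator_def)
    next
      case False then show ?thesis by (auto simp: indicator_def)
    qed
  qed
qed

lemma norm_duhamel_le:
  assumes "0 \<le> t"
  shows "ennreal (norm (LINT s:{0..t}|lborel. exp (of_real (t - s) * symbol d k) * Q s k))
    \<le> (\<integral>\<^sup>+s\<in>{0..t}. ennreal (norm (Q s k)) \<partial>lborel)"
proof (rule order_trans[OF norm_set_integral_le_nn_integral nn_integral_mono])
  fix s
  show "ennreal (norm (exp (of_real (t - s) * symbol d k) * Q s k)) * indicator {0..t} s
      \<le> ennreal (norm (Q s k)) * indicator {0..t} s"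
  proof (cases "0 \<le> s \<and> s \<le> t")
    case True
    have "norm (exp (of_real (t - s) * symbol d k) * Q s k) \<le> 1 * norm (Q s k)"
      unfolding norm_mult[of "exp _"] norm_exp_symbol using True d by (intro mult_right_mono) auto
    then show ?thesis by (intro mult_right_mono ennreal_leI) auto
  next
    case False then show ?thesis by (auto simp: indicator_def)
  qed
qed

lemma evolves_duhamel:
  assumes Q: "\<And>k. continuous_on {0..} (\<lambda>t. Q t k)"
  shows "evolves d (duhamel g Q) Q"
  unfolding evolves_def
proof (intro conjI allI impI Q)
  fix k t :: real assume t: "0 \<le> t"
  let ?lam = "symbol d k"
  let ?F = "\<lambda>t. exp (of_real t * ?lam) * (g k + integral {0..t} (\<lambda>s. exp (of_real (- s) * ?lam) * Q s k))"
  have cQ: "continuous_on {0..T} (\<lambda>s. Q s k)" for T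
    by (rule continuous_on_subset[OF Q]) auto
  have eq: "duhamel g Q u k = ?F u" if "0 \<le> u" for u
  proof -
    have "(LINT s:{0..u}|lborel. exp (of_real (u - s) * ?lam) * Q s k)
        = integral {0..u} (\<lambda>s. exp (of_real (u - s) * ?lam) * Q s k)"
      by (intro set_integral_eq_HK continuous_intros cQ)
    also have "\<dots> = integral {0..u} (\<lambda>s. exp (of_real u * ?lam) * (exp (of_real (- s) * ?lam) * Q s k))"
    proof (rule Henstock_Kurzweil_Integration.integral_cong)
      fix s
      have "of_real (u - s) * ?lam = of_real u * ?lam + of_real (- s) * ?lam" by (simp add: left_diff_distrib)
      then have "exp (of_real (u - s) * ?lam) = exp (of_real u * ?lam) * exp (of_real (- s) * ?lam)"
        by (simp only: exp_add)
      then show "exp (of_real (u - s) * ?lam) * Q s k = exp (of_real u * ?lam) * (exp (of_real (- s) * ?lam) * Q s k)"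
        by (simp only: mult.assoc)
    qed
    also have "\<dots> = exp (of_real u * ?lam) * integral {0..u} (\<lambda>s. exp (of_real (- s) * ?lam) * Q s k)"
      by (rule Henstock_Kurzweil_Integration.integral_mult_right)
    finally show ?thesis unfolding duhamel_def distrib_left by (rule arg_cong)
  qed
  \<comment> \<open>The fundamental theorem of calculus works on compact intervals; the margin 1 keeps \<open>t\<close> away from the right end.\<close>
  have w: "at t within {0..t + 1} = at t within {0..}"
  proof (rule at_within_nhd[of t "{..<t + 1}"])
    have "{0..t + 1} \<inter> {..<t + 1} = {0..} \<inter> {..<t + 1}"
      by (intro set_eqI) (simp, linarith)
    then show "{0..t + 1} \<inter> {..<t + 1} - {t} = {0..} \<inter> {..<t + 1} - {t}" by (rule arg_cong)
  qed simp_all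
  have dE: "((\<lambda>t. exp (of_real t * ?lam)) has_vector_derivative ?lam * exp (of_real t * ?lam)) (at t within S)" for S
  proof -
    have "((\<lambda>z. exp (z * ?lam)) has_field_derivative ?lam * exp (of_real t * ?lam)) (at (of_real t))"
      by (auto intro!: derivative_eq_intros)
    from has_vector_derivative_real_field[OF this] show ?thesis by simp
  qed
  have "((\<lambda>u. integral {0..u} (\<lambda>s. exp (of_real (- s) * ?lam) * Q s k)) has_vector_derivative
      exp (of_real (- t) * ?lam) * Q t k) (at t within {0..t + 1})"
    by (rule integral_has_vector_derivative) (use t in \<open>auto intro!: continuous_intros cQ\<close>)
  then have "(?F has_vector_derivative exp (of_real t * ?lam) * (0 + exp (of_real (- t) * ?lam) * Q t k)
      + ?lam * exp (of_real t * ?lam) * (g k + integral {0..t} (\<lambda>s. exp (of_real (- s) * ?lam) * Q s k))) (at t within {0..t + 1})"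
    by (intro has_vector_derivative_mult has_vector_derivative_add has_vector_derivative_const dE)
  also have "exp (of_real t * ?lam) * (0 + exp (of_real (- t) * ?lam) * Q t k)
      + ?lam * exp (of_real t * ?lam) * (g k + integral {0..t} (\<lambda>s. exp (of_real (- s) * ?lam) * Q s k)) = ?lam * ?F t + Q t k"
  proof -
    have "exp (of_real t * ?lam) * exp (of_real (- t) * ?lam) = 1" by (simp add: exp_add[symmetric])
    then show ?thesis by (simp add: mult.assoc[symmetric])
  qed
  finally have "(?F has_vector_derivative ?lam * ?F t + Q t k) (at t within {0..})" unfolding w .
  then have "((\<lambda>u. duhamel g Q u k) has_vector_derivative ?lam * ?F t + Q t k) (at t within {0..})"
    by (rule has_vector_derivative_transform[rotated 2]) (use t eq in auto)
  then show "((\<lambda>u. duhamel g Q u k) has_vector_derivative ?lam * duhamel g Q t k + Q t k) (at t within {0..})"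
    unfolding eq[OF t] .
qed

text \<open>
  A majorant in frequency, uniform on compact time intervals. It drives the dominated convergence
  arguments in time.
\<close>

definition dominated :: "(real \<Rightarrow> real \<Rightarrow> complex) \<Rightarrow> bool" where
  "dominated f \<longleftrightarrow> (\<forall>T\<ge>0. \<exists>h A. XB h A A \<and> (\<forall>t k. 0 \<le> t \<and> t \<le> T \<longrightarrow> ennreal (norm (f t k)) \<le> h k))"

text \<open>
  In the mild formulation the majorant is explicit: the modulus of the data plus the time integral of the
  modulus of the forcing.
\<close>

lemma dominated_duhamel:
  assumes g: "XB (nrm g) E E" and Q [measurable]: "joint_meas Q"
    and b: "\<And>s. 0 \<le> s \<Longrightarrow> XB (nrm (Q s)) m m" and m: "0 \<le> m"
  shows "dominated (duhamel g Q)"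
  unfolding dominated_def
proof (intro allI impI)
  fix T :: real assume T: "0 \<le> T"
  have I: "XB (\<lambda>k. \<integral>\<^sup>+s\<in>{0..T}. nrm (Q s) k \<partial>lborel) (m * T) (m * T)"
  proof (rule XB_time_integral[where a="\<lambda>_. m"])
    have "(\<integral>\<^sup>+s\<in>{0..T}. ennreal m \<partial>lborel) = ennreal m * emeasure lborel {0..T}"
      by (rule nn_integral_cmult_indicator) simp
    then show "(\<integral>\<^sup>+s\<in>{0..T}. ennreal m \<partial>lborel) \<le> ennreal (m * T)"
      using T m by (simp add: ennreal_mult)
    show "joint_meas (\<lambda>s. nrm (Q s))" by measurable
  qed (use b m T in auto)
  show "\<exists>h A. XB h A A \<and> (\<forall>t k. 0 \<le> t \<and> t \<le> T \<longrightarrow> ennreal (norm (duhamel g Q t k)) \<le> h k)"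
  proof (intro exI conjI allI impI)
    show "XB (\<lambda>k. nrm g k + (\<integral>\<^sup>+s\<in>{0..T}. nrm (Q s) k \<partial>lborel)) (E + m * T) (E + m * T)"
      by (rule XB_add[OF g I])
    fix t k assume t: "0 \<le> t \<and> t \<le> T"
    have "norm (exp (of_real t * symbol d k) * g k) \<le> 1 * norm (g k)"
      unfolding norm_mult[of "exp _"] norm_exp_symbol using t d by (intro mult_right_mono) auto
    then have 1: "ennreal (norm (exp (of_real t * symbol d k) * g k)) \<le> nrm g k" by (simp add: ennreal_leI)
    have "ennreal (norm (LINT s:{0..t}|lborel. exp (of_real (t - s) * symbol d k) * Q s k))
        \<le> (\<integral>\<^sup>+s\<in>{0..t}. ennreal (norm (Q s k)) \<partial>lborel)"
      using t by (intro norm_duhamel_le) simp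
    also have "\<dots> \<le> (\<integral>\<^sup>+s\<in>{0..T}. ennreal (norm (Q s k)) \<partial>lborel)"
      using t by (intro nn_integral_mono) (auto simp: indicator_def)
    finally have 2: "ennreal (norm (LINT s:{0..t}|lborel. exp (of_real (t - s) * symbol d k) * Q s k))
        \<le> (\<integral>\<^sup>+s\<in>{0..T}. nrm (Q s) k \<partial>lborel)" .
    have "ennreal (norm (duhamel g Q t k)) \<le> ennreal (norm (exp (of_real t * symbol d k) * g k))
       + ennreal (norm (LINT s:{0..t}|lborel. exp (of_real (t - s) * symbol d k) * Q s k))"
      unfolding duhamel_def by (rule ennreal_norm_triangle)
    also have "\<dots> \<le> nrm g k + (\<integral>\<^sup>+s\<in>{0..T}. nrm (Q s) k \<partial>lborel)" by (rule add_mono[OF 1 2])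
    finally show "ennreal (norm (duhamel g Q t k)) \<le> nrm g k + (\<integral>\<^sup>+s\<in>{0..T}. nrm (Q s) k \<partial>lborel)" .
  qed
qed

text \<open>
  Dominated convergence in \<open>l\<close>; the majorant of \<open>f\<close> convolved with itself is finite at every frequency, so
  that continuity holds for every \<open>k\<close>.
\<close>

lemma continuous_bil:
  assumes f [measurable]: "joint_meas f" and dom: "dominated f" and c: "\<And>k. continuous_on {0..} (\<lambda>t. f t k)"
  shows "continuous_on {0..} (\<lambda>t. bil b (f t) (f t) k)"
  unfolding continuous_on_sequentially
proof (intro allI ballI impI, elim conjE)
  fix x :: "nat \<Rightarrow> real" and a assume a: "a \<in> {0..}" and x: "\<forall>n. x n \<in> {0..}" and lim: "x \<longlonglongrightarrow> a"
  obtain T where T: "\<And>n. x n \<le> T" using convergent_imp_Bseq[OF convergentI[OF lim]]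
    by (metis BseqE abs_le_D1 real_norm_def)
  have T0: "0 \<le> T" using x T[of 0] by (metis atLeast_iff order_trans)
  have aT: "a \<le> T" by (rule LIMSEQ_le_const2[OF lim]) (use T in auto)
  obtain h A where h: "XB h A A" and fh: "\<And>t k. 0 \<le> t \<and> t \<le> T \<Longrightarrow> ennreal (norm (f t k)) \<le> h k"
    using dom T0 unfolding dominated_def by blast
  note [measurable] = XBD(1)[OF h]
  define w where "w l = \<beta> * enn2real (h (k - l)) * enn2real (h l)" for l
  have hf: "h l = ennreal (enn2real (h l))" for l
    using XBD(4)[OF h, of l] by (metis ennreal_enn2real ennreal_less_top le_less_trans)
  have fw: "norm (f t l) \<le> enn2real (h l)" if "0 \<le> t \<and> t \<le> T" for t l
    using fh[OF that, of l] hf[of l] by (metis enn2real_nonneg ennreal_le_iff)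
  have "(\<lambda>n. LINT l|lborel. b (k, l) * f (x n) (k - l) * f (x n) l) \<longlonglongrightarrow> (LINT l|lborel. b (k, l) * f a (k - l) * f a l)"
  proof (rule integral_dominated_convergence[where w=w])
    show "integrable lborel w"
    proof (rule integrableI_bounded)
      show "w \<in> borel_measurable lborel" unfolding w_def by measurable
      have "(\<integral>\<^sup>+l. ennreal (norm (w l)) \<partial>lborel) = (\<integral>\<^sup>+l. ennreal \<beta> * (h (k - l) * h l) \<partial>lborel)"
      proof (rule nn_integral_cong)
        fix l
        have "ennreal (norm (w l)) = ennreal \<beta> * (ennreal (enn2real (h (k - l))) * ennreal (enn2real (h l)))"
          unfolding w_def using \<beta>_nonneg by (simp add: ennreal_mult mult.assoc)
        then show "ennreal (norm (w l)) = ennreal \<beta> * (h (k - l) * h l)" by (simp only: hf[symmetric])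
      qed
      also have "\<dots> = ennreal \<beta> * conv h h k" unfolding conv_def by (rule nn_integral_cmult) measurable
      also have "\<dots> \<le> ennreal \<beta> * ennreal (A * A)" by (intro mult_left_mono XBD(4)[OF XB_conv[OF h h]]) simp
      also have "\<dots> < \<infinity>" by (simp add: ennreal_mult_less_top)
      finally show "(\<integral>\<^sup>+l. ennreal (norm (w l)) \<partial>lborel) < \<infinity>" .
    qed
    show "AE l in lborel. (\<lambda>n. b (k, l) * f (x n) (k - l) * f (x n) l) \<longlonglongrightarrow> b (k, l) * f a (k - l) * f a l"
    proof (rule AE_I2)
      fix l
      have "(\<lambda>n. f (x n) j) \<longlonglongrightarrow> f a j" for j
        using c[of j] a x lim unfolding continuous_on_sequentially comp_def by blast
      then show "(\<lambda>n. b (k, l) * f (x n) (k - l) * f (x n) l) \<longlonglongrightarrow> b (k, l) * f a (k - l) * f a l"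
        by (intro tendsto_intros)
    qed
    show "AE l in lborel. norm (b (k, l) * f (x n) (k - l) * f (x n) l) \<le> w l" for n
    proof (rule AE_I2)
      fix l
      have xn: "0 \<le> x n \<and> x n \<le> T" using x T by auto
      show "norm (b (k, l) * f (x n) (k - l) * f (x n) l) \<le> w l"
        unfolding w_def norm_mult using b_le fw[OF xn] \<beta>_nonneg by (intro mult_mono) auto
    qed
  qed measurable
  then show "((\<lambda>t. bil b (f t) (f t) k) \<circ> x) \<longlonglongrightarrow> bil b (f a) (f a) k"
    unfolding bil_def comp_def .
qed

lemma bil_integrable:
  assumes "XB (nrm f) A B" "XB (nrm g) A' B'" and [measurable]: "f \<in> borel_measurable borel" "g \<in> borel_measurable borel"
  shows "integrable lborel (\<lambda>l. b (k, l) * f (k - l) * g l)"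
proof (rule integrableI_bounded)
  have "(\<integral>\<^sup>+l. ennreal (norm (b (k, l) * f (k - l) * g l)) \<partial>lborel)
      \<le> (\<integral>\<^sup>+l. ennreal \<beta> * (nrm f (k - l) * nrm g l) \<partial>lborel)"
  proof (rule nn_integral_mono)
    fix l
    have "norm (b (k, l) * f (k - l) * g l) \<le> \<beta> * (norm (f (k - l)) * norm (g l))"
      unfolding norm_mult mult.assoc by (intro mult_right_mono b_le) simp
    then show "ennreal (norm (b (k, l) * f (k - l) * g l)) \<le> ennreal \<beta> * (nrm f (k - l) * nrm g l)"
      using \<beta>_nonneg by (simp add: ennreal_mult[symmetric] ennreal_leI)
  qed
  also have "\<dots> = ennreal \<beta> * conv (nrm f) (nrm g) k" unfolding conv_def by (rule nn_integral_cmult) measurable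
  also have "\<dots> \<le> ennreal \<beta> * ennreal (A * B')" by (intro mult_left_mono XBD(4)[OF XB_conv[OF assms(1,2)]]) simp
  also have "\<dots> < \<infinity>" by (simp add: ennreal_mult_less_top)
  finally show "(\<integral>\<^sup>+l. ennreal (norm (b (k, l) * f (k - l) * g l)) \<partial>lborel) < \<infinity>" .
qed measurable

lemma XB_bil_diff:
  assumes x: "XB (nrm (\<lambda>k. f k - p k)) x x" and f: "XB (nrm f) M M" and p: "XB (nrm p) M M"
    and m [measurable]: "f \<in> borel_measurable borel" "p \<in> borel_measurable borel"
  shows "XB (nrm (\<lambda>k. bil b f f k - bil b p p k)) (2 * \<beta> * M * x) (2 * \<beta> * M * x)"
proof -
  have mm [measurable]: "(\<lambda>k. f k - p k) \<in> borel_measurable borel" by measurable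
  have eq: "bil b f f k - bil b p p k = bil b (\<lambda>k. f k - p k) f k + bil b p (\<lambda>k. f k - p k) k" for k
  proof -
    have "bil b (\<lambda>k. f k - p k) f k + bil b p (\<lambda>k. f k - p k) k
        = (LINT l|lborel. b (k, l) * (f (k - l) - p (k - l)) * f l + b (k, l) * p (k - l) * (f l - p l))"
      unfolding bil_def
      by (rule Bochner_Integration.integral_add[symmetric]) (rule bil_integrable[OF x f mm m(1)] bil_integrable[OF p x m(2) mm])+
    also have "\<dots> = (LINT l|lborel. b (k, l) * f (k - l) * f l - b (k, l) * p (k - l) * p l)"
      by (simp add: algebra_simps)
    also have "\<dots> = bil b f f k - bil b p p k"
      unfolding bil_def by (rule Bochner_Integration.integral_diff) (rule bil_integrable[OF f f m(1,1)] bil_integrable[OF p p m(2,2)])+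
    finally show ?thesis by simp
  qed
  show ?thesis
  proof (rule XB_mono[OF XB_add[OF XB_bil[OF x f mm m(1)] XB_bil[OF p x m(2) mm]]])
    show "nrm (\<lambda>k. bil b f f k - bil b p p k) \<in> borel_measurable borel" by measurable
    fix k
    show "nrm (\<lambda>k. bil b f f k - bil b p p k) k \<le> nrm (bil b (\<lambda>k. f k - p k) f) k + nrm (bil b p (\<lambda>k. f k - p k)) k"
      unfolding eq by (rule ennreal_norm_triangle)
  qed (simp_all add: mult_ac)
qed

text \<open>
  The exponential weight \<open>exp (\<gamma> * s)\<close> gains the factor \<open>1 / \<gamma>\<close> from the time integral; a large \<open>\<gamma>\<close> makes
  the iteration a contraction on all of \<open>[0, \<infinity>)\<close>.
\<close>

lemma XB_duhamel_diff:
  assumes t: "0 \<le> t" and Q [measurable]: "joint_meas Q" "joint_meas R"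
    and bQ: "\<And>s. 0 \<le> s \<Longrightarrow> XB (nrm (Q s)) m m" and bR: "\<And>s. 0 \<le> s \<Longrightarrow> XB (nrm (R s)) m m"
    and D: "\<And>s. 0 \<le> s \<Longrightarrow> XB (nrm (\<lambda>k. Q s k - R s k)) (x * exp (\<gamma> * s)) (x * exp (\<gamma> * s))"
    and \<gamma>: "0 < \<gamma>" and x: "0 \<le> x" and [measurable]: "g \<in> borel_measurable borel"
  shows "XB (nrm (\<lambda>k. duhamel g Q t k - duhamel g R t k)) (x / \<gamma> * exp (\<gamma> * t)) (x / \<gamma> * exp (\<gamma> * t))"
proof -
  have I: "XB (\<lambda>k. \<integral>\<^sup>+s\<in>{0..t}. nrm (\<lambda>k. Q s k - R s k) k \<partial>lborel) (x / \<gamma> * exp (\<gamma> * t)) (x / \<gamma> * exp (\<gamma> * t))"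
    by (rule XB_time_integral[OF _ _ D exp_time_integral[OF t \<gamma> x]]) (use x \<gamma> in auto)
  show ?thesis
  proof (rule XB_mono[OF I order_refl order_refl])
    have [measurable]: "joint_meas (duhamel g Q)" "joint_meas (duhamel g R)" by (rule joint_meas_duhamel; measurable)+
    show "nrm (\<lambda>k. duhamel g Q t k - duhamel g R t k) \<in> borel_measurable borel" by measurable
    fix k
    have n: "norm (S s k) \<le> m" if "0 \<le> s" "XB (nrm (S s)) m m" for S :: "real \<Rightarrow> real \<Rightarrow> complex" and s
      using XBD(4)[OF that(2), of k] XBD(2)[OF that(2)] by simp
    have nQ: "norm (Q s k) \<le> m" and nR: "norm (R s k) \<le> m" if "0 \<le> s" "s \<le> t" for s
      by (rule n[where S=Q, OF that(1) bQ[OF that(1)]], rule n[where S=R, OF that(1) bR[OF that(1)]])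
    note iQ = set_integrable_bounded[where Q=Q and k=k, OF Q(1) nQ]
      and iR = set_integrable_bounded[where Q=R and k=k, OF Q(2) nR]
    have "(LINT s:{0..t}|lborel. exp (of_real (t - s) * symbol d k) * (Q s k - R s k))
        = duhamel g Q t k - duhamel g R t k"
      unfolding right_diff_distrib duhamel_def
      by (subst set_integral_diff(2)[OF iQ iR]) (assumption+, simp)
    then have "duhamel g Q t k - duhamel g R t k
        = (LINT s:{0..t}|lborel. exp (of_real (t - s) * symbol d k) * (Q s k - R s k))" by (rule sym)
    then show "nrm (\<lambda>k. duhamel g Q t k - duhamel g R t k) k \<le> (\<integral>\<^sup>+s\<in>{0..t}. nrm (\<lambda>k. Q s k - R s k) k \<partial>lborel)"
      using norm_duhamel_le[OF t, of k "\<lambda>s k. Q s k - R s k"] by simp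
  qed
qed

end

section \<open>Iteration for small data\<close>

locale small_data = bounded_kernel +
  fixes g :: "real \<Rightarrow> complex" and E M :: real
  assumes g_meas [measurable]: "g \<in> borel_measurable borel" and g: "XB (nrm g) E E"
    and M_def: "M = 2 * heat_const d * E" and M_le_1: "M \<le> 1" and M_small: "growth * M \<le> 1 / 2"
begin

primrec iterate :: "nat \<Rightarrow> real \<Rightarrow> real \<Rightarrow> complex" where
  "iterate 0 = (\<lambda>t k. 0)"
| "iterate (Suc n) = duhamel g (\<lambda>s. bil b (iterate n s) (iterate n s))"

abbreviation forcing :: "nat \<Rightarrow> real \<Rightarrow> real \<Rightarrow> complex" where
  "forcing n \<equiv> (\<lambda>s. bil b (iterate n s) (iterate n s))"

lemma E_nonneg: "0 \<le> E" using g by (rule XBD(2))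

lemma M_nonneg: "0 \<le> M"
  using E_nonneg heat_const_ge_1[OF d] by (simp add: M_def)

lemma bnd_forcing:
  assumes "bnd f M"
  shows "joint_meas (\<lambda>s. bil b (f s) (f s))"
    and "0 \<le> s \<Longrightarrow> XB (nrm (bil b (f s) (f s))) (\<beta> * M\<^sup>2 * rho s) (\<beta> * M\<^sup>2 * (rho s)\<^sup>2)"
    and "0 \<le> s \<Longrightarrow> XB (nrm (bil b (f s) (f s))) (\<beta> * M\<^sup>2) (\<beta> * M\<^sup>2)"
    and "0 \<le> s \<Longrightarrow> XB (nrm (f s)) M M"
proof -
  have [measurable]: "joint_meas f" using assms by (simp add: bnd_def)
  show "joint_meas (\<lambda>s. bil b (f s) (f s))" by (rule joint_meas_bil) measurable
  assume s: "0 \<le> s"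
  have f: "XB (nrm (f s)) M (M * rho s)" using assms s by (simp add: bnd_def)
  have m: "f s \<in> borel_measurable borel" by measurable
  show *: "XB (nrm (bil b (f s) (f s))) (\<beta> * M\<^sup>2 * rho s) (\<beta> * M\<^sup>2 * (rho s)\<^sup>2)"
    using XB_bil[OF f f m m] by (simp add: power2_eq_square mult_ac)
  have r: "0 \<le> rho s" "rho s \<le> 1" "(rho s)\<^sup>2 \<le> 1" using rho_bounds[OF s] by (auto simp: power_le_one)
  show "XB (nrm (bil b (f s) (f s))) (\<beta> * M\<^sup>2) (\<beta> * M\<^sup>2)"
    by (rule XB_weaken[OF *]) (use r \<beta>_nonneg in \<open>auto intro!: mult_left_le\<close>)
  show "XB (nrm (f s)) M M"
    by (rule XB_weaken[OF f]) (use r M_nonneg in \<open>auto intro!: mult_left_le\<close>)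
qed

lemma iterate_step:
  assumes f: "bnd f M" and XBI: "\<And>t. 0 \<le> t \<Longrightarrow>
      XB (nrm (\<lambda>k. LINT s:{0..t}|lborel. exp (of_real (t - s) * symbol d k) * bil b (f s) (f s) k))
        (growth * M\<^sup>2) (growth * M\<^sup>2 * rho t)"
  shows "bnd (duhamel g (\<lambda>s. bil b (f s) (f s))) M"
  unfolding bnd_def
proof (intro conjI allI impI)
  show j: "joint_meas (duhamel g (\<lambda>s. bil b (f s) (f s)))"
    by (rule joint_meas_duhamel[OF g_meas bnd_forcing(1)[OF f]])
  fix t :: real assume t: "0 \<le> t"
  let ?I = "\<lambda>k. LINT s:{0..t}|lborel. exp (of_real (t - s) * symbol d k) * bil b (f s) (f s) k"
  have r: "0 < rho t" using rho_bounds[OF t] by simp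
  have gM: "growth * M\<^sup>2 \<le> M / 2"
    using mult_right_mono[OF M_small M_nonneg] by (simp add: power2_eq_square)
  have EM: "E \<le> M / 2" "heat_const d * E = M / 2"
    using mult_right_mono[OF heat_const_ge_1[OF d] E_nonneg] by (simp_all add: M_def)
  show "XB (nrm (duhamel g (\<lambda>s. bil b (f s) (f s)) t)) M (M * rho t)"
  proof (rule XB_mono[OF XB_add[OF XB_heat[OF g t d] XBI[OF t]]])
    show "E + growth * M\<^sup>2 \<le> M" using gM EM by simp
    have "heat_const d * E * rho t + growth * M\<^sup>2 * rho t \<le> M / 2 * rho t + M / 2 * rho t"
      unfolding EM(2) using gM r by (intro add_mono mult_right_mono) auto
    then show "heat_const d * E * rho t + growth * M\<^sup>2 * rho t \<le> M * rho t" by simp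
    note [measurable] = j
    show "nrm (duhamel g (\<lambda>s. bil b (f s) (f s)) t) \<in> borel_measurable borel" by measurable
    fix k
    have "nrm (duhamel g (\<lambda>s. bil b (f s) (f s)) t) k \<le> ennreal (norm (exp (of_real t * symbol d k) * g k)) + nrm ?I k"
      unfolding duhamel_def by (rule ennreal_norm_triangle)
    also have "ennreal (norm (exp (of_real t * symbol d k) * g k)) = ennreal (exp (- (t * d * k\<^sup>2))) * nrm g k"
      unfolding norm_mult norm_exp_symbol by (rule ennreal_mult) auto
    finally show "nrm (duhamel g (\<lambda>s. bil b (f s) (f s)) t) k \<le> ennreal (exp (- (t * d * k\<^sup>2))) * nrm g k + nrm ?I k" .
  qed
qed

text \<open>
  The bound does not deteriorate along the iteration because the forcing of an iterate is quadratic in its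
  predecessor, and so is the forcing of that predecessor in turn: two integrations by parts are available
  at every stage. The truncated subtraction is harmless, since the iterate with index 0 vanishes and so
  does its forcing.
\<close>

lemma iterate_properties:
  "bnd (iterate n) M \<and> evolves d (iterate n) (forcing (n - 1)) \<and> dominated (iterate n)"
proof (induction n rule: less_induct)
  case (less n)
  have zero: "XB (\<lambda>k. 0) a a'" if "0 \<le> a" "0 \<le> a'" for a a' using that by (simp add: XB_def)
  show ?case
  proof (cases n)
    case 0
    have "bnd (iterate 0) M"
      unfolding bnd_def using M_nonneg
      by (auto intro!: zero mult_nonneg_nonneg order.strict_implies_order[OF rho_bounds(1)])
    moreover have "evolves d (iterate 0) (forcing 0)"
      by (simp add: evolves_def bil_def)
    moreover have "dominated (iterate 0)"
      unfolding dominated_def by (intro allI impI exI[of _ "\<lambda>k. 0"] exI[of _ 0]) (simp add: zero)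
    ultimately show ?thesis using 0 by simp
  next
    case (Suc m)
    have m: "bnd (iterate m) M" "evolves d (iterate m) (forcing (m - 1))" "dominated (iterate m)"
      using less[of m] Suc by auto
    have "m - 1 < n" "m - 1 - 1 < n" using Suc by auto
    then have m1: "bnd (iterate (m - 1)) M" "evolves d (iterate (m - 1)) (forcing (m - 1 - 1))"
      and m2: "bnd (iterate (m - 1 - 1)) M" using less by blast+
    have "bnd (duhamel g (forcing m)) M"
    proof (rule iterate_step[OF m(1)])
      fix t :: real assume t: "0 \<le> t"
      show "XB (nrm (\<lambda>k. LINT s:{0..t}|lborel. exp (of_real (t - s) * symbol d k) * forcing m s k))
        (growth * M\<^sup>2) (growth * M\<^sup>2 * rho t)"
        by (rule quadratic_duhamel_XB[OF t m1(2) m(2) refl m1(1) m(1) bnd_forcing(1)[OF m2]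
              bnd_forcing(2)[OF m2] M_nonneg M_le_1])
    qed
    moreover have "evolves d (duhamel g (forcing m)) (forcing m)"
    proof (rule evolves_duhamel)
      have "continuous_on {0..} (\<lambda>t. iterate m t k)" for k
        using m(2) unfolding evolves_def
        by (intro continuous_on_vector_derivative[of _ _ "\<lambda>t. symbol d k * iterate m t k + forcing (m - 1) t k"]) auto
      then show "continuous_on {0..} (\<lambda>t. forcing m t k)" for k
        using m(1) by (intro continuous_bil[OF _ m(3)]) (auto simp: bnd_def)
    qed
    moreover have "dominated (duhamel g (forcing m))"
      by (rule dominated_duhamel[OF g bnd_forcing(1)[OF m(1)] bnd_forcing(3)[OF m(1)]])
        (use \<beta>_nonneg in auto)
    ultimately show ?thesis unfolding Suc by simp
  qed
qed

lemma bnd_iterate: "bnd (iterate n) M" and evolves_iterate: "evolves d (iterate n) (forcing (n - 1))"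
  using iterate_properties by auto

lemma joint_meas_iterate [measurable]: "joint_meas (iterate n)"
  using bnd_iterate by (simp add: bnd_def)

definition rate :: real where "rate = 4 * \<beta> + 1"

lemma rate_pos: "0 < rate" using \<beta>_nonneg by (simp add: rate_def)

text \<open>
  The forcing is Lipschitz with constant \<open>2 \<beta> M\<close> on the ball of radius \<open>M\<close>, and the weight
  \<open>exp (rate * t)\<close> turns that constant into \<open>2 \<beta> M / rate\<close>, which is at most 1/2.
\<close>

lemma iterate_diff:
  assumes t: "0 \<le> t"
  shows "XB (nrm (\<lambda>k. iterate (Suc n) t k - iterate n t k)) (M * (1/2)^n * exp (rate * t)) (M * (1/2)^n * exp (rate * t))"
  using t
proof (induction n arbitrary: t)
  case 0
  have e: "1 \<le> exp (rate * t)" using rate_pos 0 by simp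
  have "XB (nrm (iterate 1 t)) M M" by (rule bnd_forcing(4)[OF bnd_iterate 0])
  then have "XB (nrm (iterate 1 t)) (M * exp (rate * t)) (M * exp (rate * t))"
    by (rule XB_weaken) (use mult_left_mono[OF e M_nonneg] in auto)
  then show ?case by simp
next
  case (Suc n)
  let ?x = "2 * \<beta> * M * (M * (1/2)^n)"
  have D: "XB (nrm (\<lambda>k. iterate (Suc (Suc n)) t k - iterate (Suc n) t k)) (?x / rate * exp (rate * t)) (?x / rate * exp (rate * t))"
    unfolding iterate.simps(2)
  proof (rule XB_duhamel_diff[OF Suc.prems])
    fix s :: real assume s: "0 \<le> s"
    have "XB (nrm (\<lambda>k. forcing (Suc n) s k - forcing n s k)) (2 * \<beta> * M * (M * (1/2)^n * exp (rate * s))) (2 * \<beta> * M * (M * (1/2)^n * exp (rate * s)))"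
      by (rule XB_bil_diff[OF Suc.IH[OF s] bnd_forcing(4)[OF bnd_iterate s] bnd_forcing(4)[OF bnd_iterate s]]) measurable
    then show "XB (nrm (\<lambda>k. bil b (duhamel g (forcing n) s) (duhamel g (forcing n) s) k - bil b (iterate n s) (iterate n s) k))
        (?x * exp (rate * s)) (?x * exp (rate * s))"
      by (simp add: mult.assoc)
    show "XB (nrm (bil b (duhamel g (forcing n) s) (duhamel g (forcing n) s))) (\<beta> * M\<^sup>2) (\<beta> * M\<^sup>2)"
      using bnd_forcing(3)[OF bnd_iterate[of "Suc n"] s] by simp
    show "XB (nrm (forcing n s)) (\<beta> * M\<^sup>2) (\<beta> * M\<^sup>2)"
      by (rule bnd_forcing(3)[OF bnd_iterate s])
  next
    show "joint_meas (\<lambda>s. bil b (duhamel g (forcing n) s) (duhamel g (forcing n) s))"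
      using bnd_forcing(1)[OF bnd_iterate[of "Suc n"]] by simp
    show "joint_meas (forcing n)" by (rule bnd_forcing(1)[OF bnd_iterate])
  qed (use rate_pos M_nonneg \<beta>_nonneg in auto)
  have le: "?x / rate * exp (rate * t) \<le> M * (1/2)^Suc n * exp (rate * t)"
  proof (rule mult_right_mono)
    have "2 * \<beta> * M \<le> rate / 2"
      using mult_left_mono[OF M_le_1, of "2 * \<beta>"] \<beta>_nonneg by (simp add: rate_def)
    then have "2 * \<beta> * M * (M * (1/2)^n) \<le> rate / 2 * (M * (1/2)^n)"
      using M_nonneg by (intro mult_right_mono) auto
    then show "?x / rate \<le> M * (1/2)^Suc n"
      using rate_pos by (simp add: field_simps)
  qed simp
  show ?case by (rule XB_weaken[OF D le le])
qed

text \<open>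
  The sharper constant \<open>2 * (1/2)^n - 2 * (1/2)^(n + m)\<close> in the proof is the partial geometric sum that
  makes the induction close.
\<close>

lemma iterate_diff_far:
  assumes t: "0 \<le> t"
  shows "XB (nrm (\<lambda>k. iterate (n + m) t k - iterate n t k)) (2 * M * (1/2)^n * exp (rate * t)) (2 * M * (1/2)^n * exp (rate * t))"
proof -
  let ?c = "\<lambda>m. M * (2 * (1/2)^n - 2 * (1/2)^(n + m)) * exp (rate * t)"
  have "XB (nrm (\<lambda>k. iterate (n + m) t k - iterate n t k)) (?c m) (?c m)"
  proof (induction m)
    case 0 show ?case by (simp add: XB_def)
  next
    case (Suc m)
    have eq: "M * (1/2)^(n + m) * exp (rate * t) + ?c m = ?c (Suc m)" by (simp add: algebra_simps)
    show ?case
    proof (rule XB_mono[OF XB_add[OF iterate_diff[OF t, of "n + m"] Suc]])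
      show "nrm (\<lambda>k. iterate (n + Suc m) t k - iterate n t k) \<in> borel_measurable borel" by measurable
      show "nrm (\<lambda>k. iterate (n + Suc m) t k - iterate n t k) k
        \<le> nrm (\<lambda>k. iterate (Suc (n + m)) t k - iterate (n + m) t k) k + nrm (\<lambda>k. iterate (n + m) t k - iterate n t k) k" for k
        using ennreal_norm_triangle[of "iterate (Suc (n + m)) t k - iterate (n + m) t k" "iterate (n + m) t k - iterate n t k"]
        by (simp del: iterate.simps)
    qed (simp_all add: eq)
  qed
  then show ?thesis
  proof (rule XB_weaken)
    have "M * (2 * (1/2)^n - 2 * (1/2)^(n + m)) \<le> 2 * M * (1/2)^n"
      using M_nonneg by (simp add: algebra_simps)
    then show "?c m \<le> 2 * M * (1/2)^n * exp (rate * t)" by (rule mult_right_mono) simp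
    then show "?c m \<le> 2 * M * (1/2)^n * exp (rate * t)" .
  qed
qed

definition solution :: "real \<Rightarrow> real \<Rightarrow> complex" where
  "solution t k = lim (\<lambda>n. iterate n t k)"

lemma joint_meas_solution [measurable]: "joint_meas solution"
  unfolding solution_def case_prod_beta by (rule borel_measurable_lim_metric) measurable

lemma iterate_tendsto:
  assumes t: "0 \<le> t"
  shows "(\<lambda>n. iterate n t k) \<longlonglongrightarrow> solution t k"
proof -
  define c where "c = 2 * M * exp (rate * t)"
  have c: "0 \<le> c" using M_nonneg by (simp add: c_def)
  have bound: "norm (iterate (n + m) t k - iterate n t k) \<le> c * (1/2)^n" for n m
    using XBD(4)[OF iterate_diff_far[OF t, of n m], of k] c M_nonneg
    by (simp add: c_def mult_ac)
  have "Cauchy (\<lambda>n. iterate n t k)"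
  proof (rule CauchyI')
    fix e :: real assume e: "0 < e"
    have "(\<lambda>n. c * (1/2)^n) \<longlonglongrightarrow> c * 0" by (intro tendsto_intros LIMSEQ_realpow_zero) auto
    then have "eventually (\<lambda>n. c * (1/2)^n < e) sequentially" using e by (intro order_tendstoD(2)) auto
    then obtain N where N: "\<And>n. n \<ge> N \<Longrightarrow> c * (1/2)^n < e" by (auto simp: eventually_sequentially)
    show "\<exists>N. \<forall>m\<ge>N. \<forall>n>m. dist (iterate m t k) (iterate n t k) < e"
      unfolding dist_norm
    proof (intro exI allI impI)
      fix m n assume mn: "N \<le> m" "m < n"
      have "norm (iterate m t k - iterate n t k) = norm (iterate (m + (n - m)) t k - iterate m t k)"
        using mn by (simp add: norm_minus_commute)
      also have "\<dots> \<le> c * (1/2)^m" by (rule bound)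
      also have "\<dots> < e" by (rule N[OF mn(1)])
      finally show "norm (iterate m t k - iterate n t k) < e" .
    qed
  qed
  then show ?thesis unfolding solution_def by (simp add: Cauchy_convergent_iff convergent_LIMSEQ_iff)
qed

lemma bnd_solution: "bnd solution M"
  unfolding bnd_def
proof (intro conjI allI impI joint_meas_solution)
  fix s :: real assume s: "0 \<le> s"
  show "XB (nrm (solution s)) M (M * rho s)"
    by (rule XB_limit[OF _ iterate_tendsto[OF s]]) (use bnd_iterate s in \<open>auto simp: bnd_def\<close>)
qed

lemma solution_iterate_diff:
  assumes t: "0 \<le> t"
  shows "XB (nrm (\<lambda>k. solution t k - iterate n t k)) (2 * M * (1/2)^n * exp (rate * t)) (2 * M * (1/2)^n * exp (rate * t))"
proof (rule XB_limit[OF iterate_diff_far[OF t]])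
  fix k
  have "(\<lambda>m. iterate (m + n) t k) \<longlonglongrightarrow> solution t k"
    by (rule LIMSEQ_ignore_initial_segment[OF iterate_tendsto[OF t]])
  then show "(\<lambda>m. iterate (n + m) t k - iterate n t k) \<longlonglongrightarrow> solution t k - iterate n t k"
    by (intro tendsto_intros) (simp add: add.commute)
qed measurable

text \<open>
  The forcing of the iterates converges to the forcing of the limit, locally uniformly in time, so that
  Duhamel's formula passes to the limit at every time and every frequency.
\<close>

lemma solution_duhamel:
  assumes t: "0 \<le> t"
  shows "solution t k = duhamel g (\<lambda>s. bil b (solution s) (solution s)) t k"
proof -
  let ?S = "\<lambda>s. bil b (solution s) (solution s)"
  have "(\<lambda>n. duhamel g ?S t k - duhamel g (forcing n) t k) \<longlonglongrightarrow> 0"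
  proof (rule Lim_null_comparison)
    let ?x = "\<lambda>n. 2 * \<beta> * M * (2 * M * (1/2)^n)"
    show "(\<lambda>n. ?x n / rate * exp (rate * t)) \<longlonglongrightarrow> 0"
    proof -
      have "(\<lambda>n. 2 * \<beta> * M * (2 * M * (1/2)^n) / rate * exp (rate * t)) \<longlonglongrightarrow> 2 * \<beta> * M * (2 * M * 0) / rate * exp (rate * t)"
        by (intro tendsto_intros LIMSEQ_realpow_zero) (use rate_pos in auto)
      then show ?thesis by simp
    qed
    show "\<forall>\<^sub>F n in sequentially. norm (duhamel g ?S t k - duhamel g (forcing n) t k) \<le> ?x n / rate * exp (rate * t)"
    proof (rule always_eventually, rule allI)
      fix n
      have "XB (nrm (\<lambda>k. duhamel g ?S t k - duhamel g (forcing n) t k)) (?x n / rate * exp (rate * t)) (?x n / rate * exp (rate * t))"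
      proof (rule XB_duhamel_diff[OF t bnd_forcing(1)[OF bnd_solution] bnd_forcing(1)[OF bnd_iterate]
            bnd_forcing(3)[OF bnd_solution] bnd_forcing(3)[OF bnd_iterate]])
        fix s :: real assume s: "0 \<le> s"
        show "XB (nrm (\<lambda>k. ?S s k - forcing n s k)) (?x n * exp (rate * s)) (?x n * exp (rate * s))"
          using XB_bil_diff[OF solution_iterate_diff[OF s, of n] bnd_forcing(4)[OF bnd_solution s] bnd_forcing(4)[OF bnd_iterate s]]
          by (simp add: mult.assoc)
      qed (use rate_pos M_nonneg \<beta>_nonneg in auto)
      from XBD(4)[OF this, of k] XBD(2)[OF this]
      show "norm (duhamel g ?S t k - duhamel g (forcing n) t k) \<le> ?x n / rate * exp (rate * t)" by simp
    qed
  qed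
  then have "(\<lambda>n. duhamel g ?S t k - iterate (Suc n) t k) \<longlonglongrightarrow> 0" by simp
  moreover have "(\<lambda>n. duhamel g ?S t k - iterate (Suc n) t k) \<longlonglongrightarrow> duhamel g ?S t k - solution t k"
    by (intro tendsto_intros LIMSEQ_Suc[OF iterate_tendsto[OF t]])
  ultimately show ?thesis using LIMSEQ_unique by fastforce
qed

lemma dominated_solution: "dominated solution"
proof -
  have "dominated (duhamel g (\<lambda>s. bil b (solution s) (solution s)))"
    by (rule dominated_duhamel[OF g bnd_forcing(1)[OF bnd_solution] bnd_forcing(3)[OF bnd_solution]])
      (use \<beta>_nonneg in auto)
  then show ?thesis unfolding dominated_def using solution_duhamel by simp
qed

lemma continuous_solution: "continuous_on {0..T} (\<lambda>t. solution t k)"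
proof (rule uniform_limit_theorem[where F=sequentially and f="\<lambda>n t. iterate n t k"])
  show "\<forall>\<^sub>F n in sequentially. continuous_on {0..T} (\<lambda>t. iterate n t k)"
    by (intro always_eventually allI evolvesD(3)[OF evolves_iterate])
  show "uniform_limit {0..T} (\<lambda>n t. iterate n t k) (\<lambda>t. solution t k) sequentially"
  proof (rule uniform_limitI)
    fix e :: real assume e: "0 < e"
    have "(\<lambda>n. 2 * M * (1/2)^n * exp (rate * T)) \<longlonglongrightarrow> 2 * M * 0 * exp (rate * T)"
      by (intro tendsto_intros LIMSEQ_realpow_zero) auto
    then have "eventually (\<lambda>n. 2 * M * (1/2)^n * exp (rate * T) < e) sequentially"
      using e by (intro order_tendstoD(2)) auto
    then show "\<forall>\<^sub>F n in sequentially. \<forall>t\<in>{0..T}. dist (iterate n t k) (solution t k) < e"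
    proof eventually_elim
      case (elim n)
      show ?case
      proof
        fix t assume t: "t \<in> {0..T}"
        then have t0: "0 \<le> t" by simp
        have "dist (iterate n t k) (solution t k) = norm (solution t k - iterate n t k)"
          by (simp add: dist_norm norm_minus_commute)
        also have "\<dots> \<le> 2 * M * (1/2)^n * exp (rate * t)"
          using XBD(4)[OF solution_iterate_diff[OF t0, of n], of k] M_nonneg by simp
        also have "\<dots> \<le> 2 * M * (1/2)^n * exp (rate * T)"
          using t M_nonneg rate_pos by (intro mult_left_mono) auto
        also have "\<dots> < e" by (rule elim)
        finally show "dist (iterate n t k) (solution t k) < e" .
      qed
    qed
  qed
qed simp

end

section \<open>Uniqueness among square integrable solutions\<close>

text \<open>
  The counterpart of \<open>continuous_L2\<close> on the Fourier side, to which the isometry carries it.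
\<close>

definition L2_continuous :: "(real \<Rightarrow> real \<Rightarrow> complex) \<Rightarrow> bool" where
  "L2_continuous v \<longleftrightarrow> (\<forall>t\<ge>0. v t \<in> L2_space) \<and>
     (\<forall>t\<ge>0. ((\<lambda>s. L2_norm (\<lambda>k. v s k - v t k)) \<longlongrightarrow> 0) (at t within {0..}))"

lemma L2_continuous_norm:
  assumes v: "L2_continuous v"
  shows "continuous_on {0..} (\<lambda>t. L2_norm (v t))"
  unfolding continuous_on_def
proof
  fix t :: real assume t: "t \<in> {0..}"
  have "((\<lambda>s. L2_norm (v s) - L2_norm (v t)) \<longlongrightarrow> 0) (at t within {0..})"
  proof (rule Lim_null_comparison)
    show "((\<lambda>s. L2_norm (\<lambda>k. v s k - v t k)) \<longlongrightarrow> 0) (at t within {0..})"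
      using v t by (simp add: L2_continuous_def)
    have "\<forall>\<^sub>F s in at t within {0..}. s \<in> {0..}" by (simp add: eventually_at_filter)
    then show "\<forall>\<^sub>F s in at t within {0..}. norm (L2_norm (v s) - L2_norm (v t)) \<le> L2_norm (\<lambda>k. v s k - v t k)"
    proof eventually_elim
      case (elim s)
      then show ?case using L2_norm_diff_triangle[of "v s" "v t"] v t by (simp add: L2_continuous_def)
    qed
  qed
  then show "((\<lambda>s. L2_norm (v s)) \<longlongrightarrow> L2_norm (v t)) (at t within {0..})" by (simp add: LIM_zero_iff)
qed

lemma L2_continuous_bounded:
  assumes v: "L2_continuous v"
  obtains m where "\<And>t. 0 \<le> t \<Longrightarrow> t \<le> T \<Longrightarrow> L2_norm (v t) \<le> m" "0 \<le> m"
proof -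
  have "continuous_on {0..T} (\<lambda>t. L2_norm (v t))"
    by (rule continuous_on_subset[OF L2_continuous_norm[OF v]]) auto
  then have "bounded ((\<lambda>t. L2_norm (v t)) ` {0..T})"
    by (intro compact_imp_bounded compact_continuous_image) auto
  then obtain m where m: "\<And>x. x \<in> (\<lambda>t. L2_norm (v t)) ` {0..T} \<Longrightarrow> norm x \<le> m"
    unfolding bounded_iff by blast
  have "L2_norm (v t) \<le> max m 0" if "0 \<le> t" "t \<le> T" for t
    using m[of "L2_norm (v t)"] that by force
  then show ?thesis by (rule that) auto
qed

lemma L2_reflect:
  assumes "f \<in> L2_space" shows "(\<lambda>x. f (k - x)) \<in> L2_space" "L2_norm (\<lambda>x. f (k - x)) = L2_norm f"
proof -
  note [measurable] = L2_spaceD(1)[OF assms]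
  have "(\<integral>\<^sup>+x. ennreal ((norm (f (k - x)))\<^sup>2) \<partial>lborel) = (\<integral>\<^sup>+x. ennreal ((norm (f x))\<^sup>2) \<partial>lborel)"
    by (rule nn_integral_reflect) measurable
  then have eq: "(\<integral>\<^sup>+x. ennreal ((norm (f (k - x)))\<^sup>2) \<partial>lborel) = ennreal ((L2_norm f)\<^sup>2)"
    by (simp add: nn_integral_L2 assms)
  then show *: "(\<lambda>x. f (k - x)) \<in> L2_space" by (intro L2_spaceI) auto
  show "L2_norm (\<lambda>x. f (k - x)) = L2_norm f"
    using eq unfolding nn_integral_L2[OF *] by (simp add: power2_eq_iff_nonneg)
qed

lemma heat_exp_time_integral:
  assumes "0 \<le> t" "0 < \<gamma>" "0 \<le> a"
  shows "(\<integral>\<^sup>+s\<in>{0..t}. ennreal (exp (- ((t - s) * a)) * exp (\<gamma> * s)) \<partial>lborel) \<le> ennreal (exp (\<gamma> * t) / (\<gamma> + a))"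
proof -
  have p: "0 < \<gamma> + a" using assms by simp
  have "(\<integral>\<^sup>+s. ennreal (exp (- ((t - s) * a)) * exp (\<gamma> * s)) * indicator {0..t} s \<partial>lborel)
      = ennreal (exp (- ((t - t) * a) + \<gamma> * t) / (\<gamma> + a) - exp (- ((t - 0) * a) + \<gamma> * 0) / (\<gamma> + a))"
  proof (rule nn_integral_FTC_Icc[OF _ _ _ assms(1)])
    fix s
    have "((\<lambda>s. exp (- ((t - s) * a) + \<gamma> * s) / (\<gamma> + a)) has_real_derivative
        exp (- ((t - s) * a) + \<gamma> * s)) (at s)"
      using p by (auto intro!: derivative_eq_intros)
    also have "exp (- ((t - s) * a) + \<gamma> * s) = exp (- ((t - s) * a)) * exp (\<gamma> * s)" by (rule exp_add)
    finally show "((\<lambda>s. exp (- ((t - s) * a) + \<gamma> * s) / (\<gamma> + a)) has_real_derivative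
        exp (- ((t - s) * a)) * exp (\<gamma> * s)) (at s)" .
  qed auto
  also have "\<dots> \<le> ennreal (exp (\<gamma> * t) / (\<gamma> + a))"
    using p by (intro ennreal_leI) simp
  finally show ?thesis .
qed

text \<open>
  The square of the \<open>L\<^sup>2\<close> norm of \<open>1 / (\<gamma> + d k\<^sup>2)\<close>; its decay in \<open>\<gamma>\<close> makes the uniqueness
  argument contract.
\<close>

lemma resolvent_integral:
  assumes d: "0 < d"
  obtains J where "0 \<le> J" "\<And>\<gamma>. 1 \<le> \<gamma> \<Longrightarrow> (\<integral>\<^sup>+k. ennreal ((1 / (\<gamma> + d * k\<^sup>2))\<^sup>2) \<partial>lborel) \<le> ennreal (J / \<gamma>)"
proof -
  have "integrable lborel (\<lambda>x::real. inverse (1 + x\<^sup>2))"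
    using integrable_inverse_1_plus_square by (simp add: set_integrable_def)
  from lborel_integrable_real_affine[OF this, of "sqrt d" 0]
  have i: "integrable lborel (\<lambda>k. 1 / (1 + d * k\<^sup>2))"
    using d by (simp add: power_mult_distrib inverse_eq_divide)
  define J where "J = (LINT k|lborel. 1 / (1 + d * k\<^sup>2))"
  have J: "(\<integral>\<^sup>+k. ennreal (1 / (1 + d * k\<^sup>2)) \<partial>lborel) = ennreal J"
    unfolding J_def by (rule nn_integral_eq_integral[OF i]) (use d in auto)
  have J0: "0 \<le> J" unfolding J_def using d by (intro Bochner_Integration.integral_nonneg) auto
  have "(\<integral>\<^sup>+k. ennreal ((1 / (\<gamma> + d * k\<^sup>2))\<^sup>2) \<partial>lborel) \<le> ennreal (J / \<gamma>)" if \<gamma>: "1 \<le> \<gamma>" for \<gamma>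
  proof -
    have "(\<integral>\<^sup>+k. ennreal ((1 / (\<gamma> + d * k\<^sup>2))\<^sup>2) \<partial>lborel) \<le> (\<integral>\<^sup>+k. ennreal (1 / \<gamma>) * ennreal (1 / (1 + d * k\<^sup>2)) \<partial>lborel)"
    proof (rule nn_integral_mono)
      fix k
      have q: "0 \<le> d * k\<^sup>2" using d by simp
      have "1 / (\<gamma> + d * k\<^sup>2) \<le> 1 / \<gamma>" "1 / (\<gamma> + d * k\<^sup>2) \<le> 1 / (1 + d * k\<^sup>2)"
        using q \<gamma> by (intro divide_left_mono; simp)+
      then have "(1 / (\<gamma> + d * k\<^sup>2))\<^sup>2 \<le> 1 / \<gamma> * (1 / (1 + d * k\<^sup>2))"
        unfolding power2_eq_square[of "1 / (\<gamma> + d * k\<^sup>2)"] using q \<gamma> by (intro mult_mono) auto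
      then show "ennreal ((1 / (\<gamma> + d * k\<^sup>2))\<^sup>2) \<le> ennreal (1 / \<gamma>) * ennreal (1 / (1 + d * k\<^sup>2))"
        using q \<gamma> by (subst ennreal_mult[symmetric]) (auto intro!: ennreal_leI)
    qed
    also have "\<dots> = ennreal (1 / \<gamma>) * ennreal J" by (subst nn_integral_cmult) (auto simp: J)
    also have "\<dots> = ennreal (J / \<gamma>)" using \<gamma> J0 by (simp add: ennreal_mult[symmetric])
    finally show ?thesis .
  qed
  then show ?thesis using J0 by (rule that[rotated])
qed

context bounded_kernel
begin

lemma bil_L2:
  assumes f: "f \<in> L2_space" and h: "h \<in> L2_space"
  shows "integrable lborel (\<lambda>l. b (k, l) * f (k - l) * h l)"
    and "norm (bil b f h k) \<le> \<beta> * (L2_norm f * L2_norm h)"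
proof -
  note [measurable] = L2_spaceD(1)[OF f] L2_spaceD(1)[OF h]
  note r = L2_reflect[OF f, of k]
  have i: "integrable lborel (\<lambda>l. \<beta> * norm (f (k - l) * h l))"
    using L2_mult_integrable[OF r(1) h] by simp
  have le: "norm (b (k, l) * f (k - l) * h l) \<le> \<beta> * norm (f (k - l) * h l)" for l
    unfolding norm_mult mult.assoc by (intro mult_right_mono b_le) simp
  show *: "integrable lborel (\<lambda>l. b (k, l) * f (k - l) * h l)"
  proof (rule Bochner_Integration.integrable_bound[OF i])
    show "AE l in lborel. norm (b (k, l) * f (k - l) * h l) \<le> norm (\<beta> * norm (f (k - l) * h l))"
      using le order_trans[OF _ abs_ge_self] by auto
  qed measurable
  have "norm (bil b f h k) \<le> (LINT l|lborel. norm (b (k, l) * f (k - l) * h l))"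
    unfolding bil_def by (rule integral_norm_bound)
  also have "\<dots> \<le> (LINT l|lborel. \<beta> * norm (f (k - l) * h l))"
    by (rule integral_mono) (use * i le in auto)
  also have "\<dots> = \<beta> * (LINT l|lborel. norm (f (k - l) * h l))" by simp
  also have "\<dots> \<le> \<beta> * (L2_norm f * L2_norm h)"
    using L2_Cauchy_Schwarz(1)[OF r(1) h] \<beta>_nonneg unfolding r(2) by (intro mult_left_mono) auto
  finally show "norm (bil b f h k) \<le> \<beta> * (L2_norm f * L2_norm h)" .
qed

lemma norm_bil_diff_L2:
  assumes f: "f \<in> L2_space" and p: "p \<in> L2_space"
  shows "norm (bil b f f k - bil b p p k) \<le> \<beta> * ((L2_norm f + L2_norm p) * L2_norm (\<lambda>k. f k - p k))"
proof -
  let ?D = "\<lambda>k. f k - p k"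
  have D: "?D \<in> L2_space" by (intro L2_diff f p)
  have "bil b ?D f k + bil b p ?D k
      = (LINT l|lborel. b (k, l) * (f (k - l) - p (k - l)) * f l + b (k, l) * p (k - l) * (f l - p l))"
    unfolding bil_def
    by (rule Bochner_Integration.integral_add[symmetric]) (rule bil_L2(1)[OF D f] bil_L2(1)[OF p D])+
  also have "\<dots> = (LINT l|lborel. b (k, l) * f (k - l) * f l - b (k, l) * p (k - l) * p l)"
    by (simp add: algebra_simps)
  also have "\<dots> = bil b f f k - bil b p p k"
    unfolding bil_def by (rule Bochner_Integration.integral_diff) (rule bil_L2(1)[OF f f] bil_L2(1)[OF p p])+
  finally have "bil b f f k - bil b p p k = bil b ?D f k + bil b p ?D k" by simp
  also have "norm \<dots> \<le> norm (bil b ?D f k) + norm (bil b p ?D k)" by (rule norm_triangle_ineq)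
  also have "\<dots> \<le> \<beta> * (L2_norm ?D * L2_norm f) + \<beta> * (L2_norm p * L2_norm ?D)"
    by (intro add_mono bil_L2(2) D f p)
  finally show ?thesis by (simp add: algebra_simps)
qed

text \<open>
  By the Cauchy-Schwarz inequality the forcing is bounded in frequency for functions in
  \<open>L\<^sup>2\<close>, and it depends continuously on them; this makes the Duhamel integral of an arbitrary mild solution
  meaningful at every frequency.
\<close>

lemma continuous_bil_L2:
  assumes v: "L2_continuous v"
  shows "continuous_on {0..} (\<lambda>s. bil b (v s) (v s) k)"
  unfolding continuous_on_def
proof
  fix t :: real assume t: "t \<in> {0..}"
  have lim: "((\<lambda>s. L2_norm (\<lambda>k. v s k - v t k)) \<longlongrightarrow> 0) (at t within {0..})"
    using v t by (simp add: L2_continuous_def)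
  have lim': "((\<lambda>s. L2_norm (v s)) \<longlongrightarrow> L2_norm (v t)) (at t within {0..})"
    using L2_continuous_norm[OF v] t by (simp add: continuous_on_def)
  have "((\<lambda>s. bil b (v s) (v s) k - bil b (v t) (v t) k) \<longlongrightarrow> 0) (at t within {0..})"
  proof (rule Lim_null_comparison)
    have "((\<lambda>s. \<beta> * ((L2_norm (v s) + L2_norm (v t)) * L2_norm (\<lambda>k. v s k - v t k)))
        \<longlongrightarrow> \<beta> * ((L2_norm (v t) + L2_norm (v t)) * 0)) (at t within {0..})"
      by (intro tendsto_intros lim lim')
    then show "((\<lambda>s. \<beta> * ((L2_norm (v s) + L2_norm (v t)) * L2_norm (\<lambda>k. v s k - v t k))) \<longlongrightarrow> 0) (at t within {0..})"
      by simp
    have "\<forall>\<^sub>F s in at t within {0..}. s \<in> {0..}" by (simp add: eventually_at_filter)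
    then show "\<forall>\<^sub>F s in at t within {0..}. norm (bil b (v s) (v s) k - bil b (v t) (v t) k)
        \<le> \<beta> * ((L2_norm (v s) + L2_norm (v t)) * L2_norm (\<lambda>k. v s k - v t k))"
    proof eventually_elim
      case (elim s)
      then show ?case using v t by (intro norm_bil_diff_L2) (auto simp: L2_continuous_def)
    qed
  qed
  then show "((\<lambda>s. bil b (v s) (v s) k) \<longlongrightarrow> bil b (v t) (v t) k) (at t within {0..})" by (simp add: LIM_zero_iff)
qed

text \<open>
  Two solutions have bounded norms on \<open>[0, T]\<close>, the
  difference of their forcings is bounded in frequency by the \<open>L\<^sup>2\<close> norm of their difference, and the heat
  factor restores square integrability. If that norm is at most \<open>X exp (\<gamma> t)\<close>, then the difference at
  frequency \<open>k\<close> is at most a multiple of \<open>X exp (\<gamma> t) / (\<gamma> + d k\<^sup>2)\<close>; for large \<open>\<gamma>\<close> this halves \<open>X\<close>, and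
  iteration leaves zero.
\<close>

lemma duhamel_unique:
  assumes v: "L2_continuous v" and w: "L2_continuous w"
    and ev: "\<And>t. 0 \<le> t \<Longrightarrow> AE k in lborel. v t k = duhamel g (\<lambda>s. bil b (v s) (v s)) t k"
    and ew: "\<And>t. 0 \<le> t \<Longrightarrow> AE k in lborel. w t k = duhamel g (\<lambda>s. bil b (w s) (w s)) t k"
    and T: "0 \<le> T"
  shows "AE k in lborel. v T k = w T k"
proof -
  let ?\<omega> = "\<lambda>t. L2_norm (\<lambda>k. v t k - w t k)"
  have vL: "v t \<in> L2_space" and wL: "w t \<in> L2_space" if "0 \<le> t" for t
    using v w that by (auto simp: L2_continuous_def)
  obtain mv where mv: "\<And>t. 0 \<le> t \<Longrightarrow> t \<le> T \<Longrightarrow> L2_norm (v t) \<le> mv" "0 \<le> mv"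
    by (rule L2_continuous_bounded[OF v, where T=T]) blast
  obtain mw where mw: "\<And>t. 0 \<le> t \<Longrightarrow> t \<le> T \<Longrightarrow> L2_norm (w t) \<le> mw" "0 \<le> mw"
    by (rule L2_continuous_bounded[OF w, where T=T]) blast
  obtain J where J: "0 \<le> J" "\<And>\<gamma>. 1 \<le> \<gamma> \<Longrightarrow> (\<integral>\<^sup>+k. ennreal ((1 / (\<gamma> + d * k\<^sup>2))\<^sup>2) \<partial>lborel) \<le> ennreal (J / \<gamma>)"
    by (rule resolvent_integral[OF d]) blast
  define c where "c = \<beta> * (mv + mw)"
  have c: "0 \<le> c" using mv mw \<beta>_nonneg by (simp add: c_def)
  \<comment> \<open>Large enough for \<open>c\<^sup>2 J / \<gamma> \<le> 1/4\<close>, which is the contraction by the factor 1/2 in the norm.\<close>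
  define \<gamma> where "\<gamma> = 1 + 4 * c\<^sup>2 * J"
  have \<gamma>: "1 \<le> \<gamma>" using J by (simp add: \<gamma>_def)
  have \<gamma>': "c\<^sup>2 * (J / \<gamma>) \<le> (1/2)\<^sup>2"
    using \<gamma> by (simp add: field_simps power2_eq_square) (simp add: \<gamma>_def power2_eq_square)
  have improve: "?\<omega> t \<le> X * exp (\<gamma> * t) / 2"
    if X: "0 \<le> X" "\<And>s. 0 \<le> s \<Longrightarrow> s \<le> T \<Longrightarrow> ?\<omega> s \<le> X * exp (\<gamma> * s)" and t: "0 \<le> t" "t \<le> T" for X t
  proof (rule L2_norm_leI(2))
    have ptw: "AE k in lborel. ennreal ((norm (v t k - w t k))\<^sup>2) \<le> ennreal ((c * X * exp (\<gamma> * t))\<^sup>2) * ennreal ((1 / (\<gamma> + d * k\<^sup>2))\<^sup>2)"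
      using ev[OF t(1)] ew[OF t(1)]
    proof eventually_elim
      case (elim k)
      let ?e = "\<lambda>s. exp (of_real (t - s) * symbol d k)"
      have cv: "continuous_on {0..t} (\<lambda>s. bil b (v s) (v s) k)" and cw: "continuous_on {0..t} (\<lambda>s. bil b (w s) (w s) k)"
        by (rule continuous_on_subset[OF continuous_bil_L2[OF v]] continuous_on_subset[OF continuous_bil_L2[OF w]]; auto)+
      have iv: "set_integrable lborel {0..t} (\<lambda>s. ?e s * bil b (v s) (v s) k)"
        and iw: "set_integrable lborel {0..t} (\<lambda>s. ?e s * bil b (w s) (w s) k)"
        by (rule set_integral_eq_HK(2); intro continuous_intros cv cw)+
      have "v t k - w t k = (LINT s:{0..t}|lborel. ?e s * bil b (v s) (v s) k) - (LINT s:{0..t}|lborel. ?e s * bil b (w s) (w s) k)"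
        using elim by (simp add: duhamel_def)
      also have "\<dots> = (LINT s:{0..t}|lborel. ?e s * bil b (v s) (v s) k - ?e s * bil b (w s) (w s) k)"
        by (rule set_integral_diff(2)[OF iv iw, symmetric])
      finally have eq: "v t k - w t k = (LINT s:{0..t}|lborel. ?e s * bil b (v s) (v s) k - ?e s * bil b (w s) (w s) k)" .
      have "ennreal (norm (v t k - w t k)) \<le> (\<integral>\<^sup>+s\<in>{0..t}. ennreal (norm (?e s * bil b (v s) (v s) k - ?e s * bil b (w s) (w s) k)) \<partial>lborel)"
        unfolding eq by (rule norm_set_integral_le_nn_integral)
      also have "\<dots> \<le> (\<integral>\<^sup>+s. ennreal (c * X) * (ennreal (exp (- ((t - s) * (d * k\<^sup>2))) * exp (\<gamma> * s)) * indicator {0..t} s) \<partial>lborel)"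
      proof (rule nn_integral_mono)
        fix s
        show "ennreal (norm (?e s * bil b (v s) (v s) k - ?e s * bil b (w s) (w s) k)) * indicator {0..t} s
          \<le> ennreal (c * X) * (ennreal (exp (- ((t - s) * (d * k\<^sup>2))) * exp (\<gamma> * s)) * indicator {0..t} s)"
        proof (cases "0 \<le> s \<and> s \<le> t")
          case True
          then have s: "0 \<le> s" "s \<le> T" using t by auto
          have "norm (bil b (v s) (v s) k - bil b (w s) (w s) k) \<le> \<beta> * ((L2_norm (v s) + L2_norm (w s)) * ?\<omega> s)"
            by (rule norm_bil_diff_L2[OF vL[OF s(1)] wL[OF s(1)]])
          also have "\<dots> \<le> \<beta> * ((mv + mw) * (X * exp (\<gamma> * s)))"
            using mv mw \<beta>_nonneg s X by (intro mult_left_mono mult_mono add_mono) auto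
          finally have "norm (?e s) * norm (bil b (v s) (v s) k - bil b (w s) (w s) k)
              \<le> exp (- ((t - s) * d * k\<^sup>2)) * (\<beta> * ((mv + mw) * (X * exp (\<gamma> * s))))"
            unfolding norm_exp_symbol by (intro mult_left_mono) auto
          then have "norm (?e s * bil b (v s) (v s) k - ?e s * bil b (w s) (w s) k)
              \<le> c * X * (exp (- ((t - s) * (d * k\<^sup>2))) * exp (\<gamma> * s))"
            unfolding norm_mult[symmetric] right_diff_distrib c_def by (simp add: mult_ac)
          from ennreal_leI[OF this] show ?thesis using True c X(1) by (simp add: ennreal_mult)
        next
          case False then show ?thesis by (auto simp: indicator_def)
        qed
      qed
      also have "\<dots> = ennreal (c * X) * (\<integral>\<^sup>+s\<in>{0..t}. ennreal (exp (- ((t - s) * (d * k\<^sup>2))) * exp (\<gamma> * s)) \<partial>lborel)"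
        by (rule nn_integral_cmult) measurable
      also have "\<dots> \<le> ennreal (c * X) * ennreal (exp (\<gamma> * t) / (\<gamma> + d * k\<^sup>2))"
        using t \<gamma> d by (intro mult_left_mono heat_exp_time_integral) auto
      also have "\<dots> = ennreal (c * X * exp (\<gamma> * t) * (1 / (\<gamma> + d * k\<^sup>2)))"
        using c X(1) \<gamma> d by (subst ennreal_mult[symmetric]) auto
      finally have "norm (v t k - w t k) \<le> c * X * exp (\<gamma> * t) * (1 / (\<gamma> + d * k\<^sup>2))"
        using c X(1) \<gamma> d by (subst (asm) ennreal_le_iff) auto
      then have "(norm (v t k - w t k))\<^sup>2 \<le> (c * X * exp (\<gamma> * t) * (1 / (\<gamma> + d * k\<^sup>2)))\<^sup>2"
        by (rule power_mono) simp
      then show ?case unfolding power_mult_distrib[of _ "1 / (\<gamma> + d * k\<^sup>2)"]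
        by (subst ennreal_mult[symmetric]) (auto intro: ennreal_leI)
    qed
    have "(\<integral>\<^sup>+k. ennreal ((norm (v t k - w t k))\<^sup>2) \<partial>lborel)
        \<le> (\<integral>\<^sup>+k. ennreal ((c * X * exp (\<gamma> * t))\<^sup>2) * ennreal ((1 / (\<gamma> + d * k\<^sup>2))\<^sup>2) \<partial>lborel)"
      by (rule nn_integral_mono_AE[OF ptw])
    also have "\<dots> = ennreal ((c * X * exp (\<gamma> * t))\<^sup>2) * (\<integral>\<^sup>+k. ennreal ((1 / (\<gamma> + d * k\<^sup>2))\<^sup>2) \<partial>lborel)"
      by (rule nn_integral_cmult) measurable
    also have "\<dots> \<le> ennreal ((c * X * exp (\<gamma> * t))\<^sup>2) * ennreal (J / \<gamma>)"
      by (intro mult_left_mono J \<gamma>) simp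
    also have "\<dots> = ennreal (c\<^sup>2 * (J / \<gamma>) * (X * exp (\<gamma> * t))\<^sup>2)"
      using J \<gamma> by (subst ennreal_mult[symmetric]) (auto simp: power_mult_distrib mult_ac)
    also have "\<dots> \<le> ennreal ((1/2)\<^sup>2 * (X * exp (\<gamma> * t))\<^sup>2)"
      by (intro ennreal_leI mult_right_mono \<gamma>') simp
    also have "(1/2)\<^sup>2 * (X * exp (\<gamma> * t))\<^sup>2 = (X * exp (\<gamma> * t) / 2)\<^sup>2" by (simp add: power_divide power_mult_distrib)
    finally show "(\<integral>\<^sup>+k. ennreal ((norm (v t k - w t k))\<^sup>2) \<partial>lborel) \<le> ennreal ((X * exp (\<gamma> * t) / 2)\<^sup>2)" .
    show "(\<lambda>k. v t k - w t k) \<in> borel_measurable borel" by (rule L2_spaceD(1)[OF L2_diff[OF vL wL]]) (use t in auto)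
  qed (use X in simp)
  have small: "?\<omega> t \<le> (mv + mw) * (1/2)^n * exp (\<gamma> * t)" if "0 \<le> t" "t \<le> T" for n t
    using that
  proof (induction n arbitrary: t)
    case 0
    have "?\<omega> t \<le> L2_norm (v t) + L2_norm (w t)" by (rule L2_norm_triangle_diff[OF vL[OF 0(1)] wL[OF 0(1)]])
    also have "\<dots> \<le> mv + mw" by (rule add_mono[OF mv(1)[OF 0] mw(1)[OF 0]])
    also have "\<dots> \<le> (mv + mw) * exp (\<gamma> * t)"
      using mult_left_mono[of 1 "exp (\<gamma> * t)" "mv + mw"] mv mw \<gamma> 0 by simp
    finally show ?case by simp
  next
    case (Suc n)
    show ?case using improve[OF _ Suc.IH Suc.prems] mv mw by simp
  qed
  have "(\<lambda>n. (mv + mw) * (1/2)^n * exp (\<gamma> * T)) \<longlonglongrightarrow> (mv + mw) * 0 * exp (\<gamma> * T)"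
    by (intro tendsto_intros LIMSEQ_realpow_zero) auto
  then have "?\<omega> T \<le> (mv + mw) * 0 * exp (\<gamma> * T)"
    by (rule LIMSEQ_le_const) (use small[OF T order_refl] in blast)
  then have "?\<omega> T = 0" using L2_norm_nonneg[of "\<lambda>k. v T k - w T k"] by linarith
  from L2_norm_eq_0[OF L2_diff[OF vL[OF T] wL[OF T]] this]
  show ?thesis by eventually_elim simp
qed

end

section \<open>Existence, uniqueness and decay\<close>

lemma Linf_norm_AE:
  fixes f :: "'a::euclidean_space \<Rightarrow> complex"
  assumes "f \<in> Linf_space"
  shows "0 \<le> Linf_norm f" "AE x in lborel. norm (f x) \<le> Linf_norm f"
proof -
  let ?e = "esssup lborel (\<lambda>x. ereal (norm (f x)))"
  have fin: "?e < \<infinity>" using assms by (simp add: Linf_space_def)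
  have ae: "AE x in lborel. ereal (norm (f x)) \<le> ?e" by (rule esssup_AE)
  have nn: "0 \<le> ?e"
  proof (rule ccontr)
    assume neg: "\<not> 0 \<le> ?e"
    from ae have "AE x in (lborel :: 'a measure). False"
    proof eventually_elim
      case (elim x)
      have "0 \<le> ereal (norm (f x))" by simp
      also have "\<dots> \<le> ?e" by (rule elim)
      finally show False using neg by simp
    qed
    then have "emeasure (lborel :: 'a measure) (space lborel) = 0"
      by (simp add: eventually_False ae_filter_eq_bot_iff)
    then show False by simp
  qed
  with fin obtain r where r: "?e = ereal r" "0 \<le> r" by (cases ?e) auto
  then have L: "Linf_norm f = r" by (simp add: Linf_norm_def)
  then show "0 \<le> Linf_norm f" using r by simp
  show "AE x in lborel. norm (f x) \<le> Linf_norm f"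
    using ae unfolding L r(1) by simp
qed

lemma Linf_normI:
  fixes f :: "'a::euclidean_space \<Rightarrow> complex"
  assumes f: "f \<in> borel_measurable borel" and c: "0 \<le> c" and ae: "AE x in lborel. norm (f x) \<le> c"
  shows "f \<in> Linf_space" "Linf_norm f \<le> c"
proof -
  have "esssup lborel (\<lambda>x. ereal (norm (f x))) \<le> ereal c"
    using f ae by (intro esssup_I) auto
  then show "f \<in> Linf_space" "Linf_norm f \<le> c"
    using f c unfolding Linf_space_def Linf_norm_def
    by (cases "esssup lborel (\<lambda>x. ereal (norm (f x)))"; auto)+
qed

text \<open>
  Replacing a function by zero where it exceeds its essential supremum only changes a null set and turns
  almost everywhere bounds into bounds that hold everywhere.
\<close>

definition cutoff :: "real \<Rightarrow> ('a \<Rightarrow> complex) \<Rightarrow> 'a \<Rightarrow> complex" where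
  "cutoff c f x = (if norm (f x) \<le> c then f x else 0)"

lemma cutoff_le: "0 \<le> c \<Longrightarrow> norm (cutoff c f x) \<le> c" "norm (cutoff c f x) \<le> norm (f x)"
  by (simp_all add: cutoff_def)

lemma cutoff_measurable [measurable]:
  assumes [measurable]: "f \<in> borel_measurable M"
  shows "cutoff c f \<in> borel_measurable M"
  unfolding cutoff_def[abs_def] by measurable

lemma AE_cutoff:
  fixes f :: "'a::euclidean_space \<Rightarrow> complex"
  assumes "f \<in> Linf_space"
  shows "AE x in lborel. f x = cutoff (Linf_norm f) f x"
  using Linf_norm_AE(2)[OF assms] by eventually_elim (simp add: cutoff_def)

lemma XB_L2:
  assumes f: "XB (nrm f) A B" and [measurable]: "f \<in> borel_measurable borel"
  shows "integrable lborel f" "f \<in> L2_space" "L2_norm f \<le> sqrt (A * B)" "L1_norm f \<le> B" "\<And>k. norm (f k) \<le> A"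
proof -
  note F = XBD[OF f]
  show i: "integrable lborel f" using F(5) by (intro integrableI_bounded) (auto intro: le_less_trans)
  have "ennreal (L1_norm f) = (\<integral>\<^sup>+k. nrm f k \<partial>lborel)"
    unfolding L1_norm_def by (rule nn_integral_eq_integral[symmetric]) (use i in auto)
  with F(5) have "ennreal (L1_norm f) \<le> ennreal B" by (simp only:)
  then show "L1_norm f \<le> B" using F(3) by (simp only: ennreal_le_iff)
  show A: "norm (f k) \<le> A" for k using F(4)[of k] F(2) by simp
  have "(\<integral>\<^sup>+k. ennreal ((norm (f k))\<^sup>2) \<partial>lborel) \<le> (\<integral>\<^sup>+k. ennreal A * nrm f k \<partial>lborel)"
    using A F(2) by (intro nn_integral_mono) (auto simp: power2_eq_square ennreal_mult[symmetric] intro!: ennreal_leI mult_right_mono)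
  also have "\<dots> = ennreal A * (\<integral>\<^sup>+k. nrm f k \<partial>lborel)" by (rule nn_integral_cmult) measurable
  also have "\<dots> \<le> ennreal A * ennreal B" by (intro mult_left_mono F(5)) simp
  also have "\<dots> = ennreal ((sqrt (A * B))\<^sup>2)" using F(2,3) by (simp add: ennreal_mult)
  finally have "(\<integral>\<^sup>+k. ennreal ((norm (f k))\<^sup>2) \<partial>lborel) \<le> ennreal ((sqrt (A * B))\<^sup>2)" .
  then show "f \<in> L2_space" "L2_norm f \<le> sqrt (A * B)"
    by (rule L2_norm_leI; use F(2,3) in simp)+
qed

text \<open>
  The value at a frequency \<open>k\<close> with a good section of the kernel is independent of representatives. Such \<open>k\<close>
  form a set of full measure that does not depend on time, hence the exceptional sets for different times
  do not accumulate inside the Duhamel integral.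
\<close>

lemma fourier_bilinear_eq:
  assumes u: "u \<in> L2_space" and f: "AE l in lborel. fourier u l = f l" and [measurable]: "f \<in> borel_measurable borel"
    and K [measurable]: "K \<in> borel_measurable borel" "K' \<in> borel_measurable borel"
    and KK: "AE l in lborel. K (k, l) = K' (k, l)"
  shows "fourier_bilinear K u u k = bil K' f f k"
proof -
  have [measurable]: "fourier u \<in> borel_measurable borel" by (rule L2_spaceD(1)[OF fourier_L2[OF u]])
  have "AE l in lborel. fourier u (k + -1 * l) = f (k + -1 * l)"
    by (rule AE_borel_affine[OF _ _ f]) measurable
  then have f': "AE l in lborel. fourier u (k - l) = f (k - l)" by simp
  show ?thesis
    unfolding fourier_bilinear_def bil_def
  proof (rule integral_cong_AE)
    show "AE l in lborel. K (k, l) * fourier u (k - l) * fourier u l = K' (k, l) * f (k - l) * f l"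
      using f f' KK by eventually_elim simp
  qed measurable
qed

lemma continuous_L2_fourier:
  assumes "continuous_L2 u"
  shows "L2_continuous (\<lambda>t. fourier (u t))"
  unfolding L2_continuous_def
proof (intro conjI allI impI)
  have u: "u t \<in> L2_space" if "0 \<le> t" for t using assms that by (simp add: continuous_L2_def)
  fix t :: real assume t: "0 \<le> t"
  show "fourier (u t) \<in> L2_space" by (rule fourier_L2[OF u[OF t]])
  have "((\<lambda>s. sqrt (2 * pi) * L2_norm (\<lambda>x. u s x - u t x)) \<longlongrightarrow> sqrt (2 * pi) * 0) (at t within {0..})"
    by (intro tendsto_intros) (use assms t in \<open>simp add: continuous_L2_def\<close>)
  moreover have "\<forall>\<^sub>F s in at t within {0..}. sqrt (2 * pi) * L2_norm (\<lambda>x. u s x - u t x) = L2_norm (\<lambda>k. fourier (u s) k - fourier (u t) k)"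
  proof -
    have "\<forall>\<^sub>F s in at t within {0..}. s \<in> {0..}" by (simp add: eventually_at_filter)
    then show ?thesis by eventually_elim (use fourier_isometry[OF u u] t in simp)
  qed
  ultimately show "((\<lambda>s. L2_norm (\<lambda>k. fourier (u s) k - fourier (u t) k)) \<longlongrightarrow> 0) (at t within {0..})"
    using filterlim_cong[OF refl refl] by fastforce
qed

context small_data
begin

lemma solution_measurable: "solution t \<in> borel_measurable borel"
  by measurable

text \<open>
  The solution is continuous in time at every frequency, and its majorant is bounded and integrable, hence
  square integrable.
\<close>

lemma solution_L2_continuous: "L2_continuous solution"
  unfolding L2_continuous_def
proof (intro conjI allI impI)
  have S: "XB (nrm (solution t)) M M" if "0 \<le> t" for t by (rule bnd_forcing(4)[OF bnd_solution that])
  fix t :: real assume t: "0 \<le> t"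
  show "solution t \<in> L2_space" by (rule XB_L2(2)[OF S[OF t] solution_measurable])
  show "((\<lambda>s. L2_norm (\<lambda>k. solution s k - solution t k)) \<longlongrightarrow> 0) (at t within {0..})"
    unfolding tendsto_at_iff_sequentially comp_def
  proof (intro allI impI)
    fix x :: "nat \<Rightarrow> real" assume x: "\<forall>n. x n \<in> {0..} - {t}" and lim: "x \<longlonglongrightarrow> t"
    obtain T where T: "\<And>n. x n \<le> T" using convergent_imp_Bseq[OF convergentI[OF lim]]
      by (metis BseqE abs_le_D1 real_norm_def)
    have x0: "0 \<le> x n" for n using x by auto
    have tT: "t \<le> T" by (rule LIMSEQ_le_const2[OF lim]) (use T in auto)
    have T0: "0 \<le> T" using t tT by simp
    obtain h A where h: "XB h A A" and fh: "\<And>t k. 0 \<le> t \<and> t \<le> T \<Longrightarrow> ennreal (norm (solution t k)) \<le> h k"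
      using dominated_solution T0 unfolding dominated_def by blast
    note [measurable] = XBD(1)[OF h] solution_measurable
    have "(\<lambda>n. \<integral>\<^sup>+k. ennreal ((norm (solution (x n) k - solution t k))\<^sup>2) \<partial>lborel) \<longlonglongrightarrow> (\<integral>\<^sup>+k. 0 \<partial>(lborel :: real measure))"
    proof (rule nn_integral_dominated_convergence[where w="\<lambda>k. ennreal (4 * A) * h k"])
      have "(\<integral>\<^sup>+k. ennreal (4 * A) * h k \<partial>lborel) = ennreal (4 * A) * (\<integral>\<^sup>+k. h k \<partial>lborel)"
        by (rule nn_integral_cmult) measurable
      also have "\<dots> \<le> ennreal (4 * A) * ennreal A" by (intro mult_left_mono XBD(5)[OF h]) simp
      also have "\<dots> < \<infinity>" by (simp add: ennreal_mult_less_top)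
      finally show "(\<integral>\<^sup>+k. ennreal (4 * A) * h k \<partial>lborel) < \<infinity>" .
      show "AE k in lborel. (\<lambda>n. ennreal ((norm (solution (x n) k - solution t k))\<^sup>2)) \<longlonglongrightarrow> 0"
      proof (rule AE_I2)
        fix k
        have "(\<lambda>n. solution (x n) k) \<longlonglongrightarrow> solution t k"
          using continuous_solution[of T k] x0 T t tT lim
          unfolding continuous_on_sequentially comp_def by simp
        then have "(\<lambda>n. (norm (solution (x n) k - solution t k))\<^sup>2) \<longlonglongrightarrow> (norm (solution t k - solution t k))\<^sup>2"
          by (intro tendsto_intros)
        then have "(\<lambda>n. (norm (solution (x n) k - solution t k))\<^sup>2) \<longlonglongrightarrow> 0"
          by (simp only: diff_self norm_zero power_zero_numeral)
        then show "(\<lambda>n. ennreal ((norm (solution (x n) k - solution t k))\<^sup>2)) \<longlonglongrightarrow> 0"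
          by (rule tendsto_ennrealI[where x=0, unfolded ennreal_0])
      qed
      show "AE k in lborel. ennreal ((norm (solution (x n) k - solution t k))\<^sup>2) \<le> ennreal (4 * A) * h k" for n
      proof (rule AE_I2)
        fix k
        have A: "0 \<le> A" by (rule XBD(2)[OF h])
        have hk: "h k \<noteq> \<infinity>" using XBD(4)[OF h, of k] by (auto simp: top_unique)
        then obtain r where r: "h k = ennreal r" "0 \<le> r" by (rule ennreal_finiteE)
        have rA: "r \<le> A" using XBD(4)[OF h, of k] A unfolding r(1) by simp
        have "norm (solution (x n) k) \<le> r" "norm (solution t k) \<le> r"
          using fh[of "x n" k] fh[of t k] x0 T t tT r by auto
        then have "norm (solution (x n) k - solution t k) \<le> 2 * r"
          using norm_triangle_ineq4[of "solution (x n) k" "solution t k"] by linarith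
        then have "(norm (solution (x n) k - solution t k))\<^sup>2 \<le> (2 * r)\<^sup>2" by (rule power_mono) simp
        also have "\<dots> \<le> 4 * A * r" using rA r(2) by (simp add: power2_eq_square mult_right_mono)
        finally show "ennreal ((norm (solution (x n) k - solution t k))\<^sup>2) \<le> ennreal (4 * A) * h k"
          unfolding r(1) using A r(2) by (subst ennreal_mult[symmetric]) (auto intro: ennreal_leI)
      qed
    qed measurable
    moreover have "(\<integral>\<^sup>+k. ennreal ((norm (solution (x n) k - solution t k))\<^sup>2) \<partial>lborel)
        = ennreal ((L2_norm (\<lambda>k. solution (x n) k - solution t k))\<^sup>2)" for n
      by (rule nn_integral_L2) (intro L2_diff XB_L2(2)[OF S solution_measurable] x0 t)
    ultimately have "(\<lambda>n. ennreal ((L2_norm (\<lambda>k. solution (x n) k - solution t k))\<^sup>2)) \<longlonglongrightarrow> 0" by simp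
    then have "(\<lambda>n. (L2_norm (\<lambda>k. solution (x n) k - solution t k))\<^sup>2) \<longlonglongrightarrow> 0"
      using tendsto_ennreal_iff[of "\<lambda>n. (L2_norm (\<lambda>k. solution (x n) k - solution t k))\<^sup>2" sequentially 0] by simp
    from tendsto_real_sqrt[OF this]
    show "(\<lambda>n. L2_norm (\<lambda>k. solution (x n) k - solution t k)) \<longlonglongrightarrow> 0" by simp
  qed
qed

text \<open>
  The solution in physical space.
\<close>

definition flow :: "real \<Rightarrow> real \<Rightarrow> complex" where
  "flow t = inverse_fourier_integral (solution t)"

lemma solution_L1_L2:
  assumes "0 \<le> t"
  shows "integrable lborel (solution t)" "solution t \<in> L2_space"
    "L2_norm (solution t) \<le> M * sqrt (rho t)" "L1_norm (solution t) \<le> M * rho t" "norm (solution t k) \<le> M"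
proof -
  have S: "XB (nrm (solution t)) M (M * rho t)" using bnd_solution assms by (simp add: bnd_def)
  note X = XB_L2[OF S solution_measurable]
  show "integrable lborel (solution t)" "solution t \<in> L2_space" "L1_norm (solution t) \<le> M * rho t" "norm (solution t k) \<le> M"
    by (rule X)+
  have "sqrt (M * (M * rho t)) = M * sqrt (rho t)"
    using M_nonneg by (simp add: real_sqrt_mult mult.assoc[symmetric])
  then show "L2_norm (solution t) \<le> M * sqrt (rho t)" using X(3) by simp
qed

lemma flow_L2:
  assumes "0 \<le> t"
  shows "flow t \<in> L2_space" "AE k in lborel. fourier (flow t) k = solution t k"
    "L2_norm (flow t) \<le> L2_norm (solution t)"
proof -
  note S = solution_L1_L2(1,2)[OF assms]
  show F: "flow t \<in> L2_space" unfolding flow_def by (rule inverse_fourier_integral_L2(1)[OF S])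
  show "AE k in lborel. fourier (flow t) k = solution t k"
    by (rule fourier_eqI[OF F]) (unfold flow_def, rule is_fourier_inverse_fourier_integral[OF S])
  have "1 * L2_norm (flow t) \<le> sqrt (2 * pi) * L2_norm (flow t)"
    by (rule mult_right_mono) (use pi_gt3 in auto)
  also have "\<dots> = L2_norm (solution t)"
    unfolding flow_def by (rule inverse_fourier_integral_L2(2)[OF S, symmetric])
  finally show "L2_norm (flow t) \<le> L2_norm (solution t)" by simp
qed

lemma continuous_L2_flow: "continuous_L2 flow"
  unfolding continuous_L2_def
proof (intro conjI allI impI flow_L2(1))
  fix t :: real assume t: "0 \<le> t"
  show "((\<lambda>s. L2_norm (\<lambda>x. flow s x - flow t x)) \<longlongrightarrow> 0) (at t within {0..})"
  proof (rule Lim_null_comparison)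
    show "((\<lambda>s. L2_norm (\<lambda>k. solution s k - solution t k)) \<longlongrightarrow> 0) (at t within {0..})"
      using solution_L2_continuous t by (simp add: L2_continuous_def)
    have "\<forall>\<^sub>F s in at t within {0..}. s \<in> {0..}" by (simp add: eventually_at_filter)
    then show "\<forall>\<^sub>F s in at t within {0..}. norm (L2_norm (\<lambda>x. flow s x - flow t x)) \<le> L2_norm (\<lambda>k. solution s k - solution t k)"
    proof eventually_elim
      case (elim s)
      then have s: "0 \<le> s" by simp
      note Ss = solution_L1_L2(1,2)[OF s] and St = solution_L1_L2(1,2)[OF t]
      have eq: "(\<lambda>x. flow s x - flow t x) = inverse_fourier_integral (\<lambda>k. solution s k - solution t k)"
        unfolding flow_def inverse_fourier_integral_def fun_eq_iff
        by (simp add: fourier_integral_diff[OF Ss(1) St(1)] diff_divide_distrib)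
      have "1 * L2_norm (\<lambda>x. flow s x - flow t x) \<le> sqrt (2 * pi) * L2_norm (\<lambda>x. flow s x - flow t x)"
        by (rule mult_right_mono) (use pi_gt3 in auto)
      also have "\<dots> = L2_norm (\<lambda>k. solution s k - solution t k)"
        unfolding eq by (rule inverse_fourier_integral_L2(2)[symmetric]) (use Ss St in \<open>auto intro: L2_diff\<close>)
      finally show ?case by simp
    qed
  qed
qed

lemma flow_Linf:
  assumes "0 \<le> t"
  shows "flow t \<in> Linf_space" "Linf_norm (flow t) \<le> L1_norm (solution t)"
proof -
  have le: "norm (flow t x) \<le> L1_norm (solution t)" for x
  proof -
    have "norm (flow t x) = norm (fourier_integral (solution t) (- x)) / (2 * pi)"
      by (simp add: flow_def inverse_fourier_integral_def norm_divide norm_mult)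
    also have "\<dots> \<le> norm (fourier_integral (solution t) (- x)) / 1"
      using pi_gt3 by (intro divide_left_mono) auto
    also have "\<dots> \<le> L1_norm (solution t)"
      using norm_fourier_integral_le[of "solution t" "- x"] by (simp add: L1_norm_def)
    finally show ?thesis .
  qed
  have "0 \<le> L1_norm (solution t)" by (simp add: L1_norm_def)
  then show "flow t \<in> Linf_space" "Linf_norm (flow t) \<le> L1_norm (solution t)"
    using Linf_normI[OF L2_spaceD(1)[OF flow_L2(1)[OF assms]], of "L1_norm (solution t)"] le by auto
qed

end

theorem theorem1p1:
  fixes d :: real and Bhat :: "real \<times> real \<Rightarrow> complex"
  assumes "d > 0" and "Bhat \<in> Linf_space"
  shows "\<exists>\<delta>>0. \<exists>C>0. \<forall>u\<^sub>0 \<in> L2_space.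
    fourier u\<^sub>0 \<in> L1_space \<inter> Linf_space \<longrightarrow> L1_Linf_norm (fourier u\<^sub>0) \<le> \<delta> \<longrightarrow>
    (\<exists>u. mild_solution d Bhat u\<^sub>0 u \<and>
      (\<forall>v. mild_solution d Bhat u\<^sub>0 v \<longrightarrow> (\<forall>t\<ge>0. AE x in lborel. v t x = u t x)) \<and>
      (\<forall>t\<ge>0.
        fourier (u t) \<in> L1_space \<inter> Linf_space \<and>
        u t \<in> Linf_space \<and>
        Linf_norm (u t) \<le> L1_norm (fourier (u t)) \<and>
        L1_norm (fourier (u t)) \<le> C * L1_Linf_norm (fourier u\<^sub>0) * (1 + t) powr (- (1 / 2)) \<and>
        L2_norm (u t) \<le> C * L1_Linf_norm (fourier u\<^sub>0) * (1 + t) powr (- (1 / 4)) \<and>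
        Linf_norm (fourier (u t)) \<le> C * L1_Linf_norm (fourier u\<^sub>0)))"
proof -
  define \<beta> where "\<beta> = Linf_norm Bhat"
  define b where "b = cutoff \<beta> Bhat"
  have \<beta>: "0 \<le> \<beta>" unfolding \<beta>_def by (rule Linf_norm_AE[OF assms(2)])
  have Bm [measurable]: "Bhat \<in> borel_measurable borel" using assms(2) by (simp add: Linf_space_def)
  have bm [measurable]: "b \<in> borel_measurable borel" unfolding b_def by measurable
  interpret bounded_kernel d \<beta> b
    by unfold_locales (use assms(1) bm cutoff_le(1)[OF \<beta>] in \<open>auto simp: b_def\<close>)
  have "AE z in lborel \<Otimes>\<^sub>M lborel. Bhat z = b z"
    unfolding b_def \<beta>_def lborel_prod by (rule AE_cutoff[OF assms(2)])
  then have good: "AE k in lborel. AE l in lborel. Bhat (k, l) = b (k, l)"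
    by (rule lborel_pair.AE_pair)
  \<comment> \<open>The factor 2 leaves half of the ball of radius \<open>C E\<close> to the nonlinear term.\<close>
  define C where "C = 2 * heat_const d"
  have C: "2 \<le> C" using heat_const_ge_1[OF assms(1)] by (simp add: C_def)
  \<comment> \<open>This gives \<open>growth * M \<le> 1/2\<close> and \<open>M \<le> 1\<close> for \<open>M = C E\<close> at once.\<close>
  define \<delta> where "\<delta> = 1 / (2 * (growth + 1) * C)"
  have \<delta>: "0 < \<delta>" using growth_nonneg C by (simp add: \<delta>_def)
  show ?thesis
  proof (rule exI[of _ \<delta>], intro conjI \<delta>, rule exI[of _ C], intro conjI ballI impI)
    show "0 < C" using C by simp
    fix u\<^sub>0 assume u0: "u\<^sub>0 \<in> L2_space" and g0: "fourier u\<^sub>0 \<in> L1_space \<inter> Linf_space"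
      and small: "L1_Linf_norm (fourier u\<^sub>0) \<le> \<delta>"
    define E where "E = L1_Linf_norm (fourier u\<^sub>0)"
    define g where "g = cutoff (Linf_norm (fourier u\<^sub>0)) (fourier u\<^sub>0)"
    have gi: "integrable lborel (fourier u\<^sub>0)" and gL: "fourier u\<^sub>0 \<in> Linf_space" using g0 by (auto simp: L1_space_def)
    have [measurable]: "fourier u\<^sub>0 \<in> borel_measurable borel" using gi by auto
    have gm [measurable]: "g \<in> borel_measurable borel" unfolding g_def by measurable
    have gAE: "AE k in lborel. fourier u\<^sub>0 k = g k" unfolding g_def by (rule AE_cutoff[OF gL])
    have n0: "0 \<le> Linf_norm (fourier u\<^sub>0)" "0 \<le> L1_norm (fourier u\<^sub>0)"
      using Linf_norm_AE(1)[OF gL] by (simp_all add: L1_norm_def)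
    have gX: "XB (nrm g) E E"
    proof (rule XBI)
      show "0 \<le> E" "0 \<le> E" using n0 by (simp_all add: E_def L1_Linf_norm_def)
      show "nrm g k \<le> ennreal E" for k
        using cutoff_le(1)[OF n0(1), of "fourier u\<^sub>0" k] n0 by (intro ennreal_leI) (simp add: E_def L1_Linf_norm_def g_def)
      have "(\<integral>\<^sup>+k. nrm g k \<partial>lborel) \<le> (\<integral>\<^sup>+k. nrm (fourier u\<^sub>0) k \<partial>lborel)"
        unfolding g_def by (intro nn_integral_mono ennreal_leI cutoff_le)
      also have "\<dots> = ennreal (L1_norm (fourier u\<^sub>0))"
        unfolding L1_norm_def by (rule nn_integral_eq_integral) (use gi in auto)
      also have "\<dots> \<le> ennreal E" using n0 by (intro ennreal_leI) (simp add: E_def L1_Linf_norm_def)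
      finally show "(\<integral>\<^sup>+k. nrm g k \<partial>lborel) \<le> ennreal E" .
    qed measurable
    \<comment> \<open>The radius of the ball that the iteration preserves.\<close>
    define M where "M = C * E"
    have E0: "0 \<le> E" by (rule XBD(2)[OF gX])
    have M: "0 \<le> M" "M * (growth + 1) \<le> 1 / 2"
    proof -
      show "0 \<le> M" using E0 C by (simp add: M_def)
      have "C * E \<le> C * \<delta>" using small C by (intro mult_left_mono) (auto simp: E_def)
      also have "\<dots> = 1 / (2 * (growth + 1))" using C by (simp add: \<delta>_def)
      finally show "M * (growth + 1) \<le> 1 / 2" using growth_nonneg by (simp add: M_def field_simps)
    qed
    interpret small_data d \<beta> b g E M
    proof unfold_locales
      show "M = 2 * heat_const d * E" by (simp add: M_def C_def)
      have "0 \<le> M * growth" using M(1) growth_nonneg by simp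
      then show "M \<le> 1" "growth * M \<le> 1 / 2" using M by (simp_all add: distrib_left mult.commute)
    qed (use gm gX in auto)
    have mild: "AE k in lborel. fourier (u t) k = exp (of_real t * symbol d k) * fourier u\<^sub>0 k
          + (LINT s:{0..t}|lborel. exp (of_real (t - s) * symbol d k) * fourier_bilinear Bhat (u s) (u s) k)
        \<longleftrightarrow> fourier (u t) k = duhamel g (\<lambda>s. bil b (f s) (f s)) t k"
      if u: "\<forall>s\<ge>0. u s \<in> L2_space \<and> (AE l in lborel. fourier (u s) l = f s l) \<and> f s \<in> borel_measurable borel" and t: "0 \<le> t" for u :: "real \<Rightarrow> real \<Rightarrow> complex" and f t
      using good gAE
    proof eventually_elim
      case (elim k)
      have "fourier_bilinear Bhat (u s) (u s) k = bil b (f s) (f s) k" if "0 \<le> s" for s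
        by (rule fourier_bilinear_eq[OF _ _ _ Bm bm elim(1)]) (use u that in auto)
      then have "(LINT s:{0..t}|lborel. exp (of_real (t - s) * symbol d k) * fourier_bilinear Bhat (u s) (u s) k)
          = (LINT s:{0..t}|lborel. exp (of_real (t - s) * symbol d k) * bil b (f s) (f s) k)"
        by (intro set_lebesgue_integral_cong) auto
      then show ?case unfolding duhamel_def elim(2) by simp
    qed
    have msol: "mild_solution d Bhat u\<^sub>0 flow"
      unfolding mild_solution_def
    proof (intro conjI allI impI continuous_L2_flow)
      fix t :: real assume t: "0 \<le> t"
      show "AE k in lborel. fourier (flow t) k = exp (of_real t * symbol d k) * fourier u\<^sub>0 k
          + (LINT s:{0..t}|lborel. exp (of_real (t - s) * symbol d k) * fourier_bilinear Bhat (flow s) (flow s) k)"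
      proof -
        have "\<forall>s\<ge>0. flow s \<in> L2_space \<and> (AE l in lborel. fourier (flow s) l = solution s l) \<and> solution s \<in> borel_measurable borel"
          by (intro allI impI conjI flow_L2(1,2) solution_measurable)
        from mild[OF this t] flow_L2(2)[OF t] show ?thesis
          by eventually_elim (simp add: solution_duhamel[OF t])
      qed
    qed
    have mild_duhamel: "AE k in lborel. fourier (v t) k = duhamel g (\<lambda>s. bil b (fourier (v s)) (fourier (v s))) t k"
      if v: "mild_solution d Bhat u\<^sub>0 v" and t: "0 \<le> t" for v t
    proof -
      have vL: "v s \<in> L2_space" if "0 \<le> s" for s using v that by (simp add: mild_solution_def continuous_L2_def)
      have "AE k in lborel. fourier (v t) k = exp (of_real t * symbol d k) * fourier u\<^sub>0 k
          + (LINT s:{0..t}|lborel. exp (of_real (t - s) * symbol d k) * fourier_bilinear Bhat (v s) (v s) k)"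
        using v t by (simp add: mild_solution_def)
      moreover have "\<forall>s\<ge>0. v s \<in> L2_space \<and> (AE l in lborel. fourier (v s) l = fourier (v s) l)
          \<and> fourier (v s) \<in> borel_measurable borel"
        by (intro allI impI conjI vL AE_I2 refl L2_spaceD(1) fourier_L2)
      note mild[OF this t]
      ultimately show ?thesis by eventually_elim blast
    qed
    have uniq: "AE x in lborel. v t x = flow t x" if v: "mild_solution d Bhat u\<^sub>0 v" and t: "0 \<le> t" for v t
    proof (rule fourier_inj)
      show "v t \<in> L2_space" using v t by (simp add: mild_solution_def continuous_L2_def)
      show "flow t \<in> L2_space" by (rule flow_L2(1)[OF t])
      show "AE k in lborel. fourier (v t) k = fourier (flow t) k"
        by (rule duhamel_unique[OF continuous_L2_fourier continuous_L2_fourier mild_duhamel[OF v] mild_duhamel[OF msol] t])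
          (use v msol in \<open>simp_all add: mild_solution_def\<close>)
    qed
    have bounds: "fourier (flow t) \<in> L1_space \<inter> Linf_space \<and>
        flow t \<in> Linf_space \<and>
        Linf_norm (flow t) \<le> L1_norm (fourier (flow t)) \<and>
        L1_norm (fourier (flow t)) \<le> C * L1_Linf_norm (fourier u\<^sub>0) * (1 + t) powr (- (1 / 2)) \<and>
        L2_norm (flow t) \<le> C * L1_Linf_norm (fourier u\<^sub>0) * (1 + t) powr (- (1 / 4)) \<and>
        Linf_norm (fourier (flow t)) \<le> C * L1_Linf_norm (fourier u\<^sub>0)" if t: "0 \<le> t" for t
    proof -
      have rho1: "(1 + t) powr (- (1 / 2)) = rho t"
        using t by (simp add: rho_def powr_minus powr_half_sqrt inverse_eq_divide)
      have rho2: "(1 + t) powr (- (1 / 4)) = sqrt (rho t)"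
      proof -
        have "(1 + t) powr (- (1 / 4)) = ((1 + t) powr (- (1 / 2))) powr (1 / 2)" by (simp add: powr_powr)
        also have "\<dots> = sqrt (rho t)" unfolding rho1 using rho_bounds[OF t] by (simp add: powr_half_sqrt)
        finally show ?thesis .
      qed
      note S = solution_L1_L2[OF t] and F = flow_L2[OF t]
      have [measurable]: "fourier (flow t) \<in> borel_measurable borel" by (rule L2_spaceD(1)[OF fourier_L2[OF F(1)]])
      note [measurable] = solution_measurable
      have F1: "integrable lborel (fourier (flow t))"
        using S(1) F(2) by (subst integrable_cong_AE[where g="solution t"]) auto
      have F2: "L1_norm (fourier (flow t)) = L1_norm (solution t)"
        unfolding L1_norm_def by (rule integral_cong_AE) (use F(2) in auto)
      have "AE k in lborel. norm (fourier (flow t) k) \<le> M"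
        using F(2) by eventually_elim (simp add: S(5))
      then have F3: "fourier (flow t) \<in> Linf_space" "Linf_norm (fourier (flow t)) \<le> M"
        using M(1) by (auto intro!: Linf_normI)
      have "L2_norm (flow t) \<le> M * sqrt (rho t)" using F(3) S(3) by simp
      then show ?thesis
        using F1 F3 flow_Linf[OF t] S(4) unfolding F2 rho1 rho2 M_def E_def C_def
        by (simp add: L1_space_def F2)
    qed
    show "\<exists>u. mild_solution d Bhat u\<^sub>0 u \<and>
      (\<forall>v. mild_solution d Bhat u\<^sub>0 v \<longrightarrow> (\<forall>t\<ge>0. AE x in lborel. v t x = u t x)) \<and>
      (\<forall>t\<ge>0.
        fourier (u t) \<in> L1_space \<inter> Linf_space \<and>
        u t \<in> Linf_space \<and>
        Linf_norm (u t) \<le> L1_norm (fourier (u t)) \<and>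
        L1_norm (fourier (u t)) \<le> C * L1_Linf_norm (fourier u\<^sub>0) * (1 + t) powr (- (1 / 2)) \<and>
        L2_norm (u t) \<le> C * L1_Linf_norm (fourier u\<^sub>0) * (1 + t) powr (- (1 / 4)) \<and>
        Linf_norm (fourier (u t)) \<le> C * L1_Linf_norm (fourier u\<^sub>0))"
      using msol uniq bounds by (intro exI[of _ flow] conjI allI impI) auto
  qed
qed

end
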